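(* Let $\lambda(s)=\alpha s^{-1-\alpha}$ with $\alpha\in(0,1)$, let $\xi^\circ\sim\mathrm{GD}(\lambda,P^\circ)$, and let $\Pi_1,\Pi_2,\ldots\,|\,\xi^\circ$ be i.i.d. Bernoulli processes $\mathrm{BeP}(\xi^\circ)$. Let $U^*_1,\ldots,U^*_{K_n}$ be the distinct atoms observed in $\Pi_{1:n}=(\Pi_1,\ldots,\Pi_n)$, where $U^*_k$ is an atom of exactly $n_k>0$ of the measures $\Pi_1,\ldots,\Pi_n$. Define a random variable $\zeta_n$ by $\zeta_n^{-1/\alpha}\sim\mathcal{L}(\Delta^\circ\,|\,\Pi_{1:n})$, and put $\zeta:=(\Delta^\circ)^{-\alpha}$. Then $$\Pi_{n+1}\,|\,\Pi_1,\ldots,\Pi_n\ \stackrel{d}{=}\ \sum_{j=1}^{N(C_n)}\delta_{U_j}+\sum_{k=1}^{K_n}\mathbf{Z}_{n+1,k}\,\delta_{U^*_k},$$ where $N(C_n)$ is a $\mathrm{Poisson}(C_n)$ variable (given $C_n$), the $U_j$ are new i.i.d. atom locations with law $G$, and the variables $C_n$ and $\mathbf{Z}_{n+1,k}$ are conditionally independent given $\Delta^\circ$. Their laws are $$C_n\stackrel{d}{=}\zeta_n\,\alpha\,B(1-\alpha,n+1)\quad\text{and}\quad \mathbf{Z}_{n+1,k}\sim\mathrm{Bernoulli}(J_k)\quad\text{with}\quad J_k\sim\mathrm{Beta}(n_k-\alpha,\,n-n_k+1),$$ where $B$ is the beta function. The initial sample is marginally distributed as $\Pi_1\stackrel{d}{=}\sum_{j=1}^{N(C_0)}\delta_{U_j}$,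 with $N(C_0)\sim\mathrm{Poisson}\bigl(\frac{\zeta\alpha}{1-\alpha}\bigr)$ (given $\zeta$).
   Context: For the Lévy density $\lambda$, let $\Delta_1>\Delta_2>\cdots$ be the ranked jumps of a subordinator with Lévy density $\lambda$ (ranked points of a Poisson process on $(0,\infty)$ with intensity $\lambda(s)\,ds$). Let $U_1,U_2,\ldots$ be i.i.d. with non-atomic law $G$ on a space $\mathbb{U}$, independent of $(\Delta_k)$, and $\xi:=\sum_{k\ge1}\frac{\Delta_{k+1}}{\Delta_1}\delta_{U_k}$. For $a>0$, $\xi_a:=\xi\,|\,(\Delta_1=a)$ is a completely random measure with Lévy density $\lambda_a(s)=a\lambda(as)\mathbb{I}\{s\le1\}$. For a probability measure $P^\circ$ on $(0,\infty)$ and $\Delta^\circ\sim P^\circ$, the random measure $\xi^\circ:=\xi_{\Delta^\circ}$ (given $\Delta^\circ=a$, distributed as $\xi_a$) has law $\mathrm{GD}(\lambda,P^\circ)$. For a discrete measure $m=\sum_kw_k\delta_{u_k}$ with $w_k\in[0,1]$ and $\sum_kw_k<\infty$, $\mathrm{BeP}(m)$ is the law of $\sum_kZ_k\delta_{u_k}$ with independent $Z_k\sim\mathrm{Bernoulli}(w_k)$. *)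

theory Defs
  imports "HOL-Probability.Probability"
begin

text \<open>The measurable space of all measures on \<open>K\<close>, with the sigma-algebra generated by the
  evaluations; this is \<^const>\<open>subprob_algebra\<close> without the bound on the total mass.\<close>

definition measure_algebra :: "'u measure \<Rightarrow> 'u measure measure" where
  "measure_algebra K =
     (SUP A\<in>sets K. vimage_algebra {m. sets m = sets K} (\<lambda>m. emeasure m A) borel)"

text \<open>The space is countably separated (as every Polish space is); for a probability measure this
  makes singletons and the diagonal measurable, so that coincidences of atom locations are events.\<close>

definition countably_separated :: "'u measure \<Rightarrow> bool" where
  "countably_separated K \<longleftrightarrow>
     (\<exists>C. countable C \<and> C \<subseteq> sets K \<and>
        (\<forall>x\<in>space K. \<forall>y\<in>space K. x \<noteq> y \<longrightarrow> (\<exists>A\<in>C. (x \<in> A) \<noteq> (y \<in> A))))"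

text \<open>\<open>\<kappa>\<close> is a version of the conditional law of \<open>Y\<close> given \<open>X\<close>. Only almost sure properties of
  \<open>\<kappa>\<close> are required, so \<open>\<kappa>\<close> may be arbitrary on values that \<open>X\<close> almost surely avoids.\<close>

definition cond_law ::
  "'a measure \<Rightarrow> 'b measure \<Rightarrow> ('a \<Rightarrow> 'b) \<Rightarrow> 'c measure \<Rightarrow> ('a \<Rightarrow> 'c) \<Rightarrow> ('b \<Rightarrow> 'c measure) \<Rightarrow> bool"
  where
  "cond_law M MX X MY Y \<kappa> \<longleftrightarrow>
     X \<in> M \<rightarrow>\<^sub>M MX \<and> Y \<in> M \<rightarrow>\<^sub>M MY \<and>
     (AE \<omega> in M. \<kappa> (X \<omega>) \<in> space (prob_algebra MY)) \<and>
     (\<forall>B\<in>sets MY. AE \<omega> in M.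
        real_cond_exp M (vimage_algebra (space M) X MX) (indicator (Y -` B \<inter> space M)) \<omega>
          = measure (\<kappa> (X \<omega>)) B)"


subsection \<open>Poisson processes and scaled subordinators\<close>

text \<open>\<^const>\<open>poisson_pmf\<close> is specified for positive means only; mean \<open>0\<close> is needed for null sets.\<close>

definition poisson_law :: "real \<Rightarrow> nat pmf" where
  "poisson_law c = (if 0 < c then poisson_pmf c else return_pmf 0)"

text \<open>The family \<open>X\<close> enumerates the points of a Poisson process with intensity measure \<open>\<mu>\<close>.
  Finiteness is explicit because \<^const>\<open>card\<close> of an infinite set is \<open>0\<close>.\<close>

definition poisson_points :: "'a measure \<Rightarrow> 'b measure \<Rightarrow> (nat \<Rightarrow> 'a \<Rightarrow> 'b) \<Rightarrow> bool" where
  "poisson_points M \<mu> X \<longleftrightarrow>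
     (\<forall>k. X k \<in> M \<rightarrow>\<^sub>M \<mu>) \<and>
     (\<forall>B\<in>sets \<mu>. emeasure \<mu> B < \<infinity> \<longrightarrow>
        (AE \<omega> in M. finite {k. X k \<omega> \<in> B}) \<and>
        distr M (count_space UNIV) (\<lambda>\<omega>. card {k. X k \<omega> \<in> B})
          = measure_pmf (poisson_law (measure \<mu> B))) \<and>
     (\<forall>F :: nat \<Rightarrow> 'b set. range F \<subseteq> sets \<mu> \<and> disjoint_family F \<and> (\<forall>i. emeasure \<mu> (F i) < \<infinity>) \<longrightarrow>
        prob_space.indep_vars M (\<lambda>_. count_space UNIV) (\<lambda>i \<omega>. card {k. X k \<omega> \<in> F i}) UNIV)"

text \<open>\<open>J\<close> is the joint law of the ranked points (jumps of a subordinator) of a Poisson process on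
  the positive half-line with intensity \<open>\<rho>(s) ds\<close>, where \<open>\<rho>\<close> has infinite mass. The largest point
  has index \<open>0\<close>.\<close>

definition ranked_jumps_law :: "(real \<Rightarrow> real) \<Rightarrow> (nat \<Rightarrow> real) measure \<Rightarrow> bool" where
  "ranked_jumps_law \<rho> J \<longleftrightarrow>
     prob_space J \<and> sets J = sets (PiM UNIV (\<lambda>_. borel)) \<and>
     (AE \<delta> in J. \<forall>k. 0 < \<delta> k \<and> \<delta> (Suc k) < \<delta> k) \<and>
     poisson_points J (density lborel (\<lambda>s. ennreal (\<rho> s) * indicator {0<..} s)) (\<lambda>k \<delta>. \<delta> k)"

text \<open>The measure \<open>\<Sum>k. w k \<cdot> \<delta>(u k)\<close>.\<close>

definition discrete_measure :: "'u measure \<Rightarrow> (nat \<Rightarrow> real) \<Rightarrow> (nat \<Rightarrow> 'u) \<Rightarrow> 'u measure" where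
  "discrete_measure G w u = distr (point_measure UNIV (\<lambda>k. ennreal (w k))) G u"

text \<open>\<open>L\<close> is the law of a homogeneous completely random measure with Levy density \<open>\<rho>\<close> and i.i.d.
  atom locations with law \<open>G\<close>.\<close>

definition crm_law :: "(real \<Rightarrow> real) \<Rightarrow> 'u measure \<Rightarrow> 'u measure measure \<Rightarrow> bool" where
  "crm_law \<rho> G L \<longleftrightarrow>
     (\<exists>J. ranked_jumps_law \<rho> J \<and>
        L = distr (J \<Otimes>\<^sub>M PiM UNIV (\<lambda>_. G)) (measure_algebra G)
              (\<lambda>(w, u). discrete_measure G w u))"

definition scaled_density :: "(real \<Rightarrow> real) \<Rightarrow> real \<Rightarrow> real \<Rightarrow> real" where
  "scaled_density \<rho> a s = a * \<rho> (a * s) * indicator {..1} s"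

text \<open>\<open>\<kappa> a\<close> is the law of \<open>\<xi>\<close> given \<open>\<Delta>\<^sub>1 = a\<close>, where \<open>\<xi> = \<Sum>k\<ge>1. (\<Delta>\<^sub>k\<^sub>+\<^sub>1 / \<Delta>\<^sub>1) \<cdot> \<delta>(U\<^sub>k)\<close>.
  Conditioning alone determines \<open>\<kappa>\<close> only up to a null set of the law of \<open>\<Delta>\<^sub>1\<close>, whereas \<open>\<kappa>\<close> is
  going to be mixed over an arbitrary law on the positive reals; the first conjunct selects
  the version for every \<open>a > 0\<close>.\<close>

definition scaled_kernel :: "(real \<Rightarrow> real) \<Rightarrow> 'u measure \<Rightarrow> (real \<Rightarrow> 'u measure measure) \<Rightarrow> bool" where
  "scaled_kernel \<rho> G \<kappa> \<longleftrightarrow>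
     (\<forall>a>0. crm_law (scaled_density \<rho> a) G (\<kappa> a)) \<and>
     (\<forall>J. ranked_jumps_law \<rho> J \<longrightarrow>
        cond_law (J \<Otimes>\<^sub>M PiM UNIV (\<lambda>_. G))
          borel (\<lambda>(\<delta>, u). \<delta> 0)
          (measure_algebra G) (\<lambda>(\<delta>, u). discrete_measure G (\<lambda>k. \<delta> (Suc k) / \<delta> 0) u)
          \<kappa>)"

text \<open>\<open>\<xi>\<close> is a random measure with law \<open>GD(\<rho>, P)\<close>, where \<open>D\<close> is the mixing variable \<open>\<Delta>\<degree>\<close>.\<close>

definition GD :: "(real \<Rightarrow> real) \<Rightarrow> real measure \<Rightarrow> 'u measure \<Rightarrow>
    'a measure \<Rightarrow> ('a \<Rightarrow> real) \<Rightarrow> ('a \<Rightarrow> 'u measure) \<Rightarrow> bool" where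
  "GD \<rho> P G M D \<xi> \<longleftrightarrow>
     distr M borel D = P \<and>
     (\<exists>\<kappa>. scaled_kernel \<rho> G \<kappa> \<and> cond_law M borel D (measure_algebra G) \<xi> \<kappa>)"


subsection \<open>Bernoulli processes and the predictive law\<close>

definition atoms :: "'u measure \<Rightarrow> 'u set" where
  "atoms m = {x \<in> space m. emeasure m {x} \<noteq> 0}"

text \<open>The law of \<open>\<Sum>x. Z x \<cdot> \<delta>(x)\<close> over the atoms \<open>x\<close> of a discrete measure \<open>m\<close>, with independent
  \<open>Z x\<close> that are \<open>Bernoulli (m {x})\<close>.\<close>

definition BeP :: "'u measure \<Rightarrow> 'u measure measure" where
  "BeP m = distr (PiM (atoms m) (\<lambda>x. measure_pmf (bernoulli_pmf (measure m {x}))))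
     (measure_algebra m) (\<lambda>z. distr (count_space {x \<in> atoms m. z x}) m (\<lambda>x. x))"

definition observed :: "nat \<Rightarrow> (nat \<Rightarrow> 'u measure) \<Rightarrow> 'u set" where
  "observed n \<pi> = (\<Union>i<n. atoms (\<pi> i))"

definition multiplicity_of :: "nat \<Rightarrow> (nat \<Rightarrow> 'u measure) \<Rightarrow> 'u \<Rightarrow> nat" where
  "multiplicity_of n \<pi> x = card {i. i < n \<and> x \<in> atoms (\<pi> i)}"

definition beta_law :: "real \<Rightarrow> real \<Rightarrow> real measure" where
  "beta_law a b = density lborel
     (\<lambda>x. ennreal (indicator {0<..<1} x * x powr (a - 1) * (1 - x) powr (b - 1) / Beta a b))"

definition beta_bernoulli_law :: "real \<Rightarrow> real \<Rightarrow> bool measure" where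
  "beta_bernoulli_law a b = beta_law a b \<bind> (\<lambda>p. measure_pmf (bernoulli_pmf p))"

text \<open>The law of \<open>\<Sum>j<N. \<delta>(u j)\<close> with \<open>N\<close> Poisson with mean \<open>c\<close> and i.i.d. \<open>u j\<close> with law \<open>G\<close>.\<close>

definition poisson_atoms_law :: "'u measure \<Rightarrow> real \<Rightarrow> 'u measure measure" where
  "poisson_atoms_law G c =
     distr (measure_pmf (poisson_law c) \<Otimes>\<^sub>M PiM UNIV (\<lambda>_. G)) (measure_algebra G)
       (\<lambda>(N, u). distr (count_space {..<N}) G u)"

definition add_measure :: "'u measure \<Rightarrow> 'u measure \<Rightarrow> 'u measure" where
  "add_measure \<mu> \<nu> = measure_of (space \<mu>) (sets \<mu>) (\<lambda>A. emeasure \<mu> A + emeasure \<nu> A)"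

text \<open>The law of the new atoms plus the re-observed ones, where \<open>Q\<close> is the law of \<open>\<Delta>\<degree>\<close> given the
  sample \<open>\<pi>\<close>. Drawing \<open>a\<close> from \<open>Q\<close> makes \<open>a powr -\<alpha>\<close> a copy of \<open>\<zeta>\<^sub>n\<close>, and the Poisson mean is
  \<open>C\<^sub>n\<close>; given \<open>a\<close>, the new atoms and all the Beta-Bernoulli variables are independent. The
  observed atoms are indexed by themselves, not by \<open>1, \<dots>, K\<^sub>n\<close>.\<close>

definition predictive_law ::
  "real \<Rightarrow> 'u measure \<Rightarrow> nat \<Rightarrow> (nat \<Rightarrow> 'u measure) \<Rightarrow> real measure \<Rightarrow> 'u measure measure" where
  "predictive_law \<alpha> G n \<pi> Q = Q \<bind> (\<lambda>a.
     distr
       (poisson_atoms_law G (a powr (-\<alpha>) * \<alpha> * Beta (1 - \<alpha>) (real n + 1)) \<Otimes>\<^sub>M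
        PiM (observed n \<pi>) (\<lambda>x. beta_bernoulli_law (real (multiplicity_of n \<pi> x) - \<alpha>)
                                                  (real n - real (multiplicity_of n \<pi> x) + 1)))
       (measure_algebra G)
       (\<lambda>(\<nu>, z). add_measure \<nu> (distr (count_space {x \<in> observed n \<pi>. z x}) G (\<lambda>x. x))))"

text \<open>The first \<open>n\<close> samples \<open>X 0, \<dots>, X (n - 1)\<close>, jointly.\<close>

definition sample :: "nat \<Rightarrow> (nat \<Rightarrow> 'a \<Rightarrow> 'b) \<Rightarrow> 'a \<Rightarrow> nat \<Rightarrow> 'b" where
  "sample n X \<omega> = (\<lambda>i\<in>{..<n}. X i \<omega>)"

end

(* Conditionally on the random measure, a sample of n Bernoulli processes marks every atom of weight w
   independently with a pattern Z, a subset of {0..n-1}, with probability w^|Z| (1 - w)^(n - |Z|).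
   By the Laplace functional of a Poisson process, the expectation of a product over the atoms of
   functions of (pattern, location) is therefore an explicit exponential.  Such products include the
   indicators of the avoidance events "sample i has no atom in A i for all i < n", and these form a
   pi-system that determines the joint law of simple point processes (Renyi).  It thus suffices to
   compare, for n + 1 samples, the avoidance probabilities of the true law with those obtained by
   appending one draw from the predictive kernel to n samples; both are exponentials, whose exponents
   agree because the reappearance probability of an atom seen j times is the quotient of the Beta
   integrals with exponents j + 1 and j.

   All this takes place conditionally on the mixing variable, whereas the samples are only related to
   the random measure: the two conditionings are reconciled by showing that the mixing variable is
   almost surely a function of the random measure, a law of large numbers for its small atoms. *)

theory Submission
  imports Defs
begin


section \<open>The Laplace functional of a Poisson process\<close>

text \<open>All exponents live in [0, \<infinity>], with \<open>nexp\<close> as decreasing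
  exponential. An infinite exponent is a legal value, so the indicator of an avoidance event is
  itself a Laplace functional, with penalty \<open>\<top>\<close> on the forbidden marks; one
  formula covers marks, avoidance and finiteness alike.

  Because the density is a pure power, replacing the scale 1 by a multiplies the intensity of the
  scaled jumps by a^(-\<alpha>) and changes nothing else. Every exponent is a^(-\<alpha>) times an
  integral free of a. Hence the re-observation probabilities do not depend on the mixing variable,
  which enters the prediction only through the Poisson mean.

  The obstacle with random measures is measurability: atoms must be found, and their masses and
  coincidences tested, measurably in the measure and the point together. Finite partitions generated
  by a separating sequence of sets do this, the mass of a point being the limit of the masses of its
  cells. Sums over atoms are then written as integrals against the measure itself; they default to 0
  on infinite measures, which almost surely do not occur.\<close>

definition nexp :: "ennreal \<Rightarrow> ennreal" where
  "nexp x = (if x = \<top> then 0 else ennreal (exp (- enn2real x)))"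

text \<open>The inverse of \<open>nexp\<close> on [0, 1], clipped above 1. It turns an infinite
  product of probabilities or expectations into a single exponent.\<close>

definition nlog :: "ennreal \<Rightarrow> ennreal" where
  "nlog y = (if y = 0 then \<top> else if 1 \<le> y then 0 else ennreal (- ln (enn2real y)))"

lemma nexp_0 [simp]: "nexp 0 = 1" and nexp_top [simp]: "nexp \<top> = 0"
  by (simp_all add: nexp_def)

lemma nexp_ennreal: "0 \<le> r \<Longrightarrow> nexp (ennreal r) = ennreal (exp (- r))"
  by (simp add: nexp_def)

lemma nexp_le_1 [simp]: "nexp x \<le> 1"
  by (cases x) (auto simp: nexp_def)

lemma nexp_less_top [simp]: "nexp x < \<top>" "nexp x \<noteq> \<top>"
  by (auto simp: nexp_def)

lemma nexp_add: "nexp (x + y) = nexp x * nexp y"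
  by (cases x; cases y)
     (auto simp: nexp_def ennreal_mult[symmetric] exp_add[symmetric] enn2real_plus
           simp flip: ennreal_plus)

lemma nexp_sum: "nexp (\<Sum>i\<in>I. f i) = (\<Prod>i\<in>I. nexp (f i))"
  by (induction I rule: infinite_finite_induct) (auto simp: nexp_add)

lemma nexp_less_iff [simp]: "nexp x < nexp y \<longleftrightarrow> y < x"
  by (cases x; cases y) (auto simp: nexp_def ennreal_less_iff top_unique less_top[symmetric])

lemma nexp_le_iff [simp]: "nexp x \<le> nexp y \<longleftrightarrow> y \<le> x"
  by (simp flip: not_less)

lemma nexp_nlog: "y \<le> 1 \<Longrightarrow> nexp (nlog y) = y"
  by (cases y) (auto simp: nexp_def nlog_def ennreal_le_1 ln_le_zero_iff top_unique intro: antisym)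

lemma nlog_nexp [simp]: "nlog (nexp x) = x"
proof (cases x)
  case (real r)
  then show ?thesis
    by (cases "r = 0") (auto simp: nexp_def nlog_def ennreal_ge_1)
qed (auto simp: nlog_def)

lemma nlog_1 [simp]: "nlog 1 = 0"
  by (simp add: nlog_def)

lemma nexp_measurable [measurable]: "nexp \<in> borel_measurable borel"
  unfolding nexp_def[abs_def] by measurable

lemma nlog_measurable [measurable]: "nlog \<in> borel_measurable borel"
  unfolding nlog_def[abs_def] by measurable

text \<open>Continuity from order alone: \<open>nexp\<close> is a strictly decreasing bijection onto
  [0, 1], so it carries open half-lines to open half-lines. No case split at \<open>\<top>\<close>
  is needed.\<close>

lemma tendsto_nexp:
  assumes "(X \<longlongrightarrow> L) F"
  shows "((\<lambda>i. nexp (X i)) \<longlongrightarrow> nexp L) F"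
proof (rule order_tendstoI)
  fix a assume a: "a < nexp L"
  then have "a \<le> 1"
    using nexp_le_1[of L] by (auto intro: order.trans[of a "nexp L"] less_imp_le)
  then have a': "a = nexp (nlog a)" by (simp add: nexp_nlog)
  with a have "L < nlog a" by (metis nexp_less_iff)
  with assms have "\<forall>\<^sub>F x in F. X x < nlog a" by (rule order_tendstoD)
  then show "\<forall>\<^sub>F x in F. a < nexp (X x)"
    by eventually_elim (metis a' nexp_less_iff)
next
  fix a assume a: "nexp L < a"
  show "\<forall>\<^sub>F x in F. nexp (X x) < a"
  proof (cases "a \<le> 1")
    case False
    then have "nexp x < a" for x
      using le_less_trans[OF nexp_le_1, of a x] by (simp add: not_le)
    then show ?thesis by simp
  next
    case True
    then have a': "a = nexp (nlog a)" by (simp add: nexp_nlog)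
    with a have "nlog a < L" by (metis nexp_less_iff)
    with assms have "\<forall>\<^sub>F x in F. nlog a < X x" by (rule order_tendstoD)
    then show ?thesis
      by eventually_elim (metis a' nexp_less_iff)
  qed
qed

section \<open>Limits of integrals and countable products of independent factors\<close>

lemma nn_integral_LIMSEQ_on_space:
  assumes "\<And>x i j. x \<in> space M \<Longrightarrow> i \<le> j \<Longrightarrow> f i x \<le> f j x"
    and f: "\<And>i. f i \<in> borel_measurable M"
    and "\<And>x. x \<in> space M \<Longrightarrow> (\<lambda>i. f i x) \<longlonglongrightarrow> (u x :: ennreal)"
  shows "(\<lambda>i. integral\<^sup>N M (f i)) \<longlonglongrightarrow> integral\<^sup>N M u"
proof -
  have "(\<lambda>i. \<integral>\<^sup>+x. (if x \<in> space M then f i x else 0) \<partial>M)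
      \<longlonglongrightarrow> (\<integral>\<^sup>+x. (if x \<in> space M then u x else 0) \<partial>M)"
  proof (rule nn_integral_LIMSEQ)
    show "incseq (\<lambda>i x. if x \<in> space M then f i x else 0)"
      by (auto simp: incseq_def le_fun_def assms(1))
    show "(\<lambda>x. if x \<in> space M then f i x else 0) \<in> borel_measurable M" for i
      using f[of i] by (subst measurable_cong[where g="f i"]) auto
  qed (use assms(3) in auto)
  then show ?thesis
    by (simp cong: nn_integral_cong)
qed

text \<open>A single exhaustion serves every f, so the same finite sets can be used for all sample
  points at once.\<close>

lemma countable_finite_approx:
  assumes "countable A"
  obtains S :: "nat \<Rightarrow> 'a set" where "\<And>K. finite (S K)" "\<And>K. S K \<subseteq> A"
    "\<And>f :: 'a \<Rightarrow> ennreal. (\<lambda>K. \<Sum>x\<in>S K. f x) \<longlonglongrightarrow> (\<integral>\<^sup>+x. f x \<partial>count_space A)"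
proof -
  define S where "S K = {x\<in>A. to_nat_on A x < K}" for K
  have fin: "finite (S K)" for K
    unfolding S_def
    by (rule finite_imageD[of "to_nat_on A", OF finite_subset[of _ "{..<K}"]])
       (use inj_on_to_nat_on[OF assms] in \<open>auto intro: inj_on_subset\<close>)
  have sub: "S K \<subseteq> A" for K
    by (auto simp: S_def)
  have "(\<lambda>K. \<Sum>x\<in>S K. f x) \<longlonglongrightarrow> (\<integral>\<^sup>+x. f x \<partial>count_space A)" for f :: "'a \<Rightarrow> ennreal"
  proof -
  have eq: "(\<Sum>x\<in>S K. f x) = (\<integral>\<^sup>+x. f x * indicator (S K) x \<partial>count_space A)" for K
    by (subst nn_integral_count_space'[of "S K"]) (use fin sub in auto)
  have "(\<lambda>K. \<integral>\<^sup>+x. f x * indicator (S K) x \<partial>count_space A) \<longlonglongrightarrow>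
      (\<integral>\<^sup>+x. f x \<partial>count_space A)"
  proof (rule nn_integral_LIMSEQ_on_space)
    show "f x * indicator (S i) x \<le> f x * indicator (S j) x" if "i \<le> j" for x i j
      using that by (auto simp: S_def indicator_def)
    fix x
    assume "x \<in> space (count_space A)"
    then have "\<forall>\<^sub>F K in sequentially. f x * indicator (S K) x = f x"
      by (intro eventually_sequentiallyI[of "Suc (to_nat_on A x)"]) (auto simp: S_def)
    then show "(\<lambda>K. f x * indicator (S K) x) \<longlonglongrightarrow> f x"
      by (rule tendsto_eventually)
  qed auto
  then show ?thesis
    by (simp add: eq)
  qed
  with fin sub show thesis by (rule that)
qed

text \<open>On a finite index set this is the product rule for independent factors. Both sides pass
  to the limit along a finite exhaustion, the left one dominated by 1. The infinite product of
  expectations appears as a sum of \<open>nlog\<close>s.\<close>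

lemma (in prob_space) indep_vars_nn_integral_nexp:
  fixes Y :: "'i \<Rightarrow> 'a \<Rightarrow> ennreal"
  assumes "countable A" and ind: "indep_vars (\<lambda>_. borel) Y A"
  shows "(\<integral>\<^sup>+\<omega>. nexp (\<integral>\<^sup>+x. Y x \<omega> \<partial>count_space A) \<partial>M)
    = nexp (\<integral>\<^sup>+x. nlog (\<integral>\<^sup>+\<omega>. nexp (Y x \<omega>) \<partial>M) \<partial>count_space A)"
proof -
  obtain S :: "nat \<Rightarrow> 'i set" where S: "\<And>K. finite (S K)" "\<And>K. S K \<subseteq> A"
    "\<And>f :: 'i \<Rightarrow> ennreal. (\<lambda>K. \<Sum>x\<in>S K. f x) \<longlonglongrightarrow> (\<integral>\<^sup>+x. f x \<partial>count_space A)"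
    using countable_finite_approx[OF assms(1)] by metis
  have Ym: "Y x \<in> borel_measurable M" if "x \<in> A" for x
    using ind that by (auto simp: indep_vars_def)
  have Ym': "\<And>K x. x \<in> S K \<Longrightarrow> Y x \<in> borel_measurable M"
    using Ym S(2) by auto
  have lim: "(\<lambda>\<omega>. \<integral>\<^sup>+x. Y x \<omega> \<partial>count_space A) \<in> borel_measurable M"
    by (rule borel_measurable_LIMSEQ_order[where u="\<lambda>K \<omega>. \<Sum>x\<in>S K. Y x \<omega>"]) (auto intro!: S(3) borel_measurable_sum Ym')
  have le1: "(\<integral>\<^sup>+\<omega>. nexp (f \<omega>) \<partial>M) \<le> 1" for f
    using nn_integral_mono[of M "\<lambda>\<omega>. nexp (f \<omega>)" "\<lambda>_. 1"] by (simp add: emeasure_space_1)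
  have "(\<integral>\<^sup>+\<omega>. nexp (\<Sum>x\<in>S K. Y x \<omega>) \<partial>M) = nexp (\<Sum>x\<in>S K. nlog (\<integral>\<^sup>+\<omega>. nexp (Y x \<omega>) \<partial>M))" for K
  proof -
    have "indep_vars (\<lambda>_. borel) (\<lambda>x \<omega>. nexp (Y x \<omega>)) (S K)"
      by (rule indep_vars_compose2[OF indep_vars_subset[OF ind S(2)]]) auto
    from indep_vars_nn_integral[OF S(1) this] show ?thesis
      by (simp add: nexp_sum nexp_nlog le1)
  qed
  moreover have "(\<lambda>K. \<integral>\<^sup>+\<omega>. nexp (\<Sum>x\<in>S K. Y x \<omega>) \<partial>M)
      \<longlonglongrightarrow> (\<integral>\<^sup>+\<omega>. nexp (\<integral>\<^sup>+x. Y x \<omega> \<partial>count_space A) \<partial>M)"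
    by (rule nn_integral_dominated_convergence[where w="\<lambda>_. 1"])
       (use lim in \<open>auto intro!: Ym' tendsto_nexp S(3) borel_measurable_sum measurable_compose[OF _ nexp_measurable]
          simp: emeasure_space_1\<close>)
  ultimately show ?thesis
    by (intro LIMSEQ_unique[OF _ tendsto_nexp[OF S(3)]]) simp
qed

section \<open>Laplace functional of a Poisson process\<close>

lemma nn_integral_poisson_law_nexp:
  assumes "0 \<le> c"
  shows "(\<integral>\<^sup>+k. nexp (v * of_nat k) \<partial>measure_pmf (poisson_law c)) = nexp ((1 - nexp v) * ennreal c)"
proof (cases "c = 0")
  case True
  then show ?thesis by (simp add: poisson_law_def nn_integral_return)
next
  case False
  with assms have c: "0 < c" by simp
  define t where "t = enn2real (nexp v)"
  have t: "nexp v = ennreal t" "0 \<le> t" "t \<le> 1"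
    using nexp_le_1[of v] nexp_less_top(1)[of v] unfolding t_def
    by (simp_all add: enn2real_le_iff)
  have pow: "nexp (v * of_nat k) = ennreal (t ^ k)" for k
  proof -
    have "nexp (v * of_nat k) = nexp (\<Sum>i<k. v)" by (simp add: mult.commute)
    also have "\<dots> = ennreal (t ^ k)" unfolding nexp_sum using t by (simp add: ennreal_power)
    finally show ?thesis .
  qed
  have s: "(\<lambda>k. (t * c) ^ k / fact k * exp (- c)) sums (exp (t * c) * exp (- c))"
    using exp_converges[of "t * c"] by (intro sums_mult2) (simp add: field_simps scaleR_conv_of_real)
  have "(\<integral>\<^sup>+k. nexp (v * of_nat k) \<partial>measure_pmf (poisson_law c))
      = (\<integral>\<^sup>+k. ennreal (c ^ k / fact k * exp (- c)) * ennreal (t ^ k) \<partial>count_space UNIV)"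
    using c by (simp add: nn_integral_measure_pmf poisson_law_def pow)
  also have "\<dots> = (\<Sum>k. ennreal ((t * c) ^ k / fact k * exp (- c)))"
    using c t by (simp add: nn_integral_count_space_nat ennreal_mult[symmetric] power_mult_distrib mult_ac)
  also have "\<dots> = ennreal (exp (t * c) * exp (- c))"
    using s c t by (subst suminf_ennreal2) (auto simp: sums_iff)
  also have "\<dots> = nexp ((1 - nexp v) * ennreal c)"
    using c t
    by (simp add: t nexp_ennreal ennreal_minus ennreal_mult[symmetric] exp_add[symmetric] algebra_simps
         flip: ennreal_1)
  finally show ?thesis .
qed

text \<open>The nonzero level sets of f are disjoint and of finite intensity, so their point counts
  are independent Poisson variables, and the expectation is a finite product of generating
  functions.\<close>

lemma poisson_points_simple:
  fixes f :: "'b \<Rightarrow> ennreal" and X :: "nat \<Rightarrow> 'a \<Rightarrow> 'b"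
  assumes "prob_space M" and pp: "poisson_points M \<mu> X"
    and f: "simple_function \<mu> f" "\<And>x. f x < \<top>" and fin: "emeasure \<mu> {x\<in>space \<mu>. f x \<noteq> 0} < \<infinity>"
  shows "(\<integral>\<^sup>+\<omega>. nexp (\<Sum>k. f (X k \<omega>)) \<partial>M) = nexp (\<integral>\<^sup>+x. 1 - nexp (f x) \<partial>\<mu>)"
proof -
  interpret prob_space M by fact
  define R where "R = f ` space \<mu> - {0}"
  have finR: "finite R"
    using f by (auto simp: R_def simple_function_def)
  obtain h where h: "bij_betw h {0..<card R} R"
    using ex_bij_betw_nat_finite[OF finR] by auto
  \<comment> \<open>Padded with empty sets, since independence of counts is given for infinite
    sequences of sets.\<close>
  define F where "F i = (if i < card R then f -` {h i} \<inter> space \<mu> else {})" for i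
  have fm [measurable]: "f \<in> borel_measurable \<mu>"
    using f(1) by (rule borel_measurable_simple_function)
  have Fs: "F i \<in> sets \<mu>" for i
    by (auto simp: F_def)
  have hne: "i < card R \<Longrightarrow> h i \<noteq> 0" for i
    using h by (auto simp: bij_betw_def R_def)
  have Ffin: "emeasure \<mu> (F i) < \<infinity>" for i
  proof -
    have "emeasure \<mu> (F i) \<le> emeasure \<mu> {x\<in>space \<mu>. f x \<noteq> 0}"
      by (rule emeasure_mono) (auto simp: F_def hne)
    then show ?thesis using fin by simp
  qed
  have disj: "disjoint_family F"
    using h by (auto simp: F_def disjoint_family_on_def bij_betw_def inj_on_def)
  define N where "N i \<omega> = card {k. X k \<omega> \<in> F i}" for i \<omega>
  have Xm [measurable]: "X k \<in> M \<rightarrow>\<^sub>M \<mu>" for k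
    using pp by (auto simp: poisson_points_def)
  have ind: "indep_vars (\<lambda>_. count_space UNIV) N UNIV"
  proof -
    have "range F \<subseteq> sets \<mu> \<and> disjoint_family F \<and> (\<forall>i. emeasure \<mu> (F i) < \<infinity>)"
      using disj Fs Ffin by auto
    then show ?thesis
      using pp unfolding poisson_points_def N_def[abs_def] by blast
  qed
  have AEfin: "AE \<omega> in M. finite {k. X k \<omega> \<in> F i}" for i
    using pp Fs Ffin by (auto simp: poisson_points_def)
  have dN: "distr M (count_space UNIV) (N i) = measure_pmf (poisson_law (measure \<mu> (F i)))" for i
    using pp Fs Ffin by (auto simp: poisson_points_def N_def[abs_def])
  have Nm: "N i \<in> M \<rightarrow>\<^sub>M count_space UNIV" for i
    using ind by (auto simp: indep_vars_def)
  have fdec: "f x = (\<Sum>i<card R. h i * indicator (F i) x)" if "x \<in> space \<mu>" for x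
  proof (cases "f x = 0")
    case True
    then have "(\<Sum>i<card R. h i * indicator (F i) x) = 0"
      by (intro sum.neutral) (auto simp: F_def hne indicator_def)
    with True show ?thesis by (simp only:)
  next
    case False
    then have "f x \<in> R" using that by (auto simp: R_def)
    then obtain j where j: "j < card R" "h j = f x"
      using h by (auto simp: bij_betw_def image_iff) (metis atLeastLessThan_iff imageE)
    have "(\<Sum>i<card R. h i * indicator (F i) x) = (\<Sum>i<card R. if i = j then f x else 0)"
    proof (rule sum.cong)
      fix i assume "i \<in> {..<card R}"
      then show "h i * indicator (F i) x = (if i = j then f x else 0)"
        using j h that by (auto simp: F_def indicator_def bij_betw_def inj_on_def)
    qed simp
    then show ?thesis using j by simp
  qed
  \<comment> \<open>Regroups the points by level set. Only almost sure, because \<open>card\<close>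
    counts the points correctly only where they are finitely many.\<close>
  have sumN: "AE \<omega> in M. (\<Sum>k. f (X k \<omega>)) = (\<Sum>i<card R. h i * of_nat (N i \<omega>))"
  proof -
    have "AE \<omega> in M. \<forall>i. finite {k. X k \<omega> \<in> F i}"
      using AEfin by (simp add: AE_all_countable)
    then show ?thesis
    proof (rule AE_mp[OF _ AE_I2[OF impI]])
      fix \<omega> assume \<omega>: "\<omega> \<in> space M" and fi: "\<forall>i. finite {k. X k \<omega> \<in> F i}"
      have "X k \<omega> \<in> space \<mu>" for k
        using measurable_space[OF Xm \<omega>] .
      then have "(\<Sum>k. f (X k \<omega>)) = (\<Sum>k. \<Sum>i<card R. h i * indicator (F i) (X k \<omega>))"
        by (simp add: fdec)
      also have "\<dots> = (\<Sum>i<card R. \<Sum>k. h i * indicator (F i) (X k \<omega>))"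
        by (rule suminf_sum) simp
      also have "\<dots> = (\<Sum>i<card R. h i * of_nat (N i \<omega>))"
      proof (rule sum.cong)
        fix i
        have "(\<Sum>k. h i * indicator (F i) (X k \<omega>)) = (\<Sum>k\<in>{k. X k \<omega> \<in> F i}. h i * indicator (F i) (X k \<omega>))"
          using fi by (intro suminf_finite) auto
        then show "(\<Sum>k. h i * indicator (F i) (X k \<omega>)) = h i * of_nat (N i \<omega>)"
          by (simp add: N_def mult.commute)
      qed simp
      finally show "(\<Sum>k. f (X k \<omega>)) = (\<Sum>i<card R. h i * of_nat (N i \<omega>))" .
    qed
  qed
  have "(\<integral>\<^sup>+\<omega>. nexp (\<Sum>k. f (X k \<omega>)) \<partial>M) = (\<integral>\<^sup>+\<omega>. (\<Prod>i<card R. nexp (h i * of_nat (N i \<omega>))) \<partial>M)"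
    using sumN by (intro nn_integral_cong_AE) (auto simp: nexp_sum)
  also have "\<dots> = (\<Prod>i<card R. \<integral>\<^sup>+\<omega>. nexp (h i * of_nat (N i \<omega>)) \<partial>M)"
    by (intro indep_vars_nn_integral indep_vars_compose2[OF indep_vars_subset[OF ind]]) auto
  also have "\<dots> = (\<Prod>i<card R. nexp ((1 - nexp (h i)) * emeasure \<mu> (F i)))"
  proof (rule prod.cong)
    fix i
    have "(\<integral>\<^sup>+\<omega>. nexp (h i * of_nat (N i \<omega>)) \<partial>M)
        = (\<integral>\<^sup>+k. nexp (h i * of_nat k) \<partial>distr M (count_space UNIV) (N i))"
      by (subst nn_integral_distr[OF Nm]) auto
    also have "\<dots> = nexp ((1 - nexp (h i)) * ennreal (measure \<mu> (F i)))"
      by (simp add: dN nn_integral_poisson_law_nexp)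
    also have "ennreal (measure \<mu> (F i)) = emeasure \<mu> (F i)"
      using Ffin[of i] by (intro emeasure_eq_ennreal_measure[symmetric]) auto
    finally show "(\<integral>\<^sup>+\<omega>. nexp (h i * of_nat (N i \<omega>)) \<partial>M) = nexp ((1 - nexp (h i)) * emeasure \<mu> (F i))" .
  qed simp
  also have "\<dots> = nexp (\<Sum>i<card R. \<integral>\<^sup>+x. (1 - nexp (h i)) * indicator (F i) x \<partial>\<mu>)"
    by (simp add: nexp_sum nn_integral_cmult_indicator Fs)
  also have "(\<Sum>i<card R. \<integral>\<^sup>+x. (1 - nexp (h i)) * indicator (F i) x \<partial>\<mu>)
      = (\<integral>\<^sup>+x. (\<Sum>i<card R. (1 - nexp (h i)) * indicator (F i) x) \<partial>\<mu>)"
    by (rule nn_integral_sum[symmetric]) (use Fs in auto)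
  also have "\<dots> = (\<integral>\<^sup>+x. 1 - nexp (f x) \<partial>\<mu>)"
  proof (rule nn_integral_cong)
    fix x assume x: "x \<in> space \<mu>"
    show "(\<Sum>i<card R. (1 - nexp (h i)) * indicator (F i) x) = 1 - nexp (f x)"
    proof (cases "f x = 0")
      case True
      then have "(\<Sum>i<card R. (1 - nexp (h i)) * indicator (F i) x) = 0"
        by (intro sum.neutral) (auto simp: F_def hne indicator_def)
      then show ?thesis using True by simp
    next
      case False
      then have "f x \<in> R" using x by (auto simp: R_def)
      then obtain j where j: "j < card R" "h j = f x"
        using h by (auto simp: bij_betw_def image_iff) (metis atLeastLessThan_iff imageE)
      have "(\<Sum>i<card R. (1 - nexp (h i)) * indicator (F i) x) = (\<Sum>i<card R. if i = j then 1 - nexp (f x) else 0)"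
      proof (rule sum.cong)
        fix i assume "i \<in> {..<card R}"
        then show "(1 - nexp (h i)) * indicator (F i) x = (if i = j then 1 - nexp (f x) else 0)"
          using j h x by (auto simp: F_def indicator_def bij_betw_def inj_on_def)
      qed simp
      then show ?thesis using j by simp
    qed
  qed
  finally show ?thesis .
qed

text \<open>Approximation from below by simple functions. The left side converges by domination by
  1; on the right 1 - \<open>nexp\<close> is increasing, so monotone convergence applies even when
  the limit is infinite.\<close>

lemma poisson_points_laplace:
  fixes f :: "'b \<Rightarrow> ennreal" and X :: "nat \<Rightarrow> 'a \<Rightarrow> 'b"
  assumes "prob_space M" and pp: "poisson_points M \<mu> X" and "sigma_finite_measure \<mu>"
    and f: "f \<in> borel_measurable \<mu>"
  shows "(\<integral>\<^sup>+\<omega>. nexp (\<Sum>k. f (X k \<omega>)) \<partial>M) = nexp (\<integral>\<^sup>+x. 1 - nexp (f x) \<partial>\<mu>)"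
proof -
  interpret prob_space M by fact
  interpret \<mu>: sigma_finite_measure \<mu> by fact
  obtain E :: "nat \<Rightarrow> 'b set" where E: "range E \<subseteq> sets \<mu>" "(\<Union>i. E i) = space \<mu>"
    "\<And>i. emeasure \<mu> (E i) \<noteq> \<infinity>" "incseq E"
    using \<mu>.sigma_finite_incseq by blast
  obtain s where s: "\<And>i. simple_function \<mu> (s i)" "incseq s" "\<And>i x. s i x < \<top>" "\<And>x. (SUP i. s i x) = f x"
    using borel_measurable_implies_simple_function_sequence'[OF f] by blast
  \<comment> \<open>The cut-off to \<open>E i\<close> gives the approximants a support of finite
    intensity, as the simple case demands.\<close>
  define g where "g i x = s i x * indicator (E i) x" for i x
  have Em [measurable]: "E i \<in> sets \<mu>" for i using E by auto
  have gs: "simple_function \<mu> (g i)" for i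
    unfolding g_def by (intro simple_function_mult s simple_function_indicator Em)
  have [measurable]: "g i \<in> borel_measurable \<mu>" for i
    using gs by (rule borel_measurable_simple_function)
  have [measurable]: "f \<in> borel_measurable \<mu>" by fact
  have Xm [measurable]: "X k \<in> M \<rightarrow>\<^sub>M \<mu>" for k
    using pp by (auto simp: poisson_points_def)
  have ginc: "g i x \<le> g j x" if "i \<le> j" for i j x
  proof -
    have "E i \<subseteq> E j" "s i x \<le> s j x"
      using s(2) E(4) that by (auto simp: incseq_def le_fun_def)
    then show ?thesis
      unfolding g_def by (intro mult_mono) (auto simp: indicator_def)
  qed
  have glim: "(\<lambda>i. g i x) \<longlonglongrightarrow> f x" if x: "x \<in> space \<mu>" for x
  proof -
    obtain i0 where i0: "x \<in> E i0" using x E(2) by auto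
    have "\<forall>\<^sub>F i in sequentially. s i x = g i x"
      using i0 E(4) by (intro eventually_sequentiallyI[of i0]) (auto simp: g_def incseq_def indicator_def)
    moreover have "(\<lambda>i. s i x) \<longlonglongrightarrow> f x"
      unfolding s(4)[symmetric] using s(2)
      by (intro LIMSEQ_SUP) (auto simp: incseq_def le_fun_def)
    ultimately show ?thesis by (rule Lim_transform_eventually[rotated])
  qed
  have fing: "emeasure \<mu> {x\<in>space \<mu>. g i x \<noteq> 0} < \<infinity>" for i
  proof -
    have "emeasure \<mu> {x\<in>space \<mu>. g i x \<noteq> 0} \<le> emeasure \<mu> (E i)"
      by (rule emeasure_mono) (auto simp: g_def indicator_eq_0_iff)
    then show ?thesis using E(3)[of i] by (auto simp: less_top)
  qed
  have eq: "(\<integral>\<^sup>+\<omega>. nexp (\<Sum>k. g i (X k \<omega>)) \<partial>M) = nexp (\<integral>\<^sup>+x. 1 - nexp (g i x) \<partial>\<mu>)" for i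
    by (rule poisson_points_simple[OF assms(1) pp gs])
       (use fing s(3) in \<open>auto simp: g_def indicator_def\<close>)
  have "(\<lambda>i. \<integral>\<^sup>+x. 1 - nexp (g i x) \<partial>\<mu>) \<longlonglongrightarrow> (\<integral>\<^sup>+x. 1 - nexp (f x) \<partial>\<mu>)"
  proof (rule nn_integral_LIMSEQ_on_space)
    show "1 - nexp (g i x) \<le> 1 - nexp (g j x)" if "i \<le> j" for i j x
      using that by (auto intro!: ennreal_minus_mono ginc)
    show "(\<lambda>i. 1 - nexp (g i x)) \<longlonglongrightarrow> 1 - nexp (f x)" if "x \<in> space \<mu>" for x
      by (intro tendsto_diff_ennreal tendsto_nexp glim that tendsto_const) auto
  qed auto
  moreover have "(\<lambda>i. \<integral>\<^sup>+\<omega>. nexp (\<Sum>k. g i (X k \<omega>)) \<partial>M) \<longlonglongrightarrow> (\<integral>\<^sup>+\<omega>. nexp (\<Sum>k. f (X k \<omega>)) \<partial>M)"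
  proof (rule nn_integral_dominated_convergence[where w="\<lambda>_. 1"])
    show "AE \<omega> in M. (\<lambda>i. nexp (\<Sum>k. g i (X k \<omega>))) \<longlonglongrightarrow> nexp (\<Sum>k. f (X k \<omega>))"
    proof (rule AE_I2)
      fix \<omega> assume "\<omega> \<in> space M"
      then have sp: "X k \<omega> \<in> space \<mu>" for k using measurable_space[OF Xm] by blast
      have "(\<lambda>i. \<integral>\<^sup>+k. g i (X k \<omega>) \<partial>count_space UNIV) \<longlonglongrightarrow> (\<integral>\<^sup>+k. f (X k \<omega>) \<partial>count_space UNIV)"
        by (rule nn_integral_LIMSEQ) (auto simp: incseq_def le_fun_def intro!: ginc glim sp)
      then show "(\<lambda>i. nexp (\<Sum>k. g i (X k \<omega>))) \<longlonglongrightarrow> nexp (\<Sum>k. f (X k \<omega>))"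
        by (intro tendsto_nexp) (simp add: nn_integral_count_space_nat)
    qed
  qed (auto simp: emeasure_space_1)
  ultimately have "(\<lambda>i. nexp (\<integral>\<^sup>+x. 1 - nexp (g i x) \<partial>\<mu>)) \<longlonglongrightarrow> nexp (\<integral>\<^sup>+x. 1 - nexp (f x) \<partial>\<mu>)"
    and "(\<lambda>i. nexp (\<integral>\<^sup>+x. 1 - nexp (g i x) \<partial>\<mu>)) \<longlonglongrightarrow> (\<integral>\<^sup>+\<omega>. nexp (\<Sum>k. f (X k \<omega>)) \<partial>M)"
    unfolding eq by (auto intro: tendsto_nexp)
  then show ?thesis
    by (rule LIMSEQ_unique[OF _, rotated])
qed


section \<open>Spaces of measures and their atoms\<close>

lemma space_measure_algebra: "space (measure_algebra K) = {m. sets m = sets K}"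
  by (auto simp add: measure_algebra_def space_Sup_eq_UN)

lemma measure_algebra_cong: "sets M = sets N \<Longrightarrow> measure_algebra M = measure_algebra N"
  by (simp add: measure_algebra_def)

lemma measurable_emeasure_measure_algebra [measurable]:
  "A \<in> sets K \<Longrightarrow> (\<lambda>m. emeasure m A) \<in> borel_measurable (measure_algebra K)"
  by (auto intro!: measurable_Sup1 measurable_vimage_algebra1 simp: measure_algebra_def)

lemma measurable_measure_algebra:
  "(\<And>a. a \<in> space M \<Longrightarrow> sets (f a) = sets K) \<Longrightarrow>
  (\<And>A. A \<in> sets K \<Longrightarrow> (\<lambda>a. emeasure (f a) A) \<in> borel_measurable M) \<Longrightarrow>
  f \<in> M \<rightarrow>\<^sub>M measure_algebra K"
  by (auto intro!: measurable_Sup2 measurable_vimage_algebra2 simp: measure_algebra_def)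

lemma sets_measure_algebra:
  "sets (measure_algebra K) =
    sigma_sets (space (measure_algebra K)) {(\<lambda>m. emeasure m A) -` b \<inter> space (measure_algebra K) | A b. A \<in> sets K \<and> b \<in> sets borel}"
proof -
  have ne: "sets K \<noteq> {}" by auto
  have "sets (measure_algebra K) = sigma_sets {m. sets m = sets K}
      (\<Union>A\<in>sets K. sets (vimage_algebra {m. sets m = sets K} (\<lambda>m. emeasure m A) borel))"
    unfolding measure_algebra_def by (subst sets_Sup_eq[where X="{m. sets m = sets K}"]) auto
  also have "(\<Union>A\<in>sets K. sets (vimage_algebra {m. sets m = sets K} (\<lambda>m. emeasure m A) borel))
      = {(\<lambda>m. emeasure m A) -` b \<inter> {m. sets m = sets K} | A b. A \<in> sets K \<and> b \<in> sets borel}"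
    by (subst sets_vimage_algebra2) auto
  finally show ?thesis by (simp add: space_measure_algebra)
qed

text \<open>Dividing by the total mass reduces the claim to subprobability kernels. Infinite
  measures cannot be normalised, which is why the integral is replaced by 0 there.\<close>

lemma measurable_nn_integral_measure_algebra:
  assumes ne: "space K \<noteq> {}"
    and L: "L \<in> N \<rightarrow>\<^sub>M measure_algebra K"
    and f: "(\<lambda>(y, x). f y x) \<in> borel_measurable (N \<Otimes>\<^sub>M K)"
  shows "(\<lambda>y. if emeasure (L y) (space K) < \<infinity> then \<integral>\<^sup>+x. f y x \<partial>L y else 0) \<in> borel_measurable N"
proof -
  define tot where "tot y = emeasure (L y) (space K)" for y
  \<comment> \<open>Mass zero and mass infinity are both sent to the null measure: the former makes
    the integral 0 anyway, the latter is overwritten by the default.\<close>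
  define L' where "L' y = (if 0 < tot y \<and> tot y < \<infinity> then scale_measure (inverse (tot y)) (L y) else null_measure K)" for y
  have sL: "sets (L y) = sets K" if "y \<in> space N" for y
    using measurable_space[OF L that] by (simp add: space_measure_algebra)
  have eL [measurable]: "(\<lambda>y. emeasure (L y) A) \<in> borel_measurable N" if "A \<in> sets K" for A
    using measurable_compose[OF L measurable_emeasure_measure_algebra[OF that]] .
  have tm [measurable]: "tot \<in> borel_measurable N"
    unfolding tot_def[abs_def] by measurable
  have L'e: "emeasure (L' y) A = (if 0 < tot y \<and> tot y < \<infinity> then inverse (tot y) * emeasure (L y) A else 0)" for y A
    by (simp add: L'_def)
  have L'm: "L' \<in> N \<rightarrow>\<^sub>M subprob_algebra K"
  proof (rule measurable_subprob_algebra)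
    fix y assume y: "y \<in> space N"
    show s: "sets (L' y) = sets K" using sL[OF y] by (simp add: L'_def)
    show "subprob_space (L' y)"
    proof (rule subprob_spaceI)
      show "space (L' y) \<noteq> {}" using ne sets_eq_imp_space_eq[OF s] by simp
      show "emeasure (L' y) (space (L' y)) \<le> 1"
        unfolding sets_eq_imp_space_eq[OF s] L'e
        by (auto simp: tot_def[symmetric] mult.commute[of "inverse _"] ennreal_mult_divide_eq divide_ennreal_def[symmetric]
            ennreal_divide_self)
    qed
  next
    fix A assume "A \<in> sets K"
    define e where "e y = emeasure (L y) A" for y
    have [measurable]: "e \<in> borel_measurable N"
      unfolding e_def[abs_def] by (rule eL) fact
    show "(\<lambda>y. emeasure (L' y) A) \<in> borel_measurable N"
      unfolding L'e e_def[symmetric] by measurable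
  qed
  have "(\<lambda>y. \<integral>\<^sup>+x. f y x \<partial>L' y) \<in> borel_measurable N"
    by (rule nn_integral_measurable_subprob_algebra2[OF f L'm])
  then have "(\<lambda>y. if tot y < \<infinity> then tot y * (\<integral>\<^sup>+x. f y x \<partial>L' y) else 0) \<in> borel_measurable N"
    by measurable
  then show ?thesis
  proof (rule measurable_cong[THEN iffD1, rotated])
    fix y assume y: "y \<in> space N"
    have fy: "f y \<in> borel_measurable (L y)"
      using measurable_compose_Pair1[OF y f] sL[OF y] by (simp cong: measurable_cong_sets)
    show "(if tot y < \<infinity> then tot y * (\<integral>\<^sup>+x. f y x \<partial>L' y) else 0)
      = (if emeasure (L y) (space K) < \<infinity> then \<integral>\<^sup>+x. f y x \<partial>L y else 0)"
    proof (cases "0 < tot y \<and> tot y < \<infinity>")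
      case True
      then have "tot y * (\<integral>\<^sup>+x. f y x \<partial>L' y) = (tot y * inverse (tot y)) * (\<integral>\<^sup>+x. f y x \<partial>L y)"
        using fy by (simp add: L'_def nn_integral_scale_measure mult.assoc)
      also have "tot y * inverse (tot y) = 1"
        using True ennreal_divide_self[of "tot y"] by (auto simp: divide_ennreal_def)
      finally show ?thesis using True by (simp add: tot_def)
    next
      case False
      show ?thesis
      proof (cases "tot y = 0")
        case True
        then have "space (L y) \<in> null_sets (L y)"
          using sets_eq_imp_space_eq[OF sL[OF y]] sets.top[of "L y"] by (auto simp: tot_def null_sets_def)
        then have "AE x in L y. f y x = 0"
          by (rule AE_I') auto
        then have "(\<integral>\<^sup>+x. f y x \<partial>L y) = 0"
          by (simp add: nn_integral_cong_AE)
        then show ?thesis using True by (simp add: tot_def)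
      qed (use False in \<open>auto simp: tot_def less_top[symmetric] zero_less_iff_neq_zero\<close>)
    qed
  qed
qed

locale separated_prob_space = prob_space G for G :: "'u measure" +
  fixes c :: "nat \<Rightarrow> 'u set"
  assumes c_sets [measurable]: "c i \<in> sets G"
    and c_sep: "x \<in> space G \<Longrightarrow> y \<in> space G \<Longrightarrow> x \<noteq> y \<Longrightarrow> \<exists>i. (x \<in> c i) \<noteq> (y \<in> c i)"
    and nonatomic: "x \<in> space G \<Longrightarrow> emeasure G {x} = 0"

lemma separated_prob_spaceE:
  assumes "prob_space G" and "countably_separated G" and "\<forall>x\<in>space G. emeasure G {x} = 0"
  obtains c where "separated_prob_space G c"
proof -
  obtain C where C: "countable C" "C \<subseteq> sets G"
    "\<And>x y. x\<in>space G \<Longrightarrow> y\<in>space G \<Longrightarrow> x \<noteq> y \<Longrightarrow> \<exists>A\<in>C. (x \<in> A) \<noteq> (y \<in> A)"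
    using assms(2) unfolding countably_separated_def by metis
  \<comment> \<open>\<open>space G\<close> separates no points, but it makes the family nonempty, so
    that it can be enumerated.\<close>
  define c where "c = from_nat_into (insert (space G) C)"
  have r: "range c = insert (space G) C"
    unfolding c_def by (rule range_from_nat_into) (use C(1) in auto)
  have "separated_prob_space G c"
  proof (intro separated_prob_space.intro separated_prob_space_axioms.intro assms(1))
    fix i
    have "c i \<in> insert (space G) C" using r by auto
    then show "c i \<in> sets G" using C(2) by auto
  next
    fix x y assume "x \<in> space G" "y \<in> space G" "x \<noteq> y"
    then obtain A where "A \<in> C" "(x \<in> A) \<noteq> (y \<in> A)" using C(3) by blast
    moreover then obtain i where "A = c i" using r by (metis insertCI rangeE)
    ultimately show "\<exists>i. (x \<in> c i) \<noteq> (y \<in> c i)" by auto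
  qed (use assms(3) in auto)
  then show thesis by (rule that)
qed

section \<open>Nested partitions and point masses\<close>

context separated_prob_space
begin

text \<open>The pieces, for s inside \<open>{..<N}\<close>, of the partition generated by the first
  N separating sets. \<open>code N x\<close> names the piece of x; as N grows the pieces around x
  shrink to x alone.\<close>

definition cell :: "nat \<Rightarrow> nat set \<Rightarrow> 'u set" where
  "cell N s = {y\<in>space G. \<forall>i<N. y \<in> c i \<longleftrightarrow> i \<in> s}"

definition code :: "nat \<Rightarrow> 'u \<Rightarrow> nat set" where
  "code N x = {i. i < N \<and> x \<in> c i}"

lemma cell_sets [measurable]: "cell N s \<in> sets G"
  unfolding cell_def by measurable

lemma mem_cell_iff: "s \<subseteq> {..<N} \<Longrightarrow> x \<in> space G \<Longrightarrow> x \<in> cell N s \<longleftrightarrow> s = code N x"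
  by (auto simp: cell_def code_def)

lemma code_subset: "code N x \<subseteq> {..<N}"
  by (auto simp: code_def)

text \<open>A jointly measurable substitute for \<open>emeasure m {x}\<close>: the mass of the piece
  containing x in ever finer partitions. The indicators select that piece and make the dependence on
  x measurable.\<close>

definition mass :: "'u measure \<Rightarrow> 'u \<Rightarrow> ennreal" where
  "mass m x = (INF N. \<Sum>s\<in>Pow {..<N}. emeasure m (cell N s) * indicator (cell N s) x)"

lemma measurable_mass [measurable]:
  assumes [measurable]: "L \<in> N \<rightarrow>\<^sub>M measure_algebra G" "g \<in> N \<rightarrow>\<^sub>M G"
  shows "(\<lambda>y. mass (L y) (g y)) \<in> borel_measurable N"
proof -
  have [measurable]: "(\<lambda>y. emeasure (L y) (cell n s)) \<in> borel_measurable N" for n s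
    using measurable_compose[OF assms(1) measurable_emeasure_measure_algebra[OF cell_sets]] .
  show ?thesis unfolding mass_def by measurable
qed

lemma INT_cell: "x \<in> space G \<Longrightarrow> (\<Inter>N. cell N (code N x)) = {x}"
  using c_sep by (auto simp: cell_def code_def)

lemma singleton_sets [measurable]: "x \<in> space G \<Longrightarrow> {x} \<in> sets G"
  by (subst INT_cell[symmetric]) auto

text \<open>Continuity from above along the shrinking cells of x; this is where finiteness of m
  enters.\<close>

lemma mass_eq:
  assumes m: "sets m = sets G" and fin: "emeasure m (space G) < \<infinity>" and x: "x \<in> space G"
  shows "mass m x = emeasure m {x}"
proof -
  have "(\<Sum>s\<in>Pow {..<N}. emeasure m (cell N s) * indicator (cell N s) x) = emeasure m (cell N (code N x))" for N
  proof -
    have "(\<Sum>s\<in>Pow {..<N}. emeasure m (cell N s) * indicator (cell N s) x)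
        = (\<Sum>s\<in>Pow {..<N}. if s = code N x then emeasure m (cell N (code N x)) else 0)"
      by (rule sum.cong) (auto simp: mem_cell_iff[OF _ x] indicator_def)
    then show ?thesis by (simp add: code_subset)
  qed
  then have "mass m x = (INF N. emeasure m (cell N (code N x)))"
    by (simp add: mass_def)
  also have "\<dots> = emeasure m (\<Inter>N. cell N (code N x))"
  proof (rule INF_emeasure_decseq)
    show "decseq (\<lambda>N. cell N (code N x))"
      by (rule decseq_SucI) (auto simp: cell_def code_def)
    show "emeasure m (cell N (code N x)) \<noteq> \<infinity>" for N
      using emeasure_mono[of "cell N (code N x)" "space G" m] fin m
      by (auto simp: cell_def top_unique)
  qed (auto simp: m)
  finally show ?thesis using INT_cell[OF x] by simp
qed

text \<open>If 0 is not in b, such a measure is purely atomic. The value \<open>{1}\<close> gives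
  simple finite point measures, \<open>{0<..1}\<close> the measures whose atoms can serve as
  Bernoulli probabilities.\<close>

definition atomic_masses :: "ennreal set \<Rightarrow> 'u measure set" where
  "atomic_masses b = {m. sets m = sets G \<and> emeasure m (space G) < \<infinity> \<and> (AE x in m. emeasure m {x} \<in> b)}"

text \<open>"For almost every x" says that an integral against m vanishes, and its integrand depends
  measurably on m and x through \<open>mass\<close>.\<close>

lemma atomic_masses_sets [measurable]:
  assumes [measurable]: "b \<in> sets borel"
  shows "atomic_masses b \<in> sets (measure_algebra G)"
proof -
  let ?I = "\<lambda>m. if emeasure m (space G) < \<infinity> then \<integral>\<^sup>+x. indicator (- b) (mass m x) \<partial>m else 0"
  have [measurable]: "?I \<in> borel_measurable (measure_algebra G)"
    by (rule measurable_nn_integral_measure_algebra[OF not_empty]) measurable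
  have "{m\<in>space (measure_algebra G). emeasure m (space G) < \<infinity> \<and> ?I m = 0} \<in> sets (measure_algebra G)"
    by measurable
  also have "{m\<in>space (measure_algebra G). emeasure m (space G) < \<infinity> \<and> ?I m = 0} = atomic_masses b"
  proof -
    have "(\<integral>\<^sup>+x. indicator (- b) (mass m x) \<partial>m) = 0 \<longleftrightarrow> (AE x in m. emeasure m {x} \<in> b)"
      if s: "sets m = sets G" and f: "emeasure m (space G) < \<infinity>" for m
    proof -
      have mm: "mass m \<in> borel_measurable m"
      proof -
        have "(\<lambda>x. mass m x) \<in> borel_measurable G"
          by (rule measurable_mass) (use s in \<open>auto simp: space_measure_algebra\<close>)
        then show ?thesis using s by (simp cong: measurable_cong_sets)
      qed
      have "(\<integral>\<^sup>+x. indicator (- b) (mass m x) \<partial>m) = 0 \<longleftrightarrow> (AE x in m. (indicator (- b) (mass m x) :: ennreal) = 0)"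
        by (rule nn_integral_0_iff_AE) (use mm in measurable)
      also have "\<dots> \<longleftrightarrow> (AE x in m. emeasure m {x} \<in> b)"
        by (rule AE_cong) (use mass_eq[OF s f] sets_eq_imp_space_eq[OF s] in \<open>auto simp: indicator_def\<close>)
      finally show ?thesis .
    qed
    then show ?thesis by (auto simp: atomic_masses_def space_measure_algebra)
  qed
  finally show ?thesis .
qed

lemma atomic_masses_D:
  assumes "m \<in> atomic_masses b"
  shows "sets m = sets G" "space m = space G" "emeasure m (space G) < \<infinity>" "finite_measure m"
    "AE x in m. emeasure m {x} \<in> b" "m \<in> space (measure_algebra G)"
  using assms sets_eq_imp_space_eq[of m G]
  by (auto simp: atomic_masses_def space_measure_algebra intro!: finite_measureI)

lemma atoms_sub: "m \<in> atomic_masses b \<Longrightarrow> x \<in> atoms m \<Longrightarrow> x \<in> space G"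
  using atomic_masses_D(2) by (auto simp: atoms_def)

lemma countable_atoms:
  assumes "m \<in> atomic_masses b" shows "countable (atoms m)"
proof -
  interpret finite_measure m using atomic_masses_D(4)[OF assms] .
  have "atoms m \<subseteq> {x. measure m {x} \<noteq> 0}"
    by (auto simp: atoms_def emeasure_eq_measure)
  then show ?thesis using countable_support by (rule countable_subset)
qed

lemma emeasure_atom:
  assumes m: "m \<in> atomic_masses b" and x: "x \<in> atoms m"
  shows "emeasure m {x} \<in> b" "emeasure m {x} \<noteq> 0" "emeasure m {x} < \<infinity>"
proof -
  have xs: "{x} \<in> sets m" using singleton_sets[OF atoms_sub[OF m x]] atomic_masses_D(1)[OF m] by simp
  show ne: "emeasure m {x} \<noteq> 0" using x by (auto simp: atoms_def)
  show "emeasure m {x} \<in> b"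
  proof (rule ccontr)
    assume "emeasure m {x} \<notin> b"
    moreover obtain N where "{x\<in>space m. \<not> emeasure m {x} \<in> b} \<subseteq> N" "emeasure m N = 0" "N \<in> sets m"
      using AE_E[OF atomic_masses_D(5)[OF m]] by metis
    ultimately have "{x} \<subseteq> N" "N \<in> sets m" "emeasure m N = 0"
      using x by (auto simp: atoms_def)
    then have "emeasure m {x} = 0" using emeasure_mono[of "{x}" N m] by simp
    with ne show False ..
  qed
  show "emeasure m {x} < \<infinity>"
    using finite_measure.emeasure_finite[OF atomic_masses_D(4)[OF m]] by (simp add: less_top)
qed

text \<open>Since 0 is not in b, almost every point is an atom, and a finite measure has countably
  many. So f equals almost everywhere the sum of its restrictions to single atoms.\<close>

lemma nn_integral_atomic_masses:
  assumes m: "m \<in> atomic_masses b" and b: "0 \<notin> b" and f: "f \<in> borel_measurable G"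
  shows "(\<integral>\<^sup>+x. f x \<partial>m) = (\<integral>\<^sup>+x. f x * emeasure m {x} \<partial>count_space (atoms m))"
proof -
  note sm = atomic_masses_D[OF m]
  have fm [measurable]: "f \<in> borel_measurable m"
    using f sm(1) by (simp cong: measurable_cong_sets)
  have [measurable]: "{x} \<in> sets m" if "x \<in> atoms m" for x
    using singleton_sets[OF atoms_sub[OF m that]] sm(1) by simp
  have "AE x in m. x \<in> atoms m"
    using sm(5) by (rule AE_mp) (use b in \<open>auto simp: atoms_def\<close>)
  then have "AE x in m. f x = (\<integral>\<^sup>+y. f y * indicator {y} x \<partial>count_space (atoms m))"
  proof (rule AE_mp[OF _ AE_I2[OF impI]])
    fix x assume x: "x \<in> atoms m"
    have "(\<integral>\<^sup>+y. f y * indicator {y} x \<partial>count_space (atoms m)) = (\<Sum>y\<in>{x}. f y * indicator {y} x)"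
      by (rule nn_integral_count_space') (use x in auto)
    then show "f x = (\<integral>\<^sup>+y. f y * indicator {y} x \<partial>count_space (atoms m))" by simp
  qed
  then have "(\<integral>\<^sup>+x. f x \<partial>m) = (\<integral>\<^sup>+x. \<integral>\<^sup>+y. f y * indicator {y} x \<partial>count_space (atoms m) \<partial>m)"
    by (rule nn_integral_cong_AE)
  also have "\<dots> = (\<integral>\<^sup>+y. \<integral>\<^sup>+x. f y * indicator {y} x \<partial>m \<partial>count_space (atoms m))"
    by (rule nn_integral_count_space_nn_integral[OF countable_atoms[OF m]]) measurable
  also have "\<dots> = (\<integral>\<^sup>+y. f y * emeasure m {y} \<partial>count_space (atoms m))"
    by (intro nn_integral_cong) (simp add: nn_integral_cmult_indicator)
  finally show ?thesis .
qed

lemma emeasure_atomic_masses: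
  assumes m: "m \<in> atomic_masses b" and b: "0 \<notin> b" and A: "A \<in> sets G"
  shows "emeasure m A = (\<integral>\<^sup>+x. emeasure m {x} * indicator A x \<partial>count_space (atoms m))"
proof -
  have "emeasure m A = (\<integral>\<^sup>+x. indicator A x \<partial>m)" using A atomic_masses_D(1)[OF m] by simp
  also have "\<dots> = (\<integral>\<^sup>+x. indicator A x * emeasure m {x} \<partial>count_space (atoms m))"
    by (rule nn_integral_atomic_masses[OF m b]) (use A in auto)
  finally show ?thesis by (simp add: mult.commute)
qed

section \<open>Measurable sums over atoms\<close>

text \<open>The sum of f over the atoms and their masses. Integrating against m makes it measurable
  in m but weights each atom by its mass; the division undoes that weight.\<close>

definition atom_sum :: "(ennreal \<Rightarrow> 'u \<Rightarrow> ennreal) \<Rightarrow> 'u measure \<Rightarrow> ennreal" where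
  "atom_sum f m = (if emeasure m (space G) < \<infinity> then \<integral>\<^sup>+x. f (mass m x) x / mass m x \<partial>m else 0)"

lemma measurable_atom_sum [measurable]:
  assumes [measurable]: "(\<lambda>(w, x). f w x) \<in> borel_measurable (borel \<Otimes>\<^sub>M G)"
  shows "atom_sum f \<in> borel_measurable (measure_algebra G)"
proof -
  have [measurable]: "(\<lambda>y. f (mass (fst y) (snd y)) (snd y)) \<in> borel_measurable (measure_algebra G \<Otimes>\<^sub>M G)"
    using measurable_compose[OF _ assms, of "\<lambda>y. (mass (fst y) (snd y), snd y)" "measure_algebra G \<Otimes>\<^sub>M G"]
    by simp
  show ?thesis
    unfolding atom_sum_def[abs_def]
    by (rule measurable_nn_integral_measure_algebra[OF not_empty]) measurable
qed

lemma atom_sum_eq: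
  assumes f: "(\<lambda>(w, x). f w x) \<in> borel_measurable (borel \<Otimes>\<^sub>M G)"
    and m: "m \<in> atomic_masses b" and b: "0 \<notin> b"
  shows "atom_sum f m = (\<integral>\<^sup>+x. f (emeasure m {x}) x \<partial>count_space (atoms m))"
proof -
  note sm = atomic_masses_D[OF m]
  have mm [measurable]: "mass m \<in> borel_measurable G"
    by (rule measurable_mass) (use sm in auto)
  have fm [measurable]: "(\<lambda>x. f (mass m x) x) \<in> borel_measurable G"
    using measurable_compose[OF _ f, of "\<lambda>x. (mass m x, x)" G] by simp
  have "atom_sum f m = (\<integral>\<^sup>+x. f (mass m x) x / mass m x * emeasure m {x} \<partial>count_space (atoms m))"
    unfolding atom_sum_def using sm(3)
    by (simp only: if_True) (rule nn_integral_atomic_masses[OF m b], measurable)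
  also have "\<dots> = (\<integral>\<^sup>+x. f (emeasure m {x}) x \<partial>count_space (atoms m))"
  proof (rule nn_integral_cong)
    fix x assume "x \<in> space (count_space (atoms m))"
    then have x: "x \<in> atoms m" by simp
    show "f (mass m x) x / mass m x * emeasure m {x} = f (emeasure m {x}) x"
      using mass_eq[OF sm(1,3) atoms_sub[OF m x]] emeasure_atom[OF m x]
      by (simp add: ennreal_divide_times)
  qed
  finally show ?thesis .
qed

section \<open>Simple point measures\<close>

abbreviation simple_pts :: "'u measure set" where "simple_pts \<equiv> atomic_masses {1}"

lemma finite_atoms_simple:
  assumes m: "m \<in> simple_pts" shows "finite (atoms m)"
proof (rule ccontr)
  assume inf: "infinite (atoms m)"
  have "emeasure m (space G) = (\<integral>\<^sup>+x. emeasure m {x} * indicator (space G) x \<partial>count_space (atoms m))"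
    by (rule emeasure_atomic_masses[OF m]) auto
  also have "\<dots> = (\<integral>\<^sup>+x. 1 \<partial>count_space (atoms m))"
    using emeasure_atom(1)[OF m] atoms_sub[OF m] by (intro nn_integral_cong) auto
  also have "\<dots> = \<infinity>" using inf by simp
  finally show False using atomic_masses_D(3)[OF m] by simp
qed

lemma emeasure_simple:
  assumes m: "m \<in> simple_pts" and A: "A \<in> sets G"
  shows "emeasure m A = of_nat (card (atoms m \<inter> A))"
proof -
  have "emeasure m A = (\<Sum>x\<in>atoms m. emeasure m {x} * indicator A x)"
    using emeasure_atomic_masses[OF m _ A] finite_atoms_simple[OF m] by (simp add: nn_integral_count_space_finite)
  also have "\<dots> = (\<Sum>x\<in>atoms m. indicator A x)"
    using emeasure_atom(1)[OF m] by (intro sum.cong) auto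
  also have "\<dots> = (\<Sum>x\<in>atoms m. if x \<in> A then 1 else 0)"
    by (intro sum.cong) auto
  also have "\<dots> = of_nat (card (atoms m \<inter> A))"
    using finite_atoms_simple[OF m] by (simp add: sum.inter_restrict[symmetric])
  finally show ?thesis .
qed

lemma simple_ptsI:
  assumes s: "sets m = sets G" and F: "finite F" "F \<subseteq> space G"
    and e: "\<And>A. A \<in> sets G \<Longrightarrow> emeasure m A = of_nat (card (F \<inter> A))"
  shows "m \<in> simple_pts" "atoms m = F"
proof -
  have sp: "space m = space G" using s by (rule sets_eq_imp_space_eq)
  have e1: "emeasure m {x} = (if x \<in> F then 1 else 0)" if "x \<in> space G" for x
    using e[OF singleton_sets[OF that]] by (simp add: Int_insert_right)
  show "atoms m = F" using e1 F(2) by (auto simp: atoms_def sp split: if_splits)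
  have FG: "F \<in> sets G"
  proof (rule sets.countable)
    show "{x} \<in> sets G" if "x \<in> F" for x
      using F(2) that by (intro singleton_sets) blast
  qed (rule countable_finite[OF F(1)])
  have "AE x in m. emeasure m {x} \<in> {1}"
  proof (rule AE_I'[of "space G - F"])
    show "space G - F \<in> null_sets m"
    proof (rule null_setsI)
      have "F \<inter> (space G - F) = {}" by blast
      then show "emeasure m (space G - F) = 0"
        using e[of "space G - F"] FG by (simp add: sets.compl_sets)
    qed (use FG s in \<open>simp add: sets.compl_sets\<close>)
    show "{x \<in> space m. emeasure m {x} \<notin> {1}} \<subseteq> space G - F"
      using e1 by (auto simp only: sp mem_Collect_eq singleton_iff if_True)
  qed
  moreover have "emeasure m (space G) < \<infinity>"
    by (simp only: e[OF sets.top]) (simp add: of_nat_less_top)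
  ultimately show "m \<in> simple_pts" using s unfolding atomic_masses_def by blast
qed

end


section \<open>Avoidance events\<close>

context separated_prob_space
begin

definition zset :: "nat \<Rightarrow> (nat \<Rightarrow> 'u measure) \<Rightarrow> 'u \<Rightarrow> nat set" where
  "zset n \<pi> x = {i. i < n \<and> x \<in> atoms (\<pi> i)}"

lemma card_zset: "card (zset n \<pi> x) = multiplicity_of n \<pi> x"
  by (simp add: zset_def multiplicity_of_def)

lemma zset_subset: "zset n \<pi> x \<subseteq> {..<n}"
  by (auto simp: zset_def)

lemma zset_eq_empty_iff: "zset n \<pi> x = {} \<longleftrightarrow> x \<notin> observed n \<pi>"
  by (auto simp: zset_def observed_def)

lemma finite_observed: "(\<And>i. i < n \<Longrightarrow> \<pi> i \<in> simple_pts) \<Longrightarrow> finite (observed n \<pi>)"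
  by (auto simp: observed_def intro: finite_atoms_simple)

lemma observed_sub: "(\<And>i. i < n \<Longrightarrow> \<pi> i \<in> simple_pts) \<Longrightarrow> observed n \<pi> \<subseteq> space G"
  using atoms_sub by (auto simp: observed_def)

text \<open>The sum of l over the observed atoms and their patterns, in a form measurable in the
  sample. Atoms of pattern Z are integrated against the one measure with index \<open>Min Z\<close>,
  so that each is counted once, and \<open>mass\<close> tests the pattern. The empty pattern is left
  out: it belongs to the unobserved points.\<close>

definition obs_sum :: "nat \<Rightarrow> (nat set \<Rightarrow> 'u \<Rightarrow> ennreal) \<Rightarrow> (nat \<Rightarrow> 'u measure) \<Rightarrow> ennreal" where
  "obs_sum n l \<pi> = (\<Sum>Z\<in>Pow {..<n} - {{}}.
     if emeasure (\<pi> (Min Z)) (space G) < \<infinity>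
     then \<integral>\<^sup>+x. l Z x * (if \<forall>j<n. mass (\<pi> j) x \<noteq> 0 \<longleftrightarrow> j \<in> Z then 1 else 0) \<partial>\<pi> (Min Z) else 0)"

lemma measurable_obs_sum:
  assumes l: "\<And>Z. Z \<subseteq> {..<n} \<Longrightarrow> l Z \<in> borel_measurable G" and I: "{..<n} \<subseteq> I"
  shows "obs_sum n l \<in> borel_measurable (PiM I (\<lambda>_. measure_algebra G))"
  unfolding obs_sum_def[abs_def]
proof (intro borel_measurable_sum)
  fix Z assume Z: "Z \<in> Pow {..<n} - {{}}"
  have lZ: "l Z \<in> borel_measurable G" using l Z by auto
  have comp: "(\<lambda>\<pi>. \<pi> j) \<in> PiM I (\<lambda>_. measure_algebra G) \<rightarrow>\<^sub>M measure_algebra G" if "j < n" for j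
    using I that by (intro measurable_component_singleton) auto
  have "Min Z \<in> Z" using Z by (intro Min_in) (auto intro: finite_subset)
  then have min: "Min Z < n" using Z by auto
  have [measurable]: "(\<lambda>y. mass (fst y j) (snd y)) \<in> borel_measurable (PiM I (\<lambda>_. measure_algebra G) \<Otimes>\<^sub>M G)"
    if "j < n" for j
    by (rule measurable_mass) (use measurable_compose[OF measurable_fst comp[OF that]] in auto)
  have P: "Measurable.pred (PiM I (\<lambda>_. measure_algebra G) \<Otimes>\<^sub>M G)
      (\<lambda>y. \<forall>j<n. mass (fst y j) (snd y) \<noteq> 0 \<longleftrightarrow> j \<in> Z)"
  proof -
    have "(\<lambda>y. \<forall>j<n. mass (fst y j) (snd y) \<noteq> 0 \<longleftrightarrow> j \<in> Z) =
      (\<lambda>y. \<forall>j\<in>{..<n}. mass (fst y j) (snd y) \<noteq> 0 \<longleftrightarrow> j \<in> Z)" by auto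
    also have "Measurable.pred (PiM I (\<lambda>_. measure_algebra G) \<Otimes>\<^sub>M G) \<dots>"
    proof (intro pred_intros_finite)
      fix j assume "j \<in> {..<n}"
      then have j: "j < n" by simp
      show "Measurable.pred (PiM I (\<lambda>_. measure_algebra G) \<Otimes>\<^sub>M G) (\<lambda>y. mass (fst y j) (snd y) \<noteq> 0 \<longleftrightarrow> j \<in> Z)"
        using j by measurable
    qed auto
    finally show ?thesis .
  qed
  show "(\<lambda>\<pi>. if emeasure (\<pi> (Min Z)) (space G) < \<infinity>
     then \<integral>\<^sup>+x. l Z x * (if \<forall>j<n. mass (\<pi> j) x \<noteq> 0 \<longleftrightarrow> j \<in> Z then 1 else 0) \<partial>\<pi> (Min Z) else 0)
    \<in> borel_measurable (PiM I (\<lambda>_. measure_algebra G))"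
  proof (rule measurable_nn_integral_measure_algebra[OF not_empty comp[OF min]])
    have "(\<lambda>y. l Z (snd y) * (if \<forall>j<n. mass (fst y j) (snd y) \<noteq> 0 \<longleftrightarrow> j \<in> Z then 1 else 0))
      \<in> borel_measurable (PiM I (\<lambda>_. measure_algebra G) \<Otimes>\<^sub>M G)"
      by (intro borel_measurable_times_ennreal measurable_compose[OF measurable_snd lZ] measurable_If[OF _ _ P[unfolded pred_def]]) auto
    then show "(\<lambda>(\<pi>, x). l Z x * (if \<forall>j<n. mass (\<pi> j) x \<noteq> 0 \<longleftrightarrow> j \<in> Z then 1 else 0))
      \<in> borel_measurable (PiM I (\<lambda>_. measure_algebra G) \<Otimes>\<^sub>M G)"
      by (simp add: split_def)
  qed
qed

lemma obs_sum_eq: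
  assumes \<pi>: "\<And>i. i < n \<Longrightarrow> \<pi> i \<in> simple_pts"
    and l: "\<And>Z. Z \<subseteq> {..<n} \<Longrightarrow> l Z \<in> borel_measurable G"
  shows "obs_sum n l \<pi> = (\<Sum>x\<in>observed n \<pi>. l (zset n \<pi> x) x)"
proof -
  let ?O = "observed n \<pi>"
  have fin: "finite ?O" and sub: "?O \<subseteq> space G"
    using finite_observed[of n \<pi>] observed_sub[of n \<pi>] \<pi> by auto
  have zs: "(\<forall>j<n. mass (\<pi> j) x \<noteq> 0 \<longleftrightarrow> j \<in> Z) \<longleftrightarrow> zset n \<pi> x = Z"
    if Z: "Z \<subseteq> {..<n}" and x: "x \<in> space G" for Z x
  proof -
    have "mass (\<pi> j) x \<noteq> 0 \<longleftrightarrow> x \<in> atoms (\<pi> j)" if j: "j < n" for j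
      using mass_eq[OF atomic_masses_D(1,3)[OF \<pi>[OF j]] x] x atomic_masses_D(2)[OF \<pi>[OF j]] by (simp add: atoms_def)
    then show ?thesis using Z by (auto simp: zset_def)
  qed
  have "obs_sum n l \<pi> = (\<Sum>Z\<in>Pow {..<n} - {{}}. \<Sum>x\<in>?O. if zset n \<pi> x = Z then l Z x else 0)"
    unfolding obs_sum_def
  proof (rule sum.cong)
    fix Z assume Z: "Z \<in> Pow {..<n} - {{}}"
    then have Zs: "Z \<subseteq> {..<n}" by auto
    have "Min Z \<in> Z" using Z by (intro Min_in) (auto intro: finite_subset)
    then have min: "Min Z < n" and minZ: "Min Z \<in> Z" using Z by auto
    note p = \<pi>[OF min]
    have sp: "emeasure (\<pi> (Min Z)) (space G) < \<infinity>" using atomic_masses_D(3)[OF p] .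
    have mm: "mass (\<pi> j) \<in> borel_measurable G" if "j < n" for j
      by (rule measurable_mass) (use atomic_masses_D(6)[OF \<pi>[OF that]] in auto)
    have ind: "(\<lambda>x. if zset n \<pi> x = Z then 1 else 0 :: ennreal) \<in> borel_measurable G"
    proof -
      have "Measurable.pred G (\<lambda>x. \<forall>j\<in>{..<n}. mass (\<pi> j) x \<noteq> 0 \<longleftrightarrow> j \<in> Z)"
      proof (intro pred_intros_finite)
        fix j assume "j \<in> {..<n}"
        then have [measurable]: "mass (\<pi> j) \<in> borel_measurable G" using mm by auto
        show "Measurable.pred G (\<lambda>x. mass (\<pi> j) x \<noteq> 0 \<longleftrightarrow> j \<in> Z)" by measurable
      qed auto
      then have "(\<lambda>x. if \<forall>j\<in>{..<n}. mass (\<pi> j) x \<noteq> 0 \<longleftrightarrow> j \<in> Z then 1 else 0 :: ennreal) \<in> borel_measurable G"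
        by measurable
      then show ?thesis
        by (rule measurable_cong[THEN iffD1, rotated]) (simp add: zs[OF Zs, symmetric] Ball_def)
    qed
    have "(\<integral>\<^sup>+x. l Z x * (if \<forall>j<n. mass (\<pi> j) x \<noteq> 0 \<longleftrightarrow> j \<in> Z then 1 else 0) \<partial>\<pi> (Min Z))
        = (\<integral>\<^sup>+x. l Z x * (if zset n \<pi> x = Z then 1 else 0) \<partial>\<pi> (Min Z))"
      by (rule nn_integral_cong) (simp only: atomic_masses_D(2)[OF p] zs[OF Zs])
    also have "\<dots> = (\<integral>\<^sup>+x. l Z x * (if zset n \<pi> x = Z then 1 else 0) * emeasure (\<pi> (Min Z)) {x} \<partial>count_space (atoms (\<pi> (Min Z))))"
      by (rule nn_integral_atomic_masses[OF p]) (simp; fail | rule borel_measurable_times_ennreal | rule ind | rule l[OF Zs])+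
    also have "\<dots> = (\<Sum>x\<in>atoms (\<pi> (Min Z)). if zset n \<pi> x = Z then l Z x else 0)"
      using finite_atoms_simple[OF p] emeasure_atom(1)[OF p]
      by (subst nn_integral_count_space_finite) (auto intro!: sum.cong)
    also have "\<dots> = (\<Sum>x\<in>?O. if zset n \<pi> x = Z then l Z x else 0)"
    proof (rule sum.mono_neutral_left[OF fin])
      show "atoms (\<pi> (Min Z)) \<subseteq> ?O" using min by (auto simp: observed_def)
      show "\<forall>x\<in>?O - atoms (\<pi> (Min Z)). (if zset n \<pi> x = Z then l Z x else 0) = 0"
        using minZ min by (auto simp: zset_def)
    qed
    finally show "(if emeasure (\<pi> (Min Z)) (space G) < \<infinity>
       then \<integral>\<^sup>+x. l Z x * (if \<forall>j<n. mass (\<pi> j) x \<noteq> 0 \<longleftrightarrow> j \<in> Z then 1 else 0) \<partial>\<pi> (Min Z) else 0)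
      = (\<Sum>x\<in>?O. if zset n \<pi> x = Z then l Z x else 0)"
      using sp by (simp only: if_True)
  qed simp
  also have "\<dots> = (\<Sum>x\<in>?O. \<Sum>Z\<in>Pow {..<n} - {{}}. if zset n \<pi> x = Z then l Z x else 0)"
    by (rule sum.swap)
  also have "\<dots> = (\<Sum>x\<in>?O. l (zset n \<pi> x) x)"
  proof (rule sum.cong)
    fix x assume "x \<in> ?O"
    then have "zset n \<pi> x \<in> Pow {..<n} - {{}}"
      using zset_eq_empty_iff[of n \<pi> x] zset_subset[of n \<pi> x] by auto
    then show "(\<Sum>Z\<in>Pow {..<n} - {{}}. if zset n \<pi> x = Z then l Z x else 0) = l (zset n \<pi> x) x"
      by (subst sum.delta') auto
  qed simp
  finally show ?thesis .
qed

section \<open>Avoidance events of a single measure\<close>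

definition void_sets :: "'u measure set set" where
  "void_sets = {{m\<in>space (measure_algebra G). emeasure m A = 0} | A. A \<in> sets G}"

lemma void_sets_sub: "void_sets \<subseteq> sets (measure_algebra G)"
  by (auto simp: void_sets_def)

text \<open>The number of partition cells in which m charges A, at ever finer partitions. It is
  built from avoidance events only.\<close>

definition hits :: "'u set \<Rightarrow> 'u measure \<Rightarrow> ennreal" where
  "hits A m = (SUP N. \<Sum>s\<in>Pow {..<N}. if emeasure m (A \<inter> cell N s) = 0 then 0 else 1)"

text \<open>At level N the count is the number of distinct codes of the atoms in A. Finitely many
  atoms are told apart at some finite level, from which on the count is exact.\<close>

lemma hits_eq:
  assumes m: "m \<in> simple_pts" and A: "A \<in> sets G"
  shows "hits A m = emeasure m A"
proof -
  define F where "F = atoms m \<inter> A"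
  have F: "finite F" "F \<subseteq> space G"
    using finite_atoms_simple[OF m] atoms_sub[OF m] by (auto simp: F_def)
  have e: "emeasure m A = of_nat (card F)"
    using emeasure_simple[OF m A] by (simp add: F_def)
  have cnt: "(\<Sum>s\<in>Pow {..<N}. if emeasure m (A \<inter> cell N s) = 0 then 0 else 1) = (of_nat (card (code N ` F)) :: ennreal)" for N
  proof -
    have "(\<Sum>s\<in>Pow {..<N}. if emeasure m (A \<inter> cell N s) = 0 then 0 else 1) =
        (\<Sum>s\<in>Pow {..<N}. if s \<in> code N ` F then 1 else 0 :: ennreal)"
    proof (rule sum.cong)
      fix s assume s: "s \<in> Pow {..<N}"
      have "emeasure m (A \<inter> cell N s) = of_nat (card (F \<inter> cell N s))"
        using emeasure_simple[OF m, of "A \<inter> cell N s"] A by (simp add: F_def Int_assoc)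
      moreover have "F \<inter> cell N s = {} \<longleftrightarrow> s \<notin> code N ` F"
        using s F(2) by (auto simp: mem_cell_iff subset_eq)
      ultimately show "(if emeasure m (A \<inter> cell N s) = 0 then 0 else 1) = (if s \<in> code N ` F then 1 else 0 :: ennreal)"
        using F(1) by simp
    qed simp
    also have "\<dots> = of_nat (card (Pow {..<N} \<inter> code N ` F))"
      by (simp add: sum.inter_restrict[symmetric])
    also have "Pow {..<N} \<inter> code N ` F = code N ` F"
      using code_subset by auto
    finally show ?thesis .
  qed
  \<comment> \<open>Each of the finitely many pairs of distinct atoms is separated by some set of
    the sequence; N exceeds all the indices used.\<close>
  have "\<exists>N. inj_on (code N) F"
  proof -
    have "\<forall>p\<in>{(x, y). x \<in> F \<and> y \<in> F \<and> x \<noteq> y}. \<exists>i. (fst p \<in> c i) \<noteq> (snd p \<in> c i)"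
      using c_sep F(2) by auto
    from bchoice[OF this] obtain i where
      i: "\<And>p. p \<in> {(x, y). x \<in> F \<and> y \<in> F \<and> x \<noteq> y} \<Longrightarrow> (fst p \<in> c (i p)) \<noteq> (snd p \<in> c (i p))"
      by blast
    have "finite {(x, y). x \<in> F \<and> y \<in> F \<and> x \<noteq> y}"
      by (rule finite_subset[of _ "F \<times> F"]) (use F(1) in auto)
    then obtain N where N: "\<And>p. p \<in> {(x, y). x \<in> F \<and> y \<in> F \<and> x \<noteq> y} \<Longrightarrow> i p < N"
      using finite_nat_set_iff_bounded[of "i ` {(x, y). x \<in> F \<and> y \<in> F \<and> x \<noteq> y}"] by auto
    have "inj_on (code N) F"
    proof (rule inj_onI, rule ccontr)
      fix x y assume xy: "x \<in> F" "y \<in> F" "code N x = code N y" "x \<noteq> y"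
      then have "(x \<in> c (i (x, y))) \<noteq> (y \<in> c (i (x, y)))" "i (x, y) < N"
        using i[of "(x, y)"] N[of "(x, y)"] by auto
      with xy(3) show False by (auto simp: code_def)
    qed
    then show ?thesis ..
  qed
  then obtain N0 where N0: "inj_on (code N0) F" ..
  show ?thesis
    unfolding hits_def cnt e
  proof (rule antisym)
    show "(SUP N. of_nat (card (code N ` F))) \<le> (of_nat (card F) :: ennreal)"
      using F(1) by (intro SUP_least) (simp add: card_image_le)
    show "(of_nat (card F) :: ennreal) \<le> (SUP N. of_nat (card (code N ` F)))"
      using N0 by (intro SUP_upper2[of N0]) (auto simp: card_image)
  qed
qed

text \<open>Renyi's theorem in set form: up to non-simple measures, the avoidance events generate the
  whole sigma-algebra.\<close>

lemma void_sets_generate: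
  assumes "B \<in> sets (measure_algebra G)"
  shows "\<exists>B'\<in>sigma_sets (space (measure_algebra G)) void_sets. B \<inter> simple_pts = B' \<inter> simple_pts"
proof -
  let ?S = "space (measure_algebra G)"
  have V: "void_sets \<subseteq> Pow ?S" by (auto simp: void_sets_def)
  interpret V: sigma_algebra ?S "sigma_sets ?S void_sets"
    using V by (rule sigma_algebra_sigma_sets)
  from assms show ?thesis
    unfolding sets_measure_algebra
  proof (induction rule: sigma_sets.induct)
    case (Basic a)
    then obtain A b where A: "A \<in> sets G" and b: "b \<in> sets borel" and a: "a = (\<lambda>m. emeasure m A) -` b \<inter> ?S"
      by auto
    have pD: "Measurable.pred (sigma ?S void_sets) (\<lambda>m. emeasure m D = 0)" if "D \<in> sets G" for D
    proof -
      have "{m\<in>?S. emeasure m D = 0} \<in> sigma_sets ?S void_sets"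
        using that by (intro sigma_sets.Basic) (auto simp: void_sets_def)
      then show ?thesis
        using V by (simp add: pred_def sets_measure_of space_measure_of)
    qed
    have "A \<inter> cell N s \<in> sets G" for N s
      using A by simp
    note [measurable] = pD[OF this]
    \<comment> \<open>Measurable for the avoidance sigma-algebra, and equal to the evaluation at A
      on simple point measures: this reduces counts to avoidance.\<close>
    have "hits A \<in> borel_measurable (sigma ?S void_sets)"
      unfolding hits_def[abs_def] by measurable
    from measurable_sets[OF this b] have "hits A -` b \<inter> ?S \<in> sigma_sets ?S void_sets"
      using V by (simp add: sets_measure_of space_measure_of)
    moreover have "a \<inter> simple_pts = (hits A -` b \<inter> ?S) \<inter> simple_pts"
      using hits_eq[OF _ A] by (auto simp: a)
    ultimately show ?case by blast
  next
    case Empty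
    show ?case by (intro bexI[of _ "{}"]) (auto intro: sigma_sets.Empty)
  next
    case (Compl a)
    then obtain B' where B': "B' \<in> sigma_sets ?S void_sets" "a \<inter> simple_pts = B' \<inter> simple_pts" by auto
    then have "(?S - a) \<inter> simple_pts = (?S - B') \<inter> simple_pts" by auto
    with B'(1) show ?case by (intro bexI[of _ "?S - B'"]) (auto intro: sigma_sets.Compl)
  next
    case (Union a)
    then obtain B' where B': "\<And>i. B' i \<in> sigma_sets ?S void_sets" "\<And>i. a i \<inter> simple_pts = B' i \<inter> simple_pts" by metis
    then have "(\<Union>i. a i) \<inter> simple_pts = (\<Union>i. B' i) \<inter> simple_pts" by auto
    with B'(1) show ?case by (intro bexI[of _ "\<Union>i. B' i"]) (auto intro: sigma_sets.Union)
  qed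
qed

text \<open>Avoiding two sets means avoiding their union.\<close>

lemma Int_stable_void_sets: "Int_stable void_sets"
proof (rule Int_stableI)
  fix a b assume "a \<in> void_sets" "b \<in> void_sets"
  then obtain A B where AB: "A \<in> sets G" "B \<in> sets G"
    "a = {m\<in>space (measure_algebra G). emeasure m A = 0}" "b = {m\<in>space (measure_algebra G). emeasure m B = 0}"
    by (auto simp: void_sets_def)
  have "emeasure m (A \<union> B) = 0 \<longleftrightarrow> emeasure m A = 0 \<and> emeasure m B = 0" if "sets m = sets G" for m
  proof
    assume "emeasure m (A \<union> B) = 0"
    then show "emeasure m A = 0 \<and> emeasure m B = 0"
      using emeasure_mono[of A "A \<union> B" m] emeasure_mono[of B "A \<union> B" m] AB that by auto
  next
    assume "emeasure m A = 0 \<and> emeasure m B = 0"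
    then show "emeasure m (A \<union> B) = 0"
      using emeasure_subadditive[of A m B] AB that by auto
  qed
  then have "a \<inter> b = {m\<in>space (measure_algebra G). emeasure m (A \<union> B) = 0}"
    using AB by (auto simp: space_measure_algebra)
  then show "a \<inter> b \<in> void_sets" using AB by (auto simp: void_sets_def)
qed

section \<open>Avoidance events of a sample\<close>

definition void_boxes :: "nat \<Rightarrow> (nat \<Rightarrow> 'u measure) set set" where
  "void_boxes n = {{\<pi>\<in>space (PiM {..<n} (\<lambda>_. measure_algebra G)). \<forall>i<n. emeasure (\<pi> i) (A i) = 0} | A. \<forall>i<n. A i \<in> sets G}"

lemma void_boxes_sub: "void_boxes n \<subseteq> sets (PiM {..<n} (\<lambda>_. measure_algebra G))"
proof
  fix a assume "a \<in> void_boxes n"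
  then obtain A where A: "\<forall>i<n. A i \<in> sets G"
    "a = {\<pi>\<in>space (PiM {..<n} (\<lambda>_. measure_algebra G)). \<forall>i<n. emeasure (\<pi> i) (A i) = 0}"
    by (auto simp: void_boxes_def)
  have "a = {\<pi>\<in>space (PiM {..<n} (\<lambda>_. measure_algebra G)). \<forall>i\<in>{..<n}. emeasure (\<pi> i) (A i) = 0}"
    using A by auto
  also have "\<dots> \<in> sets (PiM {..<n} (\<lambda>_. measure_algebra G))"
  proof (intro sets.sets_Collect_finite_All)
    fix i assume i: "i \<in> {..<n}"
    then have [measurable]: "(\<lambda>m. emeasure m (A i)) \<in> borel_measurable (measure_algebra G)"
      using A by auto
    show "{\<pi> \<in> space (PiM {..<n} (\<lambda>_. measure_algebra G)). emeasure (\<pi> i) (A i) = 0} \<in> sets (PiM {..<n} (\<lambda>_. measure_algebra G))"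
      using measurable_compose[OF measurable_component_singleton[OF i] \<open>(\<lambda>m. emeasure m (A i)) \<in> _\<close>]
      by measurable
  qed auto
  finally show "a \<in> sets (PiM {..<n} (\<lambda>_. measure_algebra G))" .
qed

lemma Int_stable_void_boxes: "Int_stable (void_boxes n)"
proof (rule Int_stableI)
  fix a b assume "a \<in> void_boxes n" "b \<in> void_boxes n"
  then obtain A B where AB: "\<forall>i<n. A i \<in> sets G" "\<forall>i<n. B i \<in> sets G"
    "a = {\<pi>\<in>space (PiM {..<n} (\<lambda>_. measure_algebra G)). \<forall>i<n. emeasure (\<pi> i) (A i) = 0}"
    "b = {\<pi>\<in>space (PiM {..<n} (\<lambda>_. measure_algebra G)). \<forall>i<n. emeasure (\<pi> i) (B i) = 0}"
    by (auto simp: void_boxes_def)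
  have "emeasure m (A i \<union> B i) = 0 \<longleftrightarrow> emeasure m (A i) = 0 \<and> emeasure m (B i) = 0"
    if "sets m = sets G" "i < n" for m i
  proof
    assume "emeasure m (A i \<union> B i) = 0"
    then show "emeasure m (A i) = 0 \<and> emeasure m (B i) = 0"
      using emeasure_mono[of "A i" "A i \<union> B i" m] emeasure_mono[of "B i" "A i \<union> B i" m] AB that by auto
  next
    assume "emeasure m (A i) = 0 \<and> emeasure m (B i) = 0"
    then show "emeasure m (A i \<union> B i) = 0"
      using emeasure_subadditive[of "A i" m "B i"] AB that by auto
  qed
  then have "a \<inter> b = {\<pi>\<in>space (PiM {..<n} (\<lambda>_. measure_algebra G)). \<forall>i<n. emeasure (\<pi> i) (A i \<union> B i) = 0}"
    using AB by (auto simp: space_PiM space_measure_algebra PiE_iff)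
  then show "a \<inter> b \<in> void_boxes n"
    unfolding void_boxes_def using AB by (auto intro!: exI[of _ "\<lambda>i. A i \<union> B i"])
qed

text \<open>The product sigma-algebra is generated by single coordinates, so the statement for one
  measure is applied to each coordinate separately.\<close>

lemma void_boxes_generate:
  assumes "C \<in> sets (PiM {..<n} (\<lambda>_. measure_algebra G))"
  shows "\<exists>C'\<in>sigma_sets (space (PiM {..<n} (\<lambda>_. measure_algebra G))) (void_boxes n).
    C \<inter> {\<pi>. \<forall>i<n. \<pi> i \<in> simple_pts} = C' \<inter> {\<pi>. \<forall>i<n. \<pi> i \<in> simple_pts}"
proof -
  let ?P = "PiM {..<n} (\<lambda>_. measure_algebra G)"
  let ?S = "space ?P" and ?E = "{\<pi>. \<forall>i<n. \<pi> i \<in> simple_pts}"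
  have V: "void_boxes n \<subseteq> Pow ?S" by (auto simp: void_boxes_def)
  have s: "space ?P = ({..<n} \<rightarrow>\<^sub>E space (measure_algebra G))" by (simp add: space_PiM)
  from assms show ?thesis
    unfolding sets_PiM_single s[symmetric]
  proof (induction rule: sigma_sets.induct)
    case (Basic a)
    then obtain i B where i: "i < n" and B: "B \<in> sets (measure_algebra G)" and a: "a = {f\<in>?S. f i \<in> B}"
      by (auto simp: s)
    obtain B' where B': "B' \<in> sigma_sets (space (measure_algebra G)) void_sets" "B \<inter> simple_pts = B' \<inter> simple_pts"
      using void_sets_generate[OF B] by auto
    have "(\<lambda>\<pi>. \<pi> i) \<in> sigma ?S (void_boxes n) \<rightarrow>\<^sub>M sigma (space (measure_algebra G)) void_sets"
    proof (rule measurable_sigma_sets)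
      show "sets (sigma (space (measure_algebra G)) void_sets) = sigma_sets (space (measure_algebra G)) void_sets"
        by (rule sets_measure_of) (auto simp: void_sets_def)
      show "void_sets \<subseteq> Pow (space (measure_algebra G))" by (auto simp: void_sets_def)
      show "(\<lambda>\<pi>. \<pi> i) \<in> space (sigma ?S (void_boxes n)) \<rightarrow> space (measure_algebra G)"
        using i V by (auto simp: space_measure_of s)
      fix y assume "y \<in> void_sets"
      then obtain A where A: "A \<in> sets G" "y = {m\<in>space (measure_algebra G). emeasure m A = 0}"
        by (auto simp: void_sets_def)
      \<comment> \<open>The other coordinates are given the empty set, which every measure
        avoids.\<close>
      have "(\<lambda>\<pi>. \<pi> i) -` y \<inter> ?S = {\<pi>\<in>?S. \<forall>j<n. emeasure (\<pi> j) (if j = i then A else {}) = 0}"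
        using i A by (auto simp: s)
      also have "\<dots> \<in> void_boxes n"
        unfolding void_boxes_def using A by (auto intro!: exI[of _ "\<lambda>j. if j = i then A else {}"])
      finally show "(\<lambda>\<pi>. \<pi> i) -` y \<inter> space (sigma ?S (void_boxes n)) \<in> sets (sigma ?S (void_boxes n))"
        using V by (simp add: space_measure_of sets_measure_of)
    qed
    moreover have "B' \<in> sets (sigma (space (measure_algebra G)) void_sets)"
      using B'(1) void_sets_sub sets.sets_into_space by (subst sets_measure_of) auto
    ultimately have "(\<lambda>\<pi>. \<pi> i) -` B' \<inter> space (sigma ?S (void_boxes n)) \<in> sets (sigma ?S (void_boxes n))"
      by (rule measurable_sets)
    then have "(\<lambda>\<pi>. \<pi> i) -` B' \<inter> ?S \<in> sigma_sets ?S (void_boxes n)"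
      using V by (simp add: space_measure_of sets_measure_of)
    moreover have "a \<inter> ?E = ((\<lambda>\<pi>. \<pi> i) -` B' \<inter> ?S) \<inter> ?E"
      using B'(2) i by (auto simp: a)
    ultimately show ?case by blast
  next
    case Empty
    show ?case by (intro bexI[of _ "{}"]) (auto intro: sigma_sets.Empty)
  next
    case (Compl a)
    then obtain B' where B': "B' \<in> sigma_sets ?S (void_boxes n)" "a \<inter> ?E = B' \<inter> ?E" by auto
    then have "(?S - a) \<inter> ?E = (?S - B') \<inter> ?E" by auto
    with B'(1) show ?case by (intro bexI[of _ "?S - B'"]) (auto intro: sigma_sets.Compl)
  next
    case (Union a)
    then obtain B' where B': "\<And>i. B' i \<in> sigma_sets ?S (void_boxes n)" "\<And>i. a i \<inter> ?E = B' i \<inter> ?E" by metis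
    then have "(\<Union>i. a i) \<inter> ?E = (\<Union>i. B' i) \<inter> ?E" by blast
    with B'(1) show ?case by (intro bexI[of _ "\<Union>i. B' i"]) (auto intro: sigma_sets.Union)
  qed
qed

end


section \<open>Discrete random measures\<close>

lemma indep_vars_PiM_components:
  assumes M: "\<And>i. i \<in> I \<Longrightarrow> prob_space (M i)"
  shows "prob_space.indep_vars (PiM I M) M (\<lambda>i \<omega>. \<omega> i) I"
proof (cases "I = {}")
  case False
  interpret prob_space "PiM I M" by (rule prob_space_PiM[OF M])
  have "distr (PiM I M) (PiM I M) (\<lambda>\<omega>. \<lambda>i\<in>I. \<omega> i) = distr (PiM I M) (PiM I M) (\<lambda>\<omega>. \<omega>)"
    by (rule distr_cong) (auto simp: space_PiM PiE_restrict)
  also have "\<dots> = PiM I M" by (rule distr_id)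
  also have "\<dots> = PiM I (\<lambda>i. distr (PiM I M) (M i) (\<lambda>\<omega>. \<omega> i))"
    by (rule PiM_cong) (simp_all add: distr_PiM_component M)
  finally show ?thesis
    using False by (subst indep_vars_iff_distr_eq_PiM') simp_all
next
  case True
  interpret prob_space "PiM I M" by (rule prob_space_PiM[OF M])
  show ?thesis unfolding indep_vars_def indep_sets_def using True by auto
qed

text \<open>On the event that X is infinite, \<open>nexp (t X)\<close> vanishes for every t > 0. The
  expectation thus stays below the probability of the complement, whereas the assumed lower bound
  tends to 1 as t tends to 0.\<close>

lemma AE_neq_top_of_nexp:
  assumes M: "prob_space M" and X: "X \<in> borel_measurable M" and K: "K < \<infinity>"
    and lower: "\<And>t. t \<in> {0<..1} \<Longrightarrow> nexp (ennreal t * K) \<le> (\<integral>\<^sup>+\<omega>. nexp (ennreal t * X \<omega>) \<partial>M)"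
  shows "AE \<omega> in M. X \<omega> < \<infinity>"
proof -
  interpret prob_space M by fact
  note [measurable] = X
  define A where "A = {\<omega>\<in>space M. X \<omega> = \<infinity>}"
  have [measurable]: "A \<in> sets M" unfolding A_def by measurable
  have le: "emeasure M A + nexp (ennreal t * K) \<le> 1" if t: "t \<in> {0<..1}" for t
  proof -
    have "emeasure M A + nexp (ennreal t * K) \<le> emeasure M A + (\<integral>\<^sup>+\<omega>. nexp (ennreal t * X \<omega>) \<partial>M)"
      by (intro add_left_mono lower t)
    also have "\<dots> = (\<integral>\<^sup>+\<omega>. indicator A \<omega> + nexp (ennreal t * X \<omega>) \<partial>M)"
      by (subst nn_integral_add) (auto intro!: measurable_compose[OF _ nexp_measurable])
    also have "\<dots> \<le> (\<integral>\<^sup>+\<omega>. 1 \<partial>M)"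
    proof (rule nn_integral_mono)
      fix \<omega> assume "\<omega> \<in> space M"
      show "indicator A \<omega> + nexp (ennreal t * X \<omega>) \<le> 1"
        using t by (auto simp: A_def indicator_def ennreal_mult_top)
    qed
    finally show ?thesis by (simp add: emeasure_space_1)
  qed
  have "(\<lambda>n. emeasure M A + nexp (ennreal (1 / real (Suc n)) * K)) \<longlonglongrightarrow> emeasure M A + nexp (ennreal 0 * K)"
  proof (intro tendsto_add tendsto_const tendsto_nexp)
    have "(\<lambda>n. 1 / real (Suc n)) \<longlonglongrightarrow> 0"
      using LIMSEQ_inverse_real_of_nat by (simp add: inverse_eq_divide)
    then show "(\<lambda>n. ennreal (1 / real (Suc n)) * K) \<longlonglongrightarrow> ennreal 0 * K"
      using K by (intro tendsto_mult_ennreal tendsto_ennrealI tendsto_const) auto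
  qed
  then have "emeasure M A + nexp (ennreal 0 * K) \<le> 1"
    by (rule LIMSEQ_le_const2) (intro exI[of _ 0] allI impI le, simp)
  then have "ennreal (measure M A + 1) \<le> ennreal 1" by (simp add: emeasure_eq_measure)
  then have "measure M A \<le> 0" by (subst (asm) ennreal_le_iff) auto
  then have "emeasure M A = 0"
    by (simp add: emeasure_eq_measure ennreal_eq_0_iff)
  then have "AE \<omega> in M. \<omega> \<notin> A"
    by (intro AE_not_in) (simp add: null_setsI)
  then show ?thesis
    by (rule AE_mp[OF _ AE_I2]) (auto simp: A_def less_top)
qed

section \<open>Beta integrals and the stable intensity\<close>

lemma nn_integral_Beta:
  assumes "0 < a" "0 < b"
  shows "(\<integral>\<^sup>+x. ennreal (x powr (a - 1) * (1 - x) powr (b - 1)) * indicator {0<..<1} x \<partial>lborel) = ennreal (Beta a b)"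
  using has_integral_Beta_real[OF assms]
  by (intro nn_integral_has_integral_lebesgue') (auto simp: has_integral_Icc_iff_Ioo)

text \<open>The scaled density for \<open>a = 1\<close>; by self-similarity \<open>a\<close> only enters as a factor \<open>a powr - \<alpha>\<close>.\<close>

definition stable_levy :: "real \<Rightarrow> real measure" where
  "stable_levy \<alpha> = density lborel (\<lambda>s. ennreal (\<alpha> * s powr (- 1 - \<alpha>)) * indicator {0<..1} s)"

lemma sets_stable_levy [measurable_cong, simp]: "sets (stable_levy \<alpha>) = sets borel"
  by (simp add: stable_levy_def)

lemma space_stable_levy [simp]: "space (stable_levy \<alpha>) = UNIV"
  by (simp add: stable_levy_def)

lemma nn_integral_stable_levy:
  "f \<in> borel_measurable borel \<Longrightarrow> (\<integral>\<^sup>+s. f s \<partial>stable_levy \<alpha>)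
    = (\<integral>\<^sup>+s. ennreal (\<alpha> * s powr (- 1 - \<alpha>)) * indicator {0<..1} s * f s \<partial>lborel)"
  unfolding stable_levy_def by (subst nn_integral_density) auto

text \<open>The source of all Beta functions here: the intensity lowers the exponent of s by 1 +
  \<alpha>. The condition on j makes j - \<alpha> positive, so that the integral converges at
  0.\<close>

lemma nn_integral_stable_levy_Beta:
  assumes "0 < \<alpha>" "\<alpha> < 1" "1 \<le> j"
  shows "(\<integral>\<^sup>+s. ennreal (s ^ j * (1 - s) ^ k) \<partial>stable_levy \<alpha>) = ennreal (\<alpha> * Beta (real j - \<alpha>) (real k + 1))"
proof -
  have "(\<integral>\<^sup>+s. ennreal (s ^ j * (1 - s) ^ k) \<partial>stable_levy \<alpha>)
      = (\<integral>\<^sup>+s. ennreal (\<alpha> * s powr (- 1 - \<alpha>)) * indicator {0<..1} s * ennreal (s ^ j * (1 - s) ^ k) \<partial>lborel)"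
    by (subst nn_integral_stable_levy) auto
  also have "\<dots> = (\<integral>\<^sup>+s. ennreal \<alpha> * (ennreal (s powr ((real j - \<alpha>) - 1) * (1 - s) powr ((real k + 1) - 1)) * indicator {0<..<1} s) \<partial>lborel)"
  proof (rule nn_integral_cong_AE)
    \<comment> \<open>The intensity lives on (0, 1], the Beta integrand on (0, 1); the endpoint 1 is
      a null set.\<close>
    have "AE s in lborel. s \<noteq> (1::real)" by (rule AE_lborel_singleton)
    then show "AE s in lborel. ennreal (\<alpha> * s powr (- 1 - \<alpha>)) * indicator {0<..1} s * ennreal (s ^ j * (1 - s) ^ k)
        = ennreal \<alpha> * (ennreal (s powr ((real j - \<alpha>) - 1) * (1 - s) powr ((real k + 1) - 1)) * indicator {0<..<1} s)"
    proof (rule AE_mp[OF _ AE_I2[OF impI]])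
      fix s :: real assume "s \<noteq> 1"
      show "ennreal (\<alpha> * s powr (- 1 - \<alpha>)) * indicator {0<..1} s * ennreal (s ^ j * (1 - s) ^ k)
        = ennreal \<alpha> * (ennreal (s powr ((real j - \<alpha>) - 1) * (1 - s) powr ((real k + 1) - 1)) * indicator {0<..<1} s)"
      proof (cases "0 < s \<and> s < 1")
        case True
        then have "s ^ j = s powr real j" "(1 - s) ^ k = (1 - s) powr real k"
          by (auto simp: powr_realpow)
        moreover have "s powr (- 1 - \<alpha>) * s powr real j = s powr ((real j - \<alpha>) - 1)"
          by (simp add: powr_add[symmetric] algebra_simps)
        ultimately show ?thesis
          using True assms by (simp add: ennreal_mult[symmetric] mult.assoc[symmetric])
      qed (use \<open>s \<noteq> 1\<close> in \<open>auto simp: indicator_def\<close>)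
    qed
  qed
  also have "\<dots> = ennreal \<alpha> * ennreal (Beta (real j - \<alpha>) (real k + 1))"
    using assms by (subst nn_integral_cmult) (auto simp only: nn_integral_Beta intro!: borel_measurable_times_ennreal, auto simp: nn_integral_Beta)
  also have "\<dots> = ennreal (\<alpha> * Beta (real j - \<alpha>) (real k + 1))"
    using assms by (subst ennreal_mult'[symmetric]) auto
  finally show ?thesis .
qed

text \<open>The intensity has the antiderivative - s^(-\<alpha>); the \<open>- 1\<close> comes from
  the cut-off at 1.\<close>

lemma emeasure_stable_levy_tail:
  assumes "0 < \<alpha>" "0 < e" "e \<le> 1"
  shows "emeasure (stable_levy \<alpha>) {e..} = ennreal (e powr (- \<alpha>) - 1)"
proof -
  have "emeasure (stable_levy \<alpha>) {e..}
      = (\<integral>\<^sup>+s. ennreal (\<alpha> * s powr (- 1 - \<alpha>)) * indicator {0<..1} s * indicator {e..} s \<partial>lborel)"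
    unfolding stable_levy_def by (subst emeasure_density) auto
  also have "\<dots> = (\<integral>\<^sup>+s. ennreal (\<alpha> * s powr (- 1 - \<alpha>)) * indicator {e..1} s \<partial>lborel)"
    using assms by (intro nn_integral_cong) (auto simp: indicator_def)
  also have "\<dots> = ennreal (- (1 powr (- \<alpha>)) - (- (e powr (- \<alpha>))))"
  proof (rule nn_integral_FTC_Icc)
    fix s assume "s \<in> {e..1}"
    then have "0 < s" using assms by auto
    then show "((\<lambda>s. - (s powr (- \<alpha>))) has_real_derivative \<alpha> * s powr (- 1 - \<alpha>)) (at s)"
      by (auto intro!: derivative_eq_intros simp: minus_diff_commute)
  qed (use assms in auto)
  finally show ?thesis by simp
qed

text \<open>Self-similarity of the power density: a times (a s)^(-1-\<alpha>) is a^(-\<alpha>) times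
  s^(-1-\<alpha>). Hence a survives only as a constant factor.\<close>

lemma scaled_stable_levy:
  assumes "0 < \<alpha>" "0 < a"
  shows "density lborel (\<lambda>s. ennreal (scaled_density (\<lambda>s. \<alpha> * s powr (- 1 - \<alpha>)) a s) * indicator {0<..} s)
    = density lborel (\<lambda>s. ennreal (a powr (- \<alpha>)) * (ennreal (\<alpha> * s powr (- 1 - \<alpha>)) * indicator {0<..1} s))"
proof (rule density_cong)
  show "AE s in lborel. ennreal (scaled_density (\<lambda>s. \<alpha> * s powr (- 1 - \<alpha>)) a s) * indicator {0<..} s
      = ennreal (a powr (- \<alpha>)) * (ennreal (\<alpha> * s powr (- 1 - \<alpha>)) * indicator {0<..1} s)"
  proof (rule AE_I2)
    fix s :: real
    show "ennreal (scaled_density (\<lambda>s. \<alpha> * s powr (- 1 - \<alpha>)) a s) * indicator {0<..} s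
      = ennreal (a powr (- \<alpha>)) * (ennreal (\<alpha> * s powr (- 1 - \<alpha>)) * indicator {0<..1} s)"
    proof (cases "0 < s \<and> s \<le> 1")
      case True
      have "a * (a * s) powr (- 1 - \<alpha>) = a powr (- \<alpha>) * s powr (- 1 - \<alpha>)"
      proof -
        have "a * a powr (- 1 - \<alpha>) = a powr (- \<alpha>)" using assms by (simp add: powr_mult_base)
        then show ?thesis using True assms by (simp add: powr_mult mult.assoc[symmetric])
      qed
      then show ?thesis
        using True assms by (simp add: scaled_density_def ennreal_mult[symmetric] mult.left_commute mult_ac)
    qed (auto simp: scaled_density_def indicator_def)
  qed
qed (auto simp: scaled_density_def[abs_def])

lemma nn_integral_scaled_stable_levy:
  assumes "0 < \<alpha>" "0 < a" and f: "f \<in> borel_measurable borel"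
  shows "(\<integral>\<^sup>+s. f s \<partial>density lborel (\<lambda>s. ennreal (scaled_density (\<lambda>s. \<alpha> * s powr (- 1 - \<alpha>)) a s) * indicator {0<..} s))
    = ennreal (a powr (- \<alpha>)) * (\<integral>\<^sup>+s. f s \<partial>stable_levy \<alpha>)"
proof -
  note [measurable] = f
  show ?thesis
    unfolding scaled_stable_levy[OF assms(1,2)]
    by (subst nn_integral_density, measurable)
       (simp add: nn_integral_stable_levy nn_integral_cmult[symmetric] mult.assoc)
qed

lemma sigma_finite_scaled_stable_levy:
  assumes "0 < \<alpha>" "0 < a"
  shows "sigma_finite_measure (density lborel (\<lambda>s. ennreal (scaled_density (\<lambda>s. \<alpha> * s powr (- 1 - \<alpha>)) a s) * indicator {0<..} s))"
  unfolding scaled_stable_levy[OF assms]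
  by (subst sigma_finite_measure.sigma_finite_iff_density_finite[OF lborel.sigma_finite_measure_axioms])
     (auto simp: ennreal_mult_eq_top_iff indicator_def intro!: AE_I2)

section \<open>Discrete measures with i.i.d. atom locations\<close>

context separated_prob_space
begin

lemma sets_discrete_measure [simp]: "sets (discrete_measure G w u) = sets G"
  by (simp add: discrete_measure_def)

lemma emeasure_discrete_measure:
  assumes u: "\<And>k. u k \<in> space G" and A: "A \<in> sets G"
  shows "emeasure (discrete_measure G w u) A = (\<Sum>k. ennreal (w k) * indicator A (u k))"
proof -
  have "emeasure (discrete_measure G w u) A = emeasure (point_measure UNIV (\<lambda>k. ennreal (w k))) (u -` A)"
    unfolding discrete_measure_def using u A by (subst emeasure_distr) (auto simp: space_point_measure)
  also have "\<dots> = (\<integral>\<^sup>+k. ennreal (w k) * indicator (u -` A) k \<partial>count_space UNIV)"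
    unfolding point_measure_def by (subst emeasure_density) auto
  also have "\<dots> = (\<Sum>k. ennreal (w k) * indicator A (u k))"
    by (simp add: nn_integral_count_space_nat indicator_def)
  finally show ?thesis .
qed

lemma measurable_discrete_measure [measurable]:
  "(\<lambda>(w, u). discrete_measure G w u) \<in> PiM UNIV (\<lambda>_. borel) \<Otimes>\<^sub>M PiM UNIV (\<lambda>_. G) \<rightarrow>\<^sub>M measure_algebra G"
proof (rule measurable_measure_algebra)
  fix A assume [measurable]: "A \<in> sets G"
  have "(\<lambda>y. \<Sum>k. ennreal (fst y k) * indicator A (snd y k))
    \<in> borel_measurable (PiM UNIV (\<lambda>_. borel) \<Otimes>\<^sub>M PiM UNIV (\<lambda>_. G))"
    by measurable
  then show "(\<lambda>y. emeasure (case y of (w, u) \<Rightarrow> discrete_measure G w u) A)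
    \<in> borel_measurable (PiM UNIV (\<lambda>_. borel) \<Otimes>\<^sub>M PiM UNIV (\<lambda>_. G))"
    by (rule measurable_cong[THEN iffD1, rotated])
       (auto simp: space_pair_measure space_PiM PiE_iff intro!: emeasure_discrete_measure[symmetric])
qed auto

abbreviation weight_pts :: "'u measure set" where "weight_pts \<equiv> atomic_masses {0<..1}"

text \<open>Distinct locations keep the weights from merging, so each atom carries exactly one
  \<open>w k\<close> and its mass stays at most 1.\<close>

lemma discrete_measure_atomic_masses:
  assumes w: "\<And>k. 0 < w k" "\<And>k. w k \<le> 1" "(\<Sum>k. ennreal (w k)) < \<infinity>"
    and u: "\<And>k. u k \<in> space G" "inj u"
  shows "discrete_measure G w u \<in> weight_pts" "atoms (discrete_measure G w u) = range u"
    "emeasure (discrete_measure G w u) {u k} = ennreal (w k)"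
proof -
  let ?m = "discrete_measure G w u"
  note em = emeasure_discrete_measure[where w=w, OF u(1)]
  have sp: "space ?m = space G" by (rule sets_eq_imp_space_eq) simp
  have ek: "emeasure ?m {u k} = ennreal (w k)" for k
  proof -
    have "emeasure ?m {u k} = (\<Sum>j. ennreal (w j) * indicator {u k} (u j))"
      by (rule em) (simp add: singleton_sets u)
    also have "\<dots> = (\<Sum>j\<in>{k}. ennreal (w j) * indicator {u k} (u j))"
      using u(2) by (intro suminf_finite) (auto simp: indicator_def dest: injD)
    finally show ?thesis by simp
  qed
  then show "emeasure ?m {u k} = ennreal (w k)" .
  have e0: "emeasure ?m {x} = 0" if "x \<in> space G" "x \<notin> range u" for x
  proof -
    have "u k \<noteq> x" for k using that(2) by auto
    then show ?thesis using em[OF singleton_sets[OF that(1)]] by simp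
  qed
  show "atoms ?m = range u"
    unfolding atoms_def sp using ek e0 w(1) u(1) by (auto simp: ennreal_eq_0_iff not_le[symmetric])
  have r: "range u \<in> sets G"
  proof (rule sets.countable)
    show "{x} \<in> sets G" if "x \<in> range u" for x
      using that u(1) by (intro singleton_sets) auto
  qed simp
  have "AE x in ?m. emeasure ?m {x} \<in> {0<..1}"
  proof (rule AE_I'[of "space G - range u"])
    have "emeasure ?m (space G - range u) = 0"
      by (subst em) (use r in auto)
    then show "space G - range u \<in> null_sets ?m" using r by (auto simp: null_sets_def)
    show "{x \<in> space ?m. emeasure ?m {x} \<notin> {0<..1}} \<subseteq> space G - range u"
      using ek w(1,2) by (auto simp: sp ennreal_le_1 ennreal_eq_0_iff not_le[symmetric])
  qed
  moreover have "emeasure ?m (space G) < \<infinity>"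
    using w(3) by (subst em) (auto simp: u(1))
  ultimately show "?m \<in> weight_pts" by (simp add: atomic_masses_def)
qed

lemma atom_sum_discrete_measure:
  assumes w: "\<And>k. 0 < w k" "\<And>k. w k \<le> 1" "(\<Sum>k. ennreal (w k)) < \<infinity>"
    and u: "\<And>k. u k \<in> space G" "inj u"
    and f: "(\<lambda>(w, x). f w x) \<in> borel_measurable (borel \<Otimes>\<^sub>M G)"
  shows "atom_sum f (discrete_measure G w u) = (\<Sum>k. f (ennreal (w k)) (u k))"
proof -
  note d = discrete_measure_atomic_masses[OF w u]
  have "atom_sum f (discrete_measure G w u) = (\<integral>\<^sup>+x. f (emeasure (discrete_measure G w u) {x}) x \<partial>count_space (range u))"
    using atom_sum_eq[OF f d(1)] d(2) by simp
  also have "\<dots> = (\<integral>\<^sup>+k. f (emeasure (discrete_measure G w u) {u k}) (u k) \<partial>count_space UNIV)"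
    by (rule nn_integral_bij_count_space[symmetric]) (use u in \<open>auto simp: bij_betw_def\<close>)
  finally show ?thesis by (simp add: d(3) nn_integral_count_space_nat)
qed

text \<open>Two points differ iff one of the countably many separating sets tells them apart; the
  diagonal is measurable for this reason.\<close>

lemma sets_Collect_neq:
  assumes [measurable]: "f \<in> N \<rightarrow>\<^sub>M G" "g \<in> N \<rightarrow>\<^sub>M G"
  shows "{y\<in>space N. f y \<noteq> g y} \<in> sets N"
proof -
  have "{y\<in>space N. f y \<noteq> g y} = {y\<in>space N. \<exists>i. (f y \<in> c i) \<noteq> (g y \<in> c i)}"
    using c_sep measurable_space[OF assms(1)] measurable_space[OF assms(2)] by auto
  also have "\<dots> \<in> sets N" by measurable
  finally show ?thesis .
qed

lemma AE_neq: "x \<in> space G \<Longrightarrow> AE y in G. y \<noteq> x"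
  using AE_not_in[of "{x}" G] nonatomic singleton_sets by (auto simp: null_sets_def)

lemma prob_space_iid: "prob_space (PiM UNIV (\<lambda>_::nat. G))"
  by (rule prob_space_PiM) (rule prob_space_axioms)

text \<open>For each of the countably many pairs of indices, one location is independent of the
  other and has a non-atomic law, so they almost surely differ.\<close>

lemma AE_PiM_inj: "AE u in PiM UNIV (\<lambda>_::nat. G). inj u"
proof -
  interpret P: prob_space "PiM UNIV (\<lambda>_::nat. G)" by (rule prob_space_iid)
  have "AE u in PiM UNIV (\<lambda>_::nat. G). u j \<noteq> u k" if jk: "j \<noteq> k" for j k
  proof -
    let ?I = "UNIV - {j}"
    interpret I: prob_space "PiM ?I (\<lambda>_. G)" by (rule prob_space_PiM) (rule prob_space_axioms)
    interpret pair_sigma_finite G "PiM ?I (\<lambda>_. G)" ..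
    have k: "k \<in> ?I" using jk by simp
    have ins: "insert j ?I = UNIV" by auto
    \<comment> \<open>Splits off coordinate j as an independent factor, so that Fubini can freeze
      all other coordinates.\<close>
    have eq: "distr (G \<Otimes>\<^sub>M PiM ?I (\<lambda>_. G)) (PiM UNIV (\<lambda>_. G)) (\<lambda>(x, X). X(j := x)) = PiM UNIV (\<lambda>_. G)"
      using distr_pair_PiM_eq_PiM[of ?I "\<lambda>_. G" j] prob_space_axioms unfolding ins by auto
    have "(\<lambda>(x, X). X(j := x)) \<in> G \<Otimes>\<^sub>M PiM ?I (\<lambda>_. G) \<rightarrow>\<^sub>M PiM (insert j ?I) (\<lambda>_. G)"
      by measurable
    then have m: "(\<lambda>(x, X). X(j := x)) \<in> G \<Otimes>\<^sub>M PiM ?I (\<lambda>_. G) \<rightarrow>\<^sub>M PiM UNIV (\<lambda>_. G)"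
      unfolding ins .
    have s: "{y \<in> space (G \<Otimes>\<^sub>M PiM ?I (\<lambda>_. G)). fst y \<noteq> snd y k} \<in> sets (G \<Otimes>\<^sub>M PiM ?I (\<lambda>_. G))"
      by (rule sets_Collect_neq) (use k in measurable)
    have "AE X in PiM ?I (\<lambda>_. G). AE x in G. x \<noteq> X k"
      by (rule AE_I2) (rule AE_neq, use k in \<open>auto simp: space_PiM\<close>)
    then have "AE x in G. AE X in PiM ?I (\<lambda>_. G). x \<noteq> X k"
      using AE_commute[of "\<lambda>x X. x \<noteq> X k"] s by simp
    then have "AE y in G \<Otimes>\<^sub>M PiM ?I (\<lambda>_. G). fst y \<noteq> snd y k"
      by (subst AE_pair_iff[OF s, symmetric])
    then have "AE y in G \<Otimes>\<^sub>M PiM ?I (\<lambda>_. G). (case y of (x, X) \<Rightarrow> X(j := x)) j \<noteq> (case y of (x, X) \<Rightarrow> X(j := x)) k"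
      using jk by (auto elim!: eventually_mono)
    moreover have "{u \<in> space (PiM UNIV (\<lambda>_. G)). u j \<noteq> u k} \<in> sets (PiM UNIV (\<lambda>_::nat. G))"
      by (rule sets_Collect_neq) measurable
    ultimately have "AE u in distr (G \<Otimes>\<^sub>M PiM ?I (\<lambda>_. G)) (PiM UNIV (\<lambda>_. G)) (\<lambda>(x, X). X(j := x)). u j \<noteq> u k"
      by (subst AE_distr_iff[OF m]) auto
    then show ?thesis unfolding eq .
  qed
  then have "AE u in PiM UNIV (\<lambda>_::nat. G). \<forall>j k. j \<noteq> k \<longrightarrow> u j \<noteq> u k"
    by (auto simp: AE_all_countable)
  then show ?thesis by eventually_elim (auto simp: inj_on_def)
qed

lemma nn_integral_PiM_nexp:
  assumes "\<And>k. g k \<in> borel_measurable G"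
  shows "(\<integral>\<^sup>+u. nexp (\<Sum>k. g k (u k)) \<partial>PiM UNIV (\<lambda>_::nat. G)) = nexp (\<Sum>k. nlog (\<integral>\<^sup>+x. nexp (g k x) \<partial>G))"
proof -
  interpret P: prob_space "PiM UNIV (\<lambda>_::nat. G)" by (rule prob_space_iid)
  have "P.indep_vars (\<lambda>_. borel) (\<lambda>k u. g k (u k)) UNIV"
    by (rule P.indep_vars_compose2[OF indep_vars_PiM_components]) (auto intro: assms prob_space_axioms)
  from P.indep_vars_nn_integral_nexp[OF _ this]
  have "(\<integral>\<^sup>+u. nexp (\<Sum>k. g k (u k)) \<partial>PiM UNIV (\<lambda>_::nat. G))
      = nexp (\<Sum>k. nlog (\<integral>\<^sup>+u. nexp (g k (u k)) \<partial>PiM UNIV (\<lambda>_. G)))"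
    by (simp add: nn_integral_count_space_nat)
  moreover have "(\<integral>\<^sup>+u. nexp (g k (u k)) \<partial>PiM UNIV (\<lambda>_::nat. G)) = (\<integral>\<^sup>+x. nexp (g k x) \<partial>G)" for k
  proof -
    have [measurable]: "g k \<in> borel_measurable G" by (rule assms)
    have "(\<integral>\<^sup>+x. nexp (g k x) \<partial>G) = (\<integral>\<^sup>+x. nexp (g k x) \<partial>distr (PiM UNIV (\<lambda>_::nat. G)) G (\<lambda>u. u k))"
      using distr_PiM_component[of UNIV "\<lambda>_::nat. G" k] prob_space_axioms by simp
    also have "\<dots> = (\<integral>\<^sup>+u. nexp (g k (u k)) \<partial>PiM UNIV (\<lambda>_::nat. G))"
      by (rule nn_integral_distr) measurable
    finally show ?thesis ..
  qed
  ultimately show ?thesis by simp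
qed

end


section \<open>The completely random measure with a stable Levy density\<close>

lemma one_minus_nexp_le: "1 - nexp y \<le> y"
proof (cases y)
  case (real r)
  have "1 - exp (- r) \<le> r" using exp_ge_add_one_self[of "- r"] by simp
  then show ?thesis
    using real by (simp add: nexp_ennreal ennreal_minus flip: ennreal_1)
qed simp

section \<open>Jumps and Laplace functional of the random measure\<close>

locale stable_crm = separated_prob_space G c for G :: "'u measure" and c +
  fixes \<alpha> :: real
  assumes \<alpha>: "0 < \<alpha>" "\<alpha> < 1"
begin

abbreviation "levy a \<equiv> scaled_density (\<lambda>s. \<alpha> * s powr (- 1 - \<alpha>)) a"

abbreviation "iidG \<equiv> PiM UNIV (\<lambda>_::nat. G)"

lemma ranked_jumps_laplace:
  assumes J: "ranked_jumps_law (levy a) J" and a: "0 < a" and f: "f \<in> borel_measurable borel"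
  shows "(\<integral>\<^sup>+\<delta>. nexp (\<Sum>k. f (\<delta> k)) \<partial>J)
    = nexp (ennreal (a powr (- \<alpha>)) * (\<integral>\<^sup>+s. 1 - nexp (f s) \<partial>stable_levy \<alpha>))"
proof -
  have "(\<integral>\<^sup>+\<delta>. nexp (\<Sum>k. f (\<delta> k)) \<partial>J)
      = nexp (\<integral>\<^sup>+s. 1 - nexp (f s) \<partial>density lborel (\<lambda>s. ennreal (levy a s) * indicator {0<..} s))"
    by (rule poisson_points_laplace)
       (use J f a sigma_finite_scaled_stable_levy[OF \<alpha>(1)] in \<open>auto simp: ranked_jumps_law_def\<close>)
  also have "\<dots> = nexp (ennreal (a powr (- \<alpha>)) * (\<integral>\<^sup>+s. 1 - nexp (f s) \<partial>stable_levy \<alpha>))"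
    using f by (subst nn_integral_scaled_stable_levy[OF \<alpha>(1) a]) auto
  finally show ?thesis .
qed

text \<open>Both properties are read off the Laplace functional: the bound from an infinite penalty
  on large jumps, summability from small multiples of the total mass.\<close>

lemma ranked_jumps_AE:
  assumes J: "ranked_jumps_law (levy a) J" and a: "0 < a"
  shows "AE \<delta> in J. (\<forall>k. 0 < \<delta> k \<and> \<delta> k \<le> 1) \<and> (\<Sum>k. ennreal (\<delta> k)) < \<infinity>"
proof -
  have pJ: "prob_space J" and sJ [measurable_cong]: "sets J = sets (PiM UNIV (\<lambda>_. borel))"
    and pos: "AE \<delta> in J. \<forall>k. 0 < \<delta> k \<and> \<delta> (Suc k) < \<delta> k"
    using J by (auto simp: ranked_jumps_law_def)
  interpret J: prob_space J by fact
  \<comment> \<open>Infinite penalty above 1, where the intensity vanishes. The expectation of its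
    exponential is 1, so almost surely no jump pays it.\<close>
  let ?f = "\<lambda>s. if 1 < s then \<top> else 0 :: ennreal"
  have "AE s in stable_levy \<alpha>. s \<le> 1"
    unfolding stable_levy_def by (subst AE_density) (auto simp: indicator_def)
  then have "(\<integral>\<^sup>+s. 1 - nexp (?f s) \<partial>stable_levy \<alpha>) = (\<integral>\<^sup>+s. 0 \<partial>stable_levy \<alpha>)"
    by (intro nn_integral_cong_AE) (auto elim!: eventually_mono)
  then have I1: "(\<integral>\<^sup>+\<delta>. nexp (\<Sum>k. ?f (\<delta> k)) \<partial>J) = 1"
    by (subst ranked_jumps_laplace[OF J a]) auto
  have m1 [measurable]: "(\<lambda>\<delta>. nexp (\<Sum>k. ?f (\<delta> k))) \<in> borel_measurable J"
    by measurable
  have "(\<integral>\<^sup>+\<delta>. 1 - nexp (\<Sum>k. ?f (\<delta> k)) \<partial>J) = (\<integral>\<^sup>+\<delta>. 1 \<partial>J) - (\<integral>\<^sup>+\<delta>. nexp (\<Sum>k. ?f (\<delta> k)) \<partial>J)"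
    by (rule nn_integral_diff) (auto simp: I1)
  then have "(\<integral>\<^sup>+\<delta>. 1 - nexp (\<Sum>k. ?f (\<delta> k)) \<partial>J) = 0"
    by (simp add: I1 J.emeasure_space_1)
  then have "AE \<delta> in J. 1 - nexp (\<Sum>k. ?f (\<delta> k)) = 0"
    by (subst (asm) nn_integral_0_iff_AE) auto
  then have le1: "AE \<delta> in J. \<forall>k. \<delta> k \<le> 1"
  proof eventually_elim
    case (elim \<delta>)
    then have "nexp 0 \<le> nexp (\<Sum>k. ?f (\<delta> k))" by (simp add: diff_eq_0_iff_ennreal)
    then have "(\<Sum>k. ?f (\<delta> k)) = 0" unfolding nexp_le_iff by simp
    then have z: "?f (\<delta> k) = 0" for k
      by (subst (asm) suminf_eq_zero_iff) auto
    have "\<not> 1 < \<delta> k" for k using z[of k] by (auto split: if_splits)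
    then show ?case by (simp add: not_less)
  qed
  \<comment> \<open>The mean total mass. It bounds the exponents from above because 1 - exp (- t s)
    \<le> t s.\<close>
  define K where "K = ennreal (a powr (- \<alpha>)) * (\<integral>\<^sup>+s. ennreal s \<partial>stable_levy \<alpha>)"
  have K: "K < \<infinity>"
    using nn_integral_stable_levy_Beta[OF \<alpha>, of 1 0] by (simp add: K_def ennreal_mult_less_top)
  have "AE \<delta> in J. (\<Sum>k. ennreal (\<delta> k)) < \<infinity>"
  proof (rule AE_neq_top_of_nexp[OF pJ _ K])
    fix t :: real assume t: "t \<in> {0<..1}"
    have "nexp (ennreal t * K) \<le> nexp (ennreal (a powr (- \<alpha>)) * (\<integral>\<^sup>+s. 1 - nexp (ennreal t * ennreal s) \<partial>stable_levy \<alpha>))"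
    proof -
      have "(\<integral>\<^sup>+s. 1 - nexp (ennreal t * ennreal s) \<partial>stable_levy \<alpha>) \<le> (\<integral>\<^sup>+s. ennreal t * ennreal s \<partial>stable_levy \<alpha>)"
        by (intro nn_integral_mono one_minus_nexp_le)
      also have "\<dots> = ennreal t * (\<integral>\<^sup>+s. ennreal s \<partial>stable_levy \<alpha>)"
        by (rule nn_integral_cmult) measurable
      finally show ?thesis
        unfolding nexp_le_iff K_def by (subst mult.left_commute) (intro mult_left_mono, auto)
    qed
    also have "\<dots> = (\<integral>\<^sup>+\<delta>. nexp (\<Sum>k. ennreal t * ennreal (\<delta> k)) \<partial>J)"
      by (subst ranked_jumps_laplace[OF J a]) auto
    also have "\<dots> = (\<integral>\<^sup>+\<delta>. nexp (ennreal t * (\<Sum>k. ennreal (\<delta> k))) \<partial>J)"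
      by (simp add: ennreal_suminf_cmult)
    finally show "nexp (ennreal t * K) \<le> (\<integral>\<^sup>+\<delta>. nexp (ennreal t * (\<Sum>k. ennreal (\<delta> k))) \<partial>J)" .
  qed measurable
  with pos le1 show ?thesis by eventually_elim auto
qed

lemma crm_law_space:
  assumes L: "crm_law (levy a) G L"
  shows "prob_space L" "sets L = sets (measure_algebra G)" "L \<in> space (prob_algebra (measure_algebra G))"
proof -
  obtain J where J: "ranked_jumps_law (levy a) J"
    and L: "L = distr (J \<Otimes>\<^sub>M iidG) (measure_algebra G) (\<lambda>(w, u). discrete_measure G w u)"
    using L by (auto simp: crm_law_def)
  have sJ [measurable_cong]: "sets J = sets (PiM UNIV (\<lambda>_. borel))" and pJ: "prob_space J"
    using J by (auto simp: ranked_jumps_law_def)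
  show s: "sets L = sets (measure_algebra G)" by (simp add: L)
  show p: "prob_space L"
    unfolding L by (intro prob_space.prob_space_distr prob_space_pair pJ prob_space_iid) measurable
  show "L \<in> space (prob_algebra (measure_algebra G))" using s p by (simp add: space_prob_algebra)
qed

lemma crm_law_AE:
  assumes J: "ranked_jumps_law (levy a) J" and a: "0 < a"
  shows "AE y in J \<Otimes>\<^sub>M iidG. (\<forall>k. 0 < fst y k \<and> fst y k \<le> 1) \<and> (\<Sum>k. ennreal (fst y k)) < \<infinity>
    \<and> (\<forall>k. snd y k \<in> space G) \<and> inj (snd y)"
proof -
  have pJ: "prob_space J" and sJ [measurable_cong]: "sets J = sets (PiM UNIV (\<lambda>_. borel))"
    using J by (auto simp: ranked_jumps_law_def)
  interpret J: prob_space J by fact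
  interpret iid: prob_space iidG by (rule prob_space_iid)
  interpret pair_prob_space J iidG ..
  have d1: "distr (J \<Otimes>\<^sub>M iidG) J fst = J"
    by (rule iid.distr_pair_fst)
  have d2: "distr (J \<Otimes>\<^sub>M iidG) iidG snd = iidG"
  proof (rule measure_eqI)
    fix A assume "A \<in> sets (distr (J \<Otimes>\<^sub>M iidG) iidG snd)"
    then have A: "A \<in> sets iidG" by simp
    then have "emeasure (distr (J \<Otimes>\<^sub>M iidG) iidG snd) A = emeasure (J \<Otimes>\<^sub>M iidG) (space J \<times> A)"
      by (subst emeasure_distr) (auto intro!: arg_cong2[where f=emeasure] simp: space_pair_measure dest: sets.sets_into_space)
    also have "\<dots> = emeasure iidG A"
      using A by (simp add: iid.emeasure_pair_measure_Times J.emeasure_space_1)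
    finally show "emeasure (distr (J \<Otimes>\<^sub>M iidG) iidG snd) A = emeasure iidG A" .
  qed simp
  have "AE y in J \<Otimes>\<^sub>M iidG. (\<forall>k. 0 < fst y k \<and> fst y k \<le> 1) \<and> (\<Sum>k. ennreal (fst y k)) < \<infinity>"
    using ranked_jumps_AE[OF J a] by (subst (asm) d1[symmetric]) (rule AE_distrD[OF measurable_fst])
  moreover have "AE y in J \<Otimes>\<^sub>M iidG. inj (snd y)"
    using AE_PiM_inj by (subst (asm) d2[symmetric]) (rule AE_distrD[OF measurable_snd])
  moreover have "AE y in J \<Otimes>\<^sub>M iidG. \<forall>k. snd y k \<in> space G"
    by (rule AE_I2) (auto simp: space_pair_measure space_PiM)
  ultimately show ?thesis by eventually_elim auto
qed

lemma crm_law_weight_pts: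
  assumes L: "crm_law (levy a) G L" and a: "0 < a"
  shows "AE m in L. m \<in> weight_pts"
proof -
  obtain J where J: "ranked_jumps_law (levy a) J"
    and L: "L = distr (J \<Otimes>\<^sub>M iidG) (measure_algebra G) (\<lambda>(w, u). discrete_measure G w u)"
    using L by (auto simp: crm_law_def)
  have sJ [measurable_cong]: "sets J = sets (PiM UNIV (\<lambda>_. borel))"
    using J by (auto simp: ranked_jumps_law_def)
  have m: "(\<lambda>(w, u). discrete_measure G w u) \<in> J \<Otimes>\<^sub>M iidG \<rightarrow>\<^sub>M measure_algebra G" by measurable
  have s: "{m \<in> space (measure_algebra G). m \<in> weight_pts} \<in> sets (measure_algebra G)"
    using atomic_masses_sets[of "{0<..1}"] by simp
  show ?thesis
    unfolding L
  proof (subst AE_distr_iff[OF m s])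
    show "AE y in J \<Otimes>\<^sub>M iidG. (case y of (w, u) \<Rightarrow> discrete_measure G w u) \<in> weight_pts"
      using crm_law_AE[OF J a] by eventually_elim (auto simp: split_def intro!: discrete_measure_atomic_masses(1))
  qed
qed

text \<open>The marking argument: given the jumps, the locations are independent, so integrating
  them out first leaves a functional of the jumps alone, to which the Poisson formula
  applies.\<close>

lemma crm_law_laplace:
  assumes L: "crm_law (levy a) G L" and a: "0 < a"
    and f: "(\<lambda>(w, x). f w x) \<in> borel_measurable (borel \<Otimes>\<^sub>M G)"
  shows "(\<integral>\<^sup>+m. nexp (atom_sum f m) \<partial>L)
    = nexp (ennreal (a powr (- \<alpha>)) * (\<integral>\<^sup>+s. 1 - (\<integral>\<^sup>+x. nexp (f (ennreal s) x) \<partial>G) \<partial>stable_levy \<alpha>))"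
proof -
  obtain J where J: "ranked_jumps_law (levy a) J"
    and L: "L = distr (J \<Otimes>\<^sub>M iidG) (measure_algebra G) (\<lambda>(w, u). discrete_measure G w u)"
    using L by (auto simp: crm_law_def)
  have sJ [measurable_cong]: "sets J = sets (PiM UNIV (\<lambda>_. borel))"
    using J by (auto simp: ranked_jumps_law_def)
  interpret iid: prob_space iidG by (rule prob_space_iid)
  note [measurable] = f
  have fc [measurable]: "(\<lambda>y. f (h y) (g y)) \<in> borel_measurable N"
    if "h \<in> borel_measurable N" "g \<in> N \<rightarrow>\<^sub>M G" for h g and N :: "'d measure"
    using measurable_compose[OF measurable_Pair[OF that] f] by simp
  have m: "(\<lambda>(w, u). discrete_measure G w u) \<in> J \<Otimes>\<^sub>M iidG \<rightarrow>\<^sub>M measure_algebra G" by measurable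
  have am [measurable]: "(\<lambda>m. nexp (atom_sum f m)) \<in> borel_measurable (measure_algebra G)"
    using measurable_atom_sum[OF f] by measurable
  \<comment> \<open>The effective penalty of a jump of size s, with its location averaged
    out.\<close>
  define g where "g s = nlog (\<integral>\<^sup>+x. nexp (f (ennreal s) x) \<partial>G)" for s :: real
  have gm [measurable]: "g \<in> borel_measurable borel"
    unfolding g_def[abs_def] by measurable
  have le1: "(\<integral>\<^sup>+x. nexp (f (ennreal s) x) \<partial>G) \<le> 1" for s
    using nn_integral_mono[of G "\<lambda>x. nexp (f (ennreal s) x)" "\<lambda>_. 1"] by (simp add: emeasure_space_1)
  have "(\<integral>\<^sup>+m. nexp (atom_sum f m) \<partial>L) = (\<integral>\<^sup>+y. nexp (atom_sum f (case y of (w, u) \<Rightarrow> discrete_measure G w u)) \<partial>(J \<Otimes>\<^sub>M iidG))"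
    unfolding L by (rule nn_integral_distr[OF m]) (use am in simp)
  also have "\<dots> = (\<integral>\<^sup>+y. nexp (\<Sum>k. f (ennreal (fst y k)) (snd y k)) \<partial>(J \<Otimes>\<^sub>M iidG))"
    using crm_law_AE[OF J a]
    by (intro nn_integral_cong_AE, eventually_elim) (auto simp: split_def intro!: arg_cong[where f=nexp] atom_sum_discrete_measure f)
  also have "\<dots> = (\<integral>\<^sup>+w. \<integral>\<^sup>+u. nexp (\<Sum>k. f (ennreal (w k)) (u k)) \<partial>iidG \<partial>J)"
    by (subst iid.nn_integral_fst[symmetric]) measurable
  also have "\<dots> = (\<integral>\<^sup>+w. nexp (\<Sum>k. g (w k)) \<partial>J)"
    by (subst nn_integral_PiM_nexp) (auto simp: g_def)
  also have "\<dots> = nexp (ennreal (a powr (- \<alpha>)) * (\<integral>\<^sup>+s. 1 - nexp (g s) \<partial>stable_levy \<alpha>))"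
    by (rule ranked_jumps_laplace[OF J a gm])
  finally show ?thesis by (simp add: g_def nexp_nlog le1)
qed

section \<open>Recovering the scale from the random measure\<close>

text \<open>The threshold \<open>threshold k\<close> gives the tail \<open>{threshold k..}\<close> Levy mass exactly \<open>2 ^ Suc k\<close>, and \<open>level_penalty k\<close>
  discounts every atom above it by \<open>1 - 1 / 2 ^ Suc k\<close>, so that \<open>nexp (atom_sum (level_penalty k) m)\<close> has
  mean exactly \<open>exp (- a powr - \<alpha>)\<close> and a variance summable in \<open>k\<close>. Hence \<open>a\<close> is a function of
  the random measure.\<close>

definition threshold :: "nat \<Rightarrow> real" where
  "threshold k = (2 ^ Suc k + 1) powr (- 1 / \<alpha>)"

definition level_penalty :: "real \<Rightarrow> nat \<Rightarrow> ennreal \<Rightarrow> 'u \<Rightarrow> ennreal" where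
  "level_penalty t k w x = (if ennreal (threshold k) \<le> w then ennreal (t * - ln (1 - 1 / 2 ^ Suc k)) else 0)"

text \<open>Solves for a the equation that the limit equals exp (- a^(-\<alpha>)).\<close>

definition recover_scale :: "'u measure \<Rightarrow> real" where
  "recover_scale m = (- ln (lim (\<lambda>k. enn2real (nexp (atom_sum (level_penalty 1 k) m))))) powr (- 1 / \<alpha>)"

lemma measurable_level_penalty [measurable]: "(\<lambda>(w, x). level_penalty t k w x) \<in> borel_measurable (borel \<Otimes>\<^sub>M G)"
  unfolding level_penalty_def[abs_def] by measurable

lemma measurable_recover_scale [measurable]: "recover_scale \<in> borel_measurable (measure_algebra G)"
proof -
  have [measurable]: "(\<lambda>m. enn2real (nexp (atom_sum (level_penalty 1 k) m))) \<in> borel_measurable (measure_algebra G)" for k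
    using measurable_atom_sum[OF measurable_level_penalty[of 1 k]] by measurable
  show ?thesis unfolding recover_scale_def[abs_def] by measurable
qed

text \<open>The \<open>+ 1\<close> compensates the \<open>- 1\<close> in the tail mass of the
  cut-off intensity, so that the tail mass is exactly \<open>2 ^ Suc k\<close>.\<close>

lemma threshold: "0 < threshold k" "threshold k \<le> 1" "threshold k powr (- \<alpha>) = 2 ^ Suc k + 1"
proof -
  have pos: "0 < (2::real) ^ Suc k + 1" by (simp add: add_pos_pos)
  then show "0 < threshold k" by (simp add: threshold_def)
  show "threshold k \<le> 1"
    using powr_mono[of "- 1 / \<alpha>" 0 "2 ^ Suc k + 1"] \<alpha> pos by (simp add: threshold_def)
  show "threshold k powr (- \<alpha>) = 2 ^ Suc k + 1"
    using \<alpha> pos by (simp add: threshold_def powr_powr)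
qed

lemma one_minus_half_power: "0 < 1 - 1 / (2::real) ^ Suc k" "1 - 1 / (2::real) ^ Suc k < 1"
  using one_less_power[of "2::real" "Suc k"] by (auto simp: field_simps)

lemma nexp_level_penalty:
  assumes "0 \<le> t"
  shows "nexp (level_penalty t k w x) = (if ennreal (threshold k) \<le> w then ennreal ((1 - 1 / 2 ^ Suc k) powr t) else 1)"
proof -
  note p = one_minus_half_power[of k]
  then have "0 \<le> t * - ln (1 - 1 / 2 ^ Suc k)"
    using assms by (intro mult_nonneg_nonneg) auto
  then show ?thesis
    using p by (auto simp: level_penalty_def nexp_ennreal powr_def)
qed

text \<open>The number of atoms above the threshold is Poisson with mean a^(-\<alpha>) 2^(k+1), and
  this is its generating function. The case t = 1 gives the mean of the level statistic, t = 2 its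
  second moment.\<close>

lemma crm_law_level_penalty:
  assumes L: "crm_law (levy a) G L" and a: "0 < a" and t: "0 \<le> t"
  shows "(\<integral>\<^sup>+m. nexp (atom_sum (level_penalty t k) m) \<partial>L)
    = ennreal (exp (- (a powr (- \<alpha>) * ((1 - (1 - 1 / 2 ^ Suc k) powr t) * 2 ^ Suc k))))"
proof -
  define p where "p = (1 - 1 / (2::real) ^ Suc k) powr t"
  note q = one_minus_half_power[of k]
  have p: "0 \<le> p" "p \<le> 1" unfolding p_def using q t by (auto intro!: powr_le1)
  have "(\<integral>\<^sup>+s. 1 - (\<integral>\<^sup>+x. nexp (level_penalty t k (ennreal s) x) \<partial>G) \<partial>stable_levy \<alpha>)
      = (\<integral>\<^sup>+s. ennreal (1 - p) * indicator {threshold k..} s \<partial>stable_levy \<alpha>)"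
  proof (rule nn_integral_cong)
    fix s :: real
    have "threshold k \<le> s \<longleftrightarrow> ennreal (threshold k) \<le> ennreal s"
      using threshold(1)[of k] by (cases "0 \<le> s") (auto simp: ennreal_neg not_le)
    then have "nexp (level_penalty t k (ennreal s) x) = (if threshold k \<le> s then ennreal p else 1)" for x
      by (simp only: nexp_level_penalty[OF t] p_def)
    moreover have "1 - ennreal p = ennreal (1 - p)"
      using p ennreal_minus[of p 1] by simp
    ultimately show "1 - (\<integral>\<^sup>+x. nexp (level_penalty t k (ennreal s) x) \<partial>G) = ennreal (1 - p) * indicator {threshold k..} s"
      by (simp add: emeasure_space_1)
  qed
  also have "\<dots> = ennreal (1 - p) * ennreal (2 ^ Suc k)"
    by (subst nn_integral_cmult_indicator) (simp_all add: emeasure_stable_levy_tail[OF \<alpha>(1) threshold(1,2)] threshold(3))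
  finally show ?thesis
    unfolding p_def[symmetric] using p
    by (simp add: crm_law_laplace[OF L a measurable_level_penalty] ennreal_mult[symmetric] nexp_ennreal)
qed

text \<open>The level statistics have the common mean exp (- \<theta>) with \<theta> =
  a^(-\<alpha>), and their variances are summable over the levels. So the squared deviations are
  almost surely summable and tend to 0.\<close>

lemma crm_law_recover_scale:
  assumes L: "crm_law (levy a) G L" and a: "0 < a"
  shows "AE m in L. recover_scale m = a"
proof -
  interpret L: prob_space L by (rule crm_law_space[OF L])
  have sL [measurable_cong]: "sets L = sets (measure_algebra G)" by (rule crm_law_space[OF L])
  define \<theta> where "\<theta> = a powr (- \<alpha>)"
  have \<theta>: "0 < \<theta>" using a by (simp add: \<theta>_def)
  define V where "V k m = enn2real (nexp (atom_sum (level_penalty 1 k) m))" for k m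
  have Vm [measurable]: "V k \<in> borel_measurable L" for k
    unfolding V_def[abs_def] using measurable_atom_sum[OF measurable_level_penalty[of 1 k]] by measurable
  have V01: "0 \<le> V k m" "V k m \<le> 1" for k m
    unfolding V_def by (auto simp: enn2real_leI)
  have eV: "ennreal (V k m) = nexp (atom_sum (level_penalty 1 k) m)" for k m
    unfolding V_def by simp
  note q = one_minus_half_power(1)
  have iV: "integrable L (V k)" and iV2: "integrable L (\<lambda>m. (V k m)\<^sup>2)" for k
    using V01 by (auto intro!: L.integrable_const_bound[where B=1] simp: power_le_one)
  have EV: "(\<integral>m. V k m \<partial>L) = exp (- \<theta>)" for k
  proof -
    have "(\<integral>\<^sup>+m. ennreal (V k m) \<partial>L) = ennreal (exp (- \<theta>))"
      unfolding eV using q[of k] by (subst crm_law_level_penalty[OF L a]) (simp_all add: \<theta>_def)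
    then show ?thesis
      using V01 by (subst integral_eq_nn_integral) auto
  qed
  have EV2: "(\<integral>m. (V k m)\<^sup>2 \<partial>L) = exp (- (\<theta> * (2 - 1 / 2 ^ Suc k)))" for k
  proof -
    \<comment> \<open>Squaring the exponential doubles the penalty, and the second moment becomes
      another Laplace functional.\<close>
    have "AE m in L. ennreal ((V k m)\<^sup>2) = nexp (atom_sum (level_penalty 2 k) m)"
      using crm_law_weight_pts[OF L a]
    proof eventually_elim
      case (elim m)
      define y where "y = - ln (1 - 1 / (2::real) ^ Suc k)"
      have "0 \<le> y" using one_minus_half_power[of k] by (simp add: y_def)
      then have "ennreal (2 * y) = ennreal (1 * y) + ennreal (1 * y)"
        using ennreal_plus[of y y] by simp
      then have "level_penalty 2 k w x = level_penalty 1 k w x + level_penalty 1 k w x" for w x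
        unfolding level_penalty_def y_def[symmetric] by simp
      then have "atom_sum (level_penalty 2 k) m = atom_sum (level_penalty 1 k) m + atom_sum (level_penalty 1 k) m"
        by (simp add: atom_sum_eq[OF measurable_level_penalty elim] nn_integral_add)
      then show ?case
        using V01 by (simp add: nexp_add power2_eq_square ennreal_mult eV[symmetric])
    qed
    then have "(\<integral>\<^sup>+m. ennreal ((V k m)\<^sup>2) \<partial>L) = (\<integral>\<^sup>+m. nexp (atom_sum (level_penalty 2 k) m) \<partial>L)"
      by (rule nn_integral_cong_AE)
    also have "\<dots> = ennreal (exp (- (\<theta> * (2 - 1 / 2 ^ Suc k))))"
    proof -
      have "(1 - (1 - 1 / 2 ^ Suc k) powr 2) * 2 ^ Suc k = (2 - 1 / 2 ^ Suc k :: real)"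
        using q[of k] by (simp add: powr_numeral power2_eq_square field_simps)
      then show ?thesis
        by (subst crm_law_level_penalty[OF L a]) (simp_all add: \<theta>_def)
    qed
    finally show ?thesis by (subst integral_eq_nn_integral) auto
  qed
  have var: "(\<integral>\<^sup>+m. ennreal ((V k m - exp (- \<theta>))\<^sup>2) \<partial>L) \<le> ennreal (\<theta> * exp \<theta> * (1/2) ^ Suc k)" for k
  proof -
    have "integrable L (\<lambda>m. (V k m - exp (- \<theta>))\<^sup>2)"
      using iV iV2 by (simp add: power2_diff)
    then have "(\<integral>\<^sup>+m. ennreal ((V k m - exp (- \<theta>))\<^sup>2) \<partial>L) = ennreal (\<integral>m. (V k m - exp (- \<theta>))\<^sup>2 \<partial>L)"
      by (rule nn_integral_eq_integral) simp
    also have "(\<integral>m. (V k m - exp (- \<theta>))\<^sup>2 \<partial>L) = exp (- (\<theta> * (2 - 1 / 2 ^ Suc k))) + (exp (- \<theta>))\<^sup>2 - 2 * exp (- \<theta>) * exp (- \<theta>)"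
      using iV iV2 EV EV2 by (simp add: power2_diff L.prob_space)
    also have "\<dots> = exp (- (2 * \<theta>)) * (exp (\<theta> / 2 ^ Suc k) - 1)"
      by (simp add: algebra_simps power2_eq_square exp_add[symmetric] mult_exp_exp)
    \<comment> \<open>Bounds exp (- 2 \<theta>) by 1, and exp y - 1 by y exp \<theta> with y =
      \<theta> / 2^(k+1) \<le> \<theta>; the latter comes from multiplying 1 - y \<le> exp (- y) by
      exp y.\<close>
    also have "\<dots> \<le> 1 * (\<theta> * exp \<theta> * (1/2) ^ Suc k)"
    proof (intro mult_mono)
      define y where "y = \<theta> / 2 ^ Suc k"
      have "(1::real) \<le> 2 ^ Suc k" by (rule one_le_power) simp
      then have y: "0 \<le> y" "y \<le> \<theta>"
        using \<theta> by (auto simp: y_def field_simps)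
      have "1 - y \<le> exp (- y)" using exp_ge_add_one_self[of "- y"] by simp
      then have "(1 - y) * exp y \<le> exp (- y) * exp y" by (intro mult_right_mono) auto
      then have "exp y - 1 \<le> y * exp y" by (simp add: algebra_simps mult_exp_exp)
      also have "\<dots> \<le> y * exp \<theta>" using y by (intro mult_left_mono) auto
      finally show "exp (\<theta> / 2 ^ Suc k) - 1 \<le> \<theta> * exp \<theta> * (1/2) ^ Suc k"
        by (simp add: y_def power_one_over field_simps)
      show "0 \<le> exp (\<theta> / 2 ^ Suc k) - 1" using y by (simp add: y_def)
    qed (use \<theta> in auto)
    finally show ?thesis by (simp add: ennreal_leI)
  qed
  \<comment> \<open>A series with finite expectation is almost surely finite, hence its terms vanish
    in the limit.\<close>
  have "(\<integral>\<^sup>+m. (\<Sum>k. ennreal ((V k m - exp (- \<theta>))\<^sup>2)) \<partial>L) = (\<Sum>k. \<integral>\<^sup>+m. ennreal ((V k m - exp (- \<theta>))\<^sup>2) \<partial>L)"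
    by (rule nn_integral_suminf) measurable
  also have "\<dots> \<le> (\<Sum>k. ennreal (\<theta> * exp \<theta> * (1/2) ^ Suc k))"
    by (intro suminf_le var) auto
  also have "\<dots> < \<infinity>"
  proof -
    have "summable (\<lambda>k. \<theta> * exp \<theta> * (1/2) ^ Suc k)"
      by (intro summable_mult) (simp add: summable_geometric)
    then show ?thesis
      using \<theta> by (subst suminf_ennreal2) (auto simp: less_top[symmetric])
  qed
  finally have "AE m in L. (\<Sum>k. ennreal ((V k m - exp (- \<theta>))\<^sup>2)) \<noteq> \<infinity>"
    by (intro nn_integral_PInf_AE) (auto simp: less_top)
  then show ?thesis
  proof eventually_elim
    case (elim m)
    then have "summable (\<lambda>k. (V k m - exp (- \<theta>))\<^sup>2)"
      by (intro summable_suminf_not_top) auto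
    then have "(\<lambda>k. (V k m - exp (- \<theta>))\<^sup>2) \<longlonglongrightarrow> 0" by (rule summable_LIMSEQ_zero)
    then have "(\<lambda>k. sqrt ((V k m - exp (- \<theta>))\<^sup>2)) \<longlonglongrightarrow> sqrt 0" by (rule tendsto_real_sqrt)
    then have "(\<lambda>k. V k m - exp (- \<theta>)) \<longlonglongrightarrow> 0"
      by (simp add: tendsto_rabs_zero_iff)
    then have "(\<lambda>k. V k m) \<longlonglongrightarrow> exp (- \<theta>)" by (simp add: LIM_zero_iff)
    then have "lim (\<lambda>k. enn2real (nexp (atom_sum (level_penalty 1 k) m))) = exp (- \<theta>)"
      unfolding V_def by (rule limI)
    then show ?case
      using \<alpha> a by (simp add: recover_scale_def \<theta>_def powr_powr)
  qed
qed

end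


section \<open>Bernoulli processes\<close>

context separated_prob_space
begin

text \<open>The law of the mark pattern \<open>Z \<subseteq> {..<n}\<close> of an atom of weight \<open>w\<close>, averaged against
  \<open>nexp (l Z x)\<close>.\<close>

definition thin :: "nat \<Rightarrow> (nat set \<Rightarrow> 'u \<Rightarrow> ennreal) \<Rightarrow> ennreal \<Rightarrow> 'u \<Rightarrow> ennreal" where
  "thin n l w x = (\<Sum>Z\<in>Pow {..<n}. w ^ card Z * (1 - w) ^ (n - card Z) * nexp (l Z x))"

lemma measurable_thin:
  assumes "\<And>Z. Z \<subseteq> {..<n} \<Longrightarrow> l Z \<in> borel_measurable G"
  shows "(\<lambda>(w, x). thin n l w x) \<in> borel_measurable (borel \<Otimes>\<^sub>M G)"
proof -
  have [measurable]: "(\<lambda>y. l Z (snd y)) \<in> borel_measurable (borel \<Otimes>\<^sub>M G)" if "Z \<in> Pow {..<n}" for Z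
    using measurable_compose[OF measurable_snd assms[of Z]] that by auto
  have "(\<lambda>y. \<Sum>Z\<in>Pow {..<n}. fst y ^ card Z * (1 - fst y) ^ (n - card Z) * nexp (l Z (snd y)))
      \<in> borel_measurable (borel \<Otimes>\<^sub>M G)"
    by (intro borel_measurable_sum) measurable
  then show ?thesis unfolding thin_def by (simp add: split_def)
qed

section \<open>Realisation of Bernoulli processes by independent coins\<close>

context
  fixes m assumes m: "m \<in> weight_pts"
begin

interpretation fm: finite_measure m by (rule atomic_masses_D(4)[OF m])

abbreviation (input) "coin x \<equiv> measure_pmf (bernoulli_pmf (measure m {x}))"
text \<open>One independent coin for each pair of sample index and atom. Grouped by index, the coins
  are i.i.d. Bernoulli processes; grouped by atom, they are independent mark patterns.\<close>

abbreviation (input) "coins \<equiv> PiM (UNIV \<times> atoms m) (\<lambda>(i::nat, x). coin x)"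
abbreviation (input) "pts z \<equiv> distr (count_space {x \<in> atoms m. z x}) m (\<lambda>x. x)"

lemma atoms_m: "atoms m \<subseteq> space G" "countable (atoms m)"
  using atoms_sub[OF m] countable_atoms[OF m] by auto

lemma weight_m: "x \<in> atoms m \<Longrightarrow> 0 \<le> measure m {x} \<and> measure m {x} \<le> 1"
  using emeasure_atom(1)[OF m, of x] by (simp add: fm.emeasure_eq_measure ennreal_le_1)

lemma prob_space_coins: "prob_space coins"
  by (rule prob_space_PiM) (auto simp: split_def intro: prob_space_measure_pmf)

interpretation C: prob_space coins by (rule prob_space_coins)

lemma emeasure_pts:
  assumes D: "D \<in> sets G"
  shows "emeasure (pts z) D = (\<integral>\<^sup>+x. indicator D x * (if z x then 1 else 0) \<partial>count_space (atoms m))"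
proof -
  have "emeasure (pts z) D = emeasure (count_space {x \<in> atoms m. z x}) (D \<inter> {x \<in> atoms m. z x})"
    by (subst emeasure_distr) (use D atoms_m atomic_masses_D[OF m] in auto)
  also have "\<dots> = emeasure (count_space (atoms m)) (D \<inter> {x \<in> atoms m. z x})"
    by (subst (1 2) emeasure_count_space) auto
  also have "\<dots> = (\<integral>\<^sup>+x. indicator (D \<inter> {x \<in> atoms m. z x}) x \<partial>count_space (atoms m))"
    by (subst nn_integral_indicator) auto
  also have "\<dots> = (\<integral>\<^sup>+x. indicator D x * (if z x then 1 else 0) \<partial>count_space (atoms m))"
    by (intro nn_integral_cong) (auto simp: indicator_def)
  finally show ?thesis .
qed

text \<open>The atoms are countable, so the mass of a set is a limit of finite sums of coin
  indicators.\<close>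

lemma measurable_pts:
  assumes "\<And>x. x \<in> atoms m \<Longrightarrow> Measurable.pred N (\<lambda>y. f y x)"
  shows "(\<lambda>y. pts (f y)) \<in> N \<rightarrow>\<^sub>M measure_algebra G"
proof (rule measurable_measure_algebra)
  show "sets (pts (f y)) = sets G" for y using atomic_masses_D(1)[OF m] by simp
  fix D assume D: "D \<in> sets G"
  obtain S where S: "\<And>K::nat. finite (S K)" "\<And>K. S K \<subseteq> atoms m"
    "\<And>f :: 'u \<Rightarrow> ennreal. (\<lambda>K. \<Sum>x\<in>S K. f x) \<longlonglongrightarrow> (\<integral>\<^sup>+x. f x \<partial>count_space (atoms m))"
    using countable_finite_approx[OF atoms_m(2)] by metis
  have "(\<lambda>y. \<integral>\<^sup>+x. indicator D x * (if f y x then 1 else 0) \<partial>count_space (atoms m)) \<in> borel_measurable N"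
  proof (rule borel_measurable_LIMSEQ_order[OF S(3)])
    fix K
    have "(\<lambda>y. indicator D x * (if f y x then 1 else 0) :: ennreal) \<in> borel_measurable N" if "x \<in> S K" for x
    proof -
      have [measurable]: "Measurable.pred N (\<lambda>y. f y x)" using assms S(2) that by auto
      show ?thesis by measurable
    qed
    then show "(\<lambda>y. \<Sum>x\<in>S K. indicator D x * (if f y x then 1 else 0) :: ennreal) \<in> borel_measurable N"
      by (rule borel_measurable_sum)
  qed
  then show "(\<lambda>y. emeasure (pts (f y)) D) \<in> borel_measurable N"
    by (simp add: emeasure_pts[OF D])
qed

lemma pred_coin:
  assumes "x \<in> S"
  shows "Measurable.pred (PiM S (\<lambda>y. measure_pmf (h y))) (\<lambda>\<omega>. \<omega> x)"
  using measurable_component_singleton[OF assms, of "\<lambda>y. measure_pmf (h y)"]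
  by (simp add: measurable_pmf_measure2 cong: measurable_cong_sets)

lemma coins_eq: "(\<lambda>(i, x). coin x) = (\<lambda>y. measure_pmf (bernoulli_pmf (measure m {snd y})))"
  by auto

lemma indep_coins: "C.indep_vars (\<lambda>(i, x). coin x) (\<lambda>y \<omega>. \<omega> y) (UNIV \<times> atoms m)"
  by (rule indep_vars_PiM_components) (auto simp: split_def intro: prob_space_measure_pmf)

text \<open>Grouping by sample index: the blocks of coins are disjoint, hence independent, and each
  block has the law of the coins in \<open>BeP\<close>.\<close>

lemma PiM_BeP: "PiM UNIV (\<lambda>_. BeP m)
  = distr coins (PiM UNIV (\<lambda>_. measure_algebra G)) (\<lambda>\<omega> i. pts (\<lambda>x. \<omega> (i, x)))"
proof -
  have ma: "measure_algebra m = measure_algebra G"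
    by (rule measure_algebra_cong) (rule atomic_masses_D(1)[OF m])
  have meas: "(\<lambda>\<omega>. pts (\<lambda>x. \<omega> (i, x))) \<in> PiM K (\<lambda>(i, x). coin x) \<rightarrow>\<^sub>M measure_algebra G" if "{i} \<times> atoms m \<subseteq> K" for i K
    unfolding coins_eq by (rule measurable_pts[where f="\<lambda>\<omega> x. \<omega> (i, x)"], rule pred_coin) (use that in auto)
  have ind: "C.indep_vars (\<lambda>_. measure_algebra G) (\<lambda>i \<omega>. pts (\<lambda>x. (restrict (\<lambda>y. \<omega> y) ({i} \<times> atoms m)) (i, x))) UNIV"
    by (rule C.indep_vars_compose2[OF C.indep_vars_restrict[OF indep_coins]])
       (auto simp: disjoint_family_on_def intro: meas)
  \<comment> \<open>The points of sample i read only the coins of block i, so restricting to that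
    block changes nothing.\<close>
  have re: "(\<lambda>i \<omega>. pts (\<lambda>x. (restrict (\<lambda>y. \<omega> y) ({i} \<times> atoms m)) (i, x))) = (\<lambda>i \<omega>. pts (\<lambda>x. \<omega> (i, x)))"
    by (intro ext distr_cong) (auto intro!: arg_cong[where f=count_space])
  from ind have ind': "C.indep_vars (\<lambda>_. measure_algebra G) (\<lambda>i \<omega>. pts (\<lambda>x. \<omega> (i, x))) UNIV"
    by (simp only: re)
  have one: "distr coins (measure_algebra G) (\<lambda>\<omega>. pts (\<lambda>x. \<omega> (i, x))) = BeP m" for i
  proof -
    have "distr coins (PiM (atoms m) (\<lambda>x. case (i, x) of (i, x) \<Rightarrow> coin x)) (\<lambda>\<omega>. \<lambda>x\<in>atoms m. \<omega> (i, x))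
        = PiM (atoms m) (\<lambda>x. case (i, x) of (i, x) \<Rightarrow> coin x)"
      by (rule distr_PiM_reindex) (auto simp: split_def inj_on_def intro: prob_space_measure_pmf)
    then have re: "distr coins (PiM (atoms m) coin) (\<lambda>\<omega>. \<lambda>x\<in>atoms m. \<omega> (i, x)) = PiM (atoms m) coin"
      by simp
    have "BeP m = distr (PiM (atoms m) coin) (measure_algebra G) pts"
      by (simp add: BeP_def ma)
    also have "\<dots> = distr (distr coins (PiM (atoms m) coin) (\<lambda>\<omega>. \<lambda>x\<in>atoms m. \<omega> (i, x))) (measure_algebra G) pts"
      by (simp only: re)
    also have "\<dots> = distr coins (measure_algebra G) (pts \<circ> (\<lambda>\<omega>. \<lambda>x\<in>atoms m. \<omega> (i, x)))"
    proof (rule distr_distr)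
      show "pts \<in> PiM (atoms m) coin \<rightarrow>\<^sub>M measure_algebra G"
        by (rule measurable_pts[where f="\<lambda>\<omega>. \<omega>"], rule pred_coin)
      show "(\<lambda>\<omega>. \<lambda>x\<in>atoms m. \<omega> (i, x)) \<in> coins \<rightarrow>\<^sub>M PiM (atoms m) coin"
        by (rule measurable_restrict) (use measurable_component_singleton[of "(i, _)" "UNIV \<times> atoms m" "\<lambda>(i, x). coin x"] in auto)
    qed
    also have "pts \<circ> (\<lambda>\<omega>. \<lambda>x\<in>atoms m. \<omega> (i, x)) = (\<lambda>\<omega>. pts (\<lambda>x. \<omega> (i, x)))"
      by (intro ext, unfold comp_def, intro distr_cong) (auto intro!: arg_cong[where f=count_space])
    finally show ?thesis ..
  qed
  have "distr coins (PiM UNIV (\<lambda>_. measure_algebra G)) (\<lambda>\<omega>. \<lambda>i\<in>UNIV. pts (\<lambda>x. \<omega> (i, x)))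
      = PiM UNIV (\<lambda>i. distr coins (measure_algebra G) (\<lambda>\<omega>. pts (\<lambda>x. \<omega> (i, x))))"
    using ind' by (subst (asm) C.indep_vars_iff_distr_eq_PiM') (auto intro: meas)
  then show ?thesis by (simp add: one restrict_def)
qed

lemma measurable_coin_pts:
  "(\<lambda>\<omega> i. pts (\<lambda>x. \<omega> (i, x))) \<in> coins \<rightarrow>\<^sub>M PiM UNIV (\<lambda>_::nat. measure_algebra G)"
proof -
  have "(\<lambda>\<omega>. \<lambda>i\<in>UNIV. pts (\<lambda>x. \<omega> (i, x))) \<in> coins \<rightarrow>\<^sub>M PiM UNIV (\<lambda>_::nat. measure_algebra G)"
    unfolding coins_eq
  proof (rule measurable_restrict)
    fix i :: nat
    show "(\<lambda>\<omega>. pts (\<lambda>x. \<omega> (i, x))) \<in> PiM (UNIV \<times> atoms m) (\<lambda>y. measure_pmf (bernoulli_pmf (measure m {snd y})))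
        \<rightarrow>\<^sub>M measure_algebra G"
      by (rule measurable_pts[where f="\<lambda>\<omega> x. \<omega> (i, x)"], rule pred_coin) auto
  qed
  then show ?thesis by (simp add: restrict_def)
qed

lemma emeasure_coin:
  assumes x: "x \<in> atoms m"
  shows "(\<integral>\<^sup>+\<omega>. (if \<omega> (i, x) = b then 1 else 0) \<partial>coins) = (if b then emeasure m {x} else 1 - emeasure m {x})"
proof -
  have "(\<integral>\<^sup>+\<omega>. (if \<omega> (i, x) = b then 1 else 0) \<partial>coins)
      = (\<integral>\<^sup>+y. (if y = b then 1 else 0) \<partial>distr coins (coin x) (\<lambda>\<omega>. \<omega> (i, x)))"
  proof (rule nn_integral_distr[symmetric])
    show "(\<lambda>\<omega>. \<omega> (i, x)) \<in> coins \<rightarrow>\<^sub>M coin x"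
      using measurable_component_singleton[of "(i, x)" "UNIV \<times> atoms m" "\<lambda>(i, x). coin x"] x by simp
  qed simp
  also have "distr coins (coin x) (\<lambda>\<omega>. \<omega> (i, x)) = coin x"
    using distr_PiM_component[of "UNIV \<times> atoms m" "\<lambda>(i, x). coin x" "(i, x)"] x
    by (auto simp: split_def prob_space_measure_pmf)
  also have "(\<integral>\<^sup>+y. (if y = b then 1 else 0) \<partial>coin x) = (if b then emeasure m {x} else 1 - emeasure m {x})"
    using weight_m[OF x] ennreal_minus[of "measure m {x}" 1]
    by (subst nn_integral_bernoulli_pmf) (auto simp: fm.emeasure_eq_measure)
  finally show ?thesis .
qed

text \<open>The expected number of heads in one sample is the total mass of m, which is
  finite.\<close>

lemma AE_coins_finite: "AE \<omega> in coins. \<forall>i. finite {x\<in>atoms m. \<omega> (i, x)}"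
proof -
  have "AE \<omega> in coins. finite {x\<in>atoms m. \<omega> (i, x)}" for i
  proof -
    have pm: "(\<lambda>\<omega>. if \<omega> (i, x) = True then 1 else 0 :: ennreal) \<in> borel_measurable coins" if "x \<in> atoms m" for x
    proof -
      have [measurable]: "Measurable.pred coins (\<lambda>\<omega>. \<omega> (i, x))"
        unfolding coins_eq by (rule pred_coin) (use that in auto)
      show ?thesis by measurable
    qed
    have "(\<integral>\<^sup>+\<omega>. \<integral>\<^sup>+x. (if \<omega> (i, x) = True then 1 else 0) \<partial>count_space (atoms m) \<partial>coins)
        = (\<integral>\<^sup>+x. \<integral>\<^sup>+\<omega>. (if \<omega> (i, x) = True then 1 else 0) \<partial>coins \<partial>count_space (atoms m))"
      by (rule nn_integral_count_space_nn_integral[OF atoms_m(2) pm])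
    also have "\<dots> = (\<integral>\<^sup>+x. emeasure m {x} * indicator (space G) x \<partial>count_space (atoms m))"
      using atoms_m(1) by (intro nn_integral_cong) (auto simp: emeasure_coin[where b=True, simplified])
    also have "\<dots> = emeasure m (space G)"
      by (rule emeasure_atomic_masses[OF m, symmetric]) auto
    finally have "(\<integral>\<^sup>+\<omega>. \<integral>\<^sup>+x. (if \<omega> (i, x) = True then 1 else 0) \<partial>count_space (atoms m) \<partial>coins) < \<infinity>"
      using atomic_masses_D(3)[OF m] by simp
    moreover have "(\<lambda>\<omega>. \<integral>\<^sup>+x. (if \<omega> (i, x) = True then 1 else 0) \<partial>count_space (atoms m)) \<in> borel_measurable coins"
    proof -
      have "(\<lambda>\<omega>. emeasure (pts (\<lambda>x. \<omega> (i, x))) (space G)) \<in> borel_measurable coins"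
        using measurable_compose[OF measurable_compose[OF measurable_coin_pts measurable_component_singleton[of i UNIV]]
            measurable_emeasure_measure_algebra[of "space G"]] by simp
      also have "(\<lambda>\<omega>. emeasure (pts (\<lambda>x. \<omega> (i, x))) (space G))
          = (\<lambda>\<omega>. \<integral>\<^sup>+x. (if \<omega> (i, x) = True then 1 else 0) \<partial>count_space (atoms m))"
        using atoms_m(1) by (intro ext, subst emeasure_pts) (auto intro!: nn_integral_cong)
      finally show ?thesis .
    qed
    ultimately have "AE \<omega> in coins. (\<integral>\<^sup>+x. (if \<omega> (i, x) = True then 1 else 0) \<partial>count_space (atoms m)) \<noteq> \<infinity>"
      by (intro nn_integral_PInf_AE) (auto simp: less_top)
    then show ?thesis
    proof eventually_elim
      case (elim \<omega>)
      have "(\<integral>\<^sup>+x. (if \<omega> (i, x) = True then 1 else 0) \<partial>count_space (atoms m))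
          = emeasure (count_space (atoms m)) {x\<in>atoms m. \<omega> (i, x)}"
      proof -
        have "(\<integral>\<^sup>+x. (if \<omega> (i, x) = True then 1 else 0) \<partial>count_space (atoms m))
            = (\<integral>\<^sup>+x. indicator {x\<in>atoms m. \<omega> (i, x)} x \<partial>count_space (atoms m))"
          by (intro nn_integral_cong) (auto simp: indicator_def)
        then show ?thesis by (subst (asm) nn_integral_indicator) auto
      qed
      with elim show ?case by (auto simp: emeasure_count_space split: if_splits)
    qed
  qed
  then show ?thesis by (simp add: AE_all_countable)
qed

lemma pts_simple:
  assumes "finite {x\<in>atoms m. z x}"
  shows "pts z \<in> simple_pts" "atoms (pts z) = {x\<in>atoms m. z x}"
proof -
  have e: "emeasure (pts z) D = of_nat (card ({x\<in>atoms m. z x} \<inter> D))" if D: "D \<in> sets G" for D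
  proof -
    have "emeasure (pts z) D = emeasure (count_space {x \<in> atoms m. z x}) ({x \<in> atoms m. z x} \<inter> D)"
      by (subst emeasure_distr) (use D atoms_m atomic_masses_D[OF m] in \<open>auto intro!: arg_cong2[where f=emeasure]\<close>)
    then show ?thesis using assms by (simp add: emeasure_count_space)
  qed
  show "pts z \<in> simple_pts" "atoms (pts z) = {x\<in>atoms m. z x}"
    using simple_ptsI[of "pts z", OF _ assms _ e] atomic_masses_D(1)[OF m] atoms_m(1) by auto
qed

lemma BeP_simple: "AE \<pi> in PiM UNIV (\<lambda>_::nat. BeP m). \<forall>i. \<pi> i \<in> simple_pts"
proof -
  have [measurable]: "Measurable.pred (PiM UNIV (\<lambda>_. measure_algebra G)) (\<lambda>\<pi>. \<pi> i \<in> simple_pts)" for i :: nat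
  proof -
    have "simple_pts \<in> sets (measure_algebra G)" by (rule atomic_masses_sets) simp
    then show ?thesis by measurable
  qed
  show ?thesis
    unfolding PiM_BeP
  proof (subst AE_distr_iff[OF measurable_coin_pts])
    show "AE \<omega> in coins. \<forall>i. pts (\<lambda>x. \<omega> (i, x)) \<in> simple_pts"
      using AE_coins_finite by eventually_elim (auto intro!: pts_simple)
  qed measurable
qed

text \<open>Sum over the possible patterns Z of the atom; the coins of different samples are
  independent, which gives the Bernoulli weights in \<open>thin\<close>.\<close>

lemma nn_integral_coin_pattern:
  assumes l: "\<And>Z. Z \<subseteq> {..<n} \<Longrightarrow> l Z \<in> borel_measurable G" and x: "x \<in> atoms m"
  shows "(\<integral>\<^sup>+\<omega>. nexp (l {i. i < n \<and> \<omega> (i, x)} x) \<partial>coins) = thin n l (emeasure m {x}) x"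
proof -
  have [measurable]: "Measurable.pred coins (\<lambda>\<omega>. \<omega> (i, x))" for i
    unfolding coins_eq by (rule pred_coin) (use x in auto)
  \<comment> \<open>Writes the event that the pattern equals Z as a product over the samples, ready
    for independence.\<close>
  have pat: "(\<Prod>i<n. if \<omega> (i, x) = (i \<in> Z) then 1 else 0) = (if {i. i < n \<and> \<omega> (i, x)} = Z then 1 else 0 :: ennreal)"
    if Z: "Z \<subseteq> {..<n}" for Z \<omega>
  proof (cases "{i. i < n \<and> \<omega> (i, x)} = Z")
    case True
    then have "\<omega> (i, x) = (i \<in> Z)" if "i < n" for i using that by auto
    then show ?thesis using True by (auto intro!: prod.neutral)
  next
    case False
    then have "\<exists>i<n. \<omega> (i, x) \<noteq> (i \<in> Z)" using Z by auto
    then have "\<exists>i\<in>{..<n}. (if \<omega> (i, x) = (i \<in> Z) then 1 else 0 :: ennreal) = 0" by auto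
    then have "(\<Prod>i<n. if \<omega> (i, x) = (i \<in> Z) then 1 else 0) = (0 :: ennreal)"
      by (rule prod_zero[OF finite_lessThan])
    then show ?thesis using False by simp
  qed
  have w: "(\<integral>\<^sup>+\<omega>. (\<Prod>i<n. if \<omega> (i, x) = (i \<in> Z) then 1 else 0) \<partial>coins)
      = emeasure m {x} ^ card Z * (1 - emeasure m {x}) ^ (n - card Z)" if Z: "Z \<subseteq> {..<n}" for Z
  proof -
    have "C.indep_vars (\<lambda>_. borel) (\<lambda>i \<omega>. if (restrict (\<lambda>y. \<omega> y) {(i, x)}) (i, x) = (i \<in> Z) then 1 else 0 :: ennreal) {..<n}"
    proof (rule C.indep_vars_compose2[OF C.indep_vars_restrict[OF indep_coins]])
      fix i :: nat
      have [measurable]: "Measurable.pred (PiM {(i, x)} (\<lambda>(i, x). coin x)) (\<lambda>\<omega>. \<omega> (i, x))"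
        unfolding coins_eq by (rule pred_coin) simp
      show "(\<lambda>\<omega>. if \<omega> (i, x) = (i \<in> Z) then 1 else 0 :: ennreal) \<in> borel_measurable (PiM {(i, x)} (\<lambda>(i, x). coin x))"
        by measurable
    qed (use x in \<open>auto simp: disjoint_family_on_def\<close>)
    from C.indep_vars_nn_integral[OF _ this]
    have "(\<integral>\<^sup>+\<omega>. (\<Prod>i<n. if \<omega> (i, x) = (i \<in> Z) then 1 else 0) \<partial>coins)
        = (\<Prod>i<n. \<integral>\<^sup>+\<omega>. (if \<omega> (i, x) = (i \<in> Z) then 1 else 0) \<partial>coins)" by simp
    also have "\<dots> = (\<Prod>i<n. if i \<in> Z then emeasure m {x} else 1 - emeasure m {x})"
      using x by (intro prod.cong) (auto simp: emeasure_coin)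
    also have "\<dots> = emeasure m {x} ^ card ({..<n} \<inter> Z) * (1 - emeasure m {x}) ^ card ({..<n} \<inter> - Z)"
      by (subst prod.If_cases) auto
    also have "{..<n} \<inter> Z = Z" using Z by auto
    also have "card ({..<n} \<inter> - Z) = n - card Z"
      using Z card_Diff_subset[of Z "{..<n}"] finite_subset[OF Z] by (simp add: Diff_eq)
    finally show ?thesis .
  qed
  have "(\<integral>\<^sup>+\<omega>. nexp (l {i. i < n \<and> \<omega> (i, x)} x) \<partial>coins)
      = (\<integral>\<^sup>+\<omega>. (\<Sum>Z\<in>Pow {..<n}. (\<Prod>i<n. if \<omega> (i, x) = (i \<in> Z) then 1 else 0) * nexp (l Z x)) \<partial>coins)"
  proof (rule nn_integral_cong)
    fix \<omega>
    have "(\<Sum>Z\<in>Pow {..<n}. (\<Prod>i<n. if \<omega> (i, x) = (i \<in> Z) then 1 else 0) * nexp (l Z x))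
        = (\<Sum>Z\<in>Pow {..<n}. if {i. i < n \<and> \<omega> (i, x)} = Z then nexp (l Z x) else 0)"
      by (rule sum.cong) (auto simp only: pat Pow_iff split: if_splits, auto)
    then show "nexp (l {i. i < n \<and> \<omega> (i, x)} x) = (\<Sum>Z\<in>Pow {..<n}. (\<Prod>i<n. if \<omega> (i, x) = (i \<in> Z) then 1 else 0) * nexp (l Z x))"
      by (simp only:) (subst sum.delta', auto)
  qed
  also have "\<dots> = (\<Sum>Z\<in>Pow {..<n}. (\<integral>\<^sup>+\<omega>. (\<Prod>i<n. if \<omega> (i, x) = (i \<in> Z) then 1 else 0) \<partial>coins) * nexp (l Z x))"
    by (subst nn_integral_sum) (auto intro!: sum.cong nn_integral_multc)
  also have "\<dots> = thin n l (emeasure m {x}) x"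
    unfolding thin_def by (intro sum.cong) (auto simp: w)
  finally show ?thesis .
qed

text \<open>Grouping by atom: patterns of different atoms are independent, so the expectation is a
  product over all atoms. That l vanishes on the empty pattern allows passing between all atoms and
  the observed ones.\<close>

lemma BeP_laplace:
  assumes l: "\<And>Z. Z \<subseteq> {..<n} \<Longrightarrow> l Z \<in> borel_measurable G" and l0: "\<And>x. l {} x = 0"
  shows "(\<integral>\<^sup>+\<pi>. nexp (obs_sum n l \<pi>) \<partial>PiM UNIV (\<lambda>_. BeP m)) = nexp (atom_sum (\<lambda>w x. nlog (thin n l w x)) m)"
proof -
  define Y where "Y x \<omega> = l {i. i < n \<and> \<omega> (i, x)} x" for x :: 'u and \<omega> :: "nat \<times> 'u \<Rightarrow> bool"
  have om: "(\<lambda>\<pi>. nexp (obs_sum n l \<pi>)) \<in> borel_measurable (PiM UNIV (\<lambda>_. measure_algebra G))"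
    using measurable_obs_sum[of n l UNIV, OF l] by measurable
  have Ym: "Y x \<in> borel_measurable (PiM K (\<lambda>(i, x). coin x))" if K: "{..<n} \<times> {x} \<subseteq> K" for x K
  proof -
    define R where "R i \<omega> \<longleftrightarrow> i < n \<and> \<omega> (i, x)" for i \<omega>
    have [measurable]: "Measurable.pred (PiM K (\<lambda>(i, x). coin x)) (R i)" for i
    proof (cases "i < n")
      case True
      then have "R i = (\<lambda>\<omega>. \<omega> (i, x))" by (auto simp: R_def)
      then show ?thesis unfolding coins_eq using K True by (simp only:) (intro pred_coin, auto)
    next
      case False
      then have "R i = (\<lambda>\<omega>. False)" by (auto simp: R_def)
      then show ?thesis by (simp only:) simp
    qed
    have [measurable]: "Measurable.pred (PiM K (\<lambda>(i, x). coin x)) (\<lambda>\<omega>. {i. i < n \<and> \<omega> (i, x)} = Z)" for Z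
    proof -
      have eq: "(\<lambda>\<omega>. {i. i < n \<and> \<omega> (i, x)} = Z) = (\<lambda>\<omega>. \<forall>i. R i \<omega> \<longleftrightarrow> i \<in> Z)" by (auto simp: R_def)
      show ?thesis by (subst eq) measurable
    qed
    have "(\<lambda>\<omega>. \<Sum>Z\<in>Pow {..<n}. if {i. i < n \<and> \<omega> (i, x)} = Z then l Z x else 0) \<in> borel_measurable (PiM K (\<lambda>(i, x). coin x))"
      by measurable
    also have "(\<lambda>\<omega>. \<Sum>Z\<in>Pow {..<n}. if {i. i < n \<and> \<omega> (i, x)} = Z then l Z x else 0) = Y x"
      by (intro ext, subst sum.delta') (auto simp: Y_def)
    finally show ?thesis .
  qed
  have "(\<integral>\<^sup>+\<pi>. nexp (obs_sum n l \<pi>) \<partial>PiM UNIV (\<lambda>_. BeP m))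
      = (\<integral>\<^sup>+\<omega>. nexp (obs_sum n l (\<lambda>i. pts (\<lambda>x. \<omega> (i, x)))) \<partial>coins)"
    unfolding PiM_BeP by (rule nn_integral_distr[OF measurable_coin_pts]) (use om in simp)
  also have "\<dots> = (\<integral>\<^sup>+\<omega>. nexp (\<integral>\<^sup>+x. Y x \<omega> \<partial>count_space (atoms m)) \<partial>coins)"
    using AE_coins_finite
  proof (intro nn_integral_cong_AE, eventually_elim)
    case (elim \<omega>)
    let ?\<pi> = "\<lambda>i. pts (\<lambda>x. \<omega> (i, x))"
    have s: "?\<pi> i \<in> simple_pts" "atoms (?\<pi> i) = {x\<in>atoms m. \<omega> (i, x)}" for i
      using pts_simple elim by auto
    have z: "zset n ?\<pi> x = {i. i < n \<and> \<omega> (i, x)}" if "x \<in> atoms m" for x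
      using that by (simp add: zset_def s(2))
    have sub: "observed n ?\<pi> \<subseteq> atoms m" by (auto simp: observed_def s(2))
    have "obs_sum n l ?\<pi> = (\<Sum>x\<in>observed n ?\<pi>. l (zset n ?\<pi> x) x)"
      by (rule obs_sum_eq[OF s(1) l])
    also have "\<dots> = (\<Sum>x\<in>observed n ?\<pi>. Y x \<omega>)"
      using sub z by (intro sum.cong) (auto simp: Y_def)
    also have "\<dots> = (\<integral>\<^sup>+x. Y x \<omega> \<partial>count_space (atoms m))"
    \<comment> \<open>An atom outside the observed set has the empty pattern and adds
      nothing.\<close>
    proof (rule nn_integral_count_space'[symmetric])
      fix x assume x: "x \<in> atoms m" "x \<notin> observed n ?\<pi>"
      then have "zset n ?\<pi> x = {}" by (simp add: zset_eq_empty_iff)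
      then have "{i. i < n \<and> \<omega> (i, x)} = {}" using z[OF x(1)] by (simp only:)
      then show "Y x \<omega> = 0" unfolding Y_def by (simp only: l0)
    qed (use sub finite_observed[of n ?\<pi>] s in auto)
    finally show ?case by simp
  qed
  also have "\<dots> = nexp (\<integral>\<^sup>+x. nlog (\<integral>\<^sup>+\<omega>. nexp (Y x \<omega>) \<partial>coins) \<partial>count_space (atoms m))"
  proof (rule C.indep_vars_nn_integral_nexp[OF atoms_m(2)])
    have "C.indep_vars (\<lambda>_. borel) (\<lambda>x \<omega>. Y x (restrict (\<lambda>y. \<omega> y) (UNIV \<times> {x}))) (atoms m)"
      by (rule C.indep_vars_compose2[OF C.indep_vars_restrict[OF indep_coins]])
         (auto simp: disjoint_family_on_def intro!: Ym)
    then show "C.indep_vars (\<lambda>_. borel) Y (atoms m)"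
      by (simp add: Y_def[abs_def])
  qed
  also have "\<dots> = nexp (\<integral>\<^sup>+x. nlog (thin n l (emeasure m {x}) x) \<partial>count_space (atoms m))"
    using nn_integral_coin_pattern[of n l, OF l]
    by (intro arg_cong[where f=nexp] nn_integral_cong) (simp add: Y_def)
  also have "\<dots> = nexp (atom_sum (\<lambda>w x. nlog (thin n l w x)) m)"
  proof -
    have "(\<lambda>(w, x). nlog (thin n l w x)) \<in> borel_measurable (borel \<Otimes>\<^sub>M G)"
      using measurable_compose[OF measurable_thin[of n l, OF l] nlog_measurable] by (simp add: split_def)
    then show ?thesis by (subst atom_sum_eq[OF _ m]) auto
  qed
  finally show ?thesis .
qed

end

end


section \<open>Conditional laws and conditional expectations\<close>

context prob_space
begin

abbreviation "cond_algebra X MX \<equiv> vimage_algebra (space M) X MX"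

lemma finite_measure_subalgebra_vimage:
  assumes X: "X \<in> M \<rightarrow>\<^sub>M MX" shows "finite_measure_subalgebra M (cond_algebra X MX)"
proof (intro finite_measure_subalgebra.intro finite_measure_subalgebra_axioms.intro finite_measure_axioms)
  have "X \<in> space M \<rightarrow> space MX" using measurable_space[OF X] by auto
  then show "subalgebra M (cond_algebra X MX)"
    unfolding subalgebra_def using measurable_sets[OF X] by (auto simp: sets_vimage_algebra2)
qed

lemma measurable_cond_algebra:
  assumes X: "X \<in> M \<rightarrow>\<^sub>M MX" and h: "h \<in> MX \<rightarrow>\<^sub>M N"
  shows "(\<lambda>\<omega>. h (X \<omega>)) \<in> cond_algebra X MX \<rightarrow>\<^sub>M N"
  using measurable_compose[OF measurable_vimage_algebra1 h] measurable_space[OF X] by blast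

lemma nn_cond_exp_suminf:
  assumes X: "X \<in> M \<rightarrow>\<^sub>M MX" and f: "\<And>i. f i \<in> borel_measurable M"
  shows "AE \<omega> in M. (\<Sum>i. nn_cond_exp M (cond_algebra X MX) (f i) \<omega>) = nn_cond_exp M (cond_algebra X MX) (\<lambda>\<omega>. \<Sum>i. f i \<omega>) \<omega>"
proof -
  interpret F: finite_measure_subalgebra M "cond_algebra X MX"
    by (rule finite_measure_subalgebra_vimage[OF X])
  note [measurable] = f
  show ?thesis
  proof (rule F.nn_cond_exp_charact)
    fix A assume A [measurable]: "A \<in> sets (cond_algebra X MX)"
    then have AM [measurable]: "A \<in> sets M" using F.subalg by (auto simp: subalgebra_def)
    have "(\<integral>\<^sup>+\<omega>\<in>A. (\<Sum>i. f i \<omega>) \<partial>M) = (\<Sum>i. \<integral>\<^sup>+\<omega>. indicator A \<omega> * f i \<omega> \<partial>M)"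
      by (subst nn_integral_suminf[symmetric]) (auto simp: mult.commute intro!: nn_integral_cong ennreal_suminf_cmult[symmetric])
    also have "\<dots> = (\<Sum>i. \<integral>\<^sup>+\<omega>. indicator A \<omega> * nn_cond_exp M (cond_algebra X MX) (f i) \<omega> \<partial>M)"
      by (subst F.nn_cond_exp_intg) auto
    also have "\<dots> = (\<integral>\<^sup>+\<omega>\<in>A. (\<Sum>i. nn_cond_exp M (cond_algebra X MX) (f i) \<omega>) \<partial>M)"
      by (subst nn_integral_suminf[symmetric]) (auto simp: mult.commute intro!: nn_integral_cong ennreal_suminf_cmult)
    finally show "(\<integral>\<^sup>+\<omega>\<in>A. (\<Sum>i. f i \<omega>) \<partial>M) = (\<integral>\<^sup>+\<omega>\<in>A. (\<Sum>i. nn_cond_exp M (cond_algebra X MX) (f i) \<omega>) \<partial>M)" .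
  qed (auto intro: borel_measurable_suminf)
qed

lemma nn_cond_exp_SUP:
  assumes X: "X \<in> M \<rightarrow>\<^sub>M MX" and f: "\<And>i. f i \<in> borel_measurable M" and "incseq f"
  shows "AE \<omega> in M. (SUP i. nn_cond_exp M (cond_algebra X MX) (f i) \<omega>) = nn_cond_exp M (cond_algebra X MX) (\<lambda>\<omega>. SUP i. f i \<omega>) \<omega>"
proof -
  interpret F: finite_measure_subalgebra M "cond_algebra X MX"
    by (rule finite_measure_subalgebra_vimage[OF X])
  note [measurable] = f
  show ?thesis
  proof (rule F.nn_cond_exp_charact)
    fix A assume A [measurable]: "A \<in> sets (cond_algebra X MX)"
    then have AM [measurable]: "A \<in> sets M" using F.subalg by (auto simp: subalgebra_def)
    have "(\<integral>\<^sup>+\<omega>\<in>A. (SUP i. f i \<omega>) \<partial>M) = (\<integral>\<^sup>+\<omega>. (SUP i. indicator A \<omega> * f i \<omega>) \<partial>M)"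
      by (intro nn_integral_cong) (auto simp: indicator_def)
    also have "\<dots> = (SUP i. \<integral>\<^sup>+\<omega>. indicator A \<omega> * f i \<omega> \<partial>M)"
      using \<open>incseq f\<close> by (intro nn_integral_monotone_convergence_SUP) (auto simp: incseq_def le_fun_def intro!: mult_left_mono)
    also have "\<dots> = (SUP i. \<integral>\<^sup>+\<omega>. indicator A \<omega> * nn_cond_exp M (cond_algebra X MX) (f i) \<omega> \<partial>M)"
      by (subst F.nn_cond_exp_intg) auto
    also have "\<dots> = (\<integral>\<^sup>+\<omega>. (SUP i. indicator A \<omega> * nn_cond_exp M (cond_algebra X MX) (f i) \<omega>) \<partial>M)"
    \<comment> \<open>Versions of the conditional expectations increase only almost
      everywhere.\<close>
    proof (rule nn_integral_monotone_convergence_SUP_AE[symmetric])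
      fix i
      have "AE \<omega> in M. nn_cond_exp M (cond_algebra X MX) (f i) \<omega> \<le> nn_cond_exp M (cond_algebra X MX) (f (Suc i)) \<omega>"
        using \<open>incseq f\<close> by (intro F.nn_cond_exp_mono) (auto simp: incseq_Suc_iff le_fun_def)
      then show "AE \<omega> in M. indicator A \<omega> * nn_cond_exp M (cond_algebra X MX) (f i) \<omega>
          \<le> indicator A \<omega> * nn_cond_exp M (cond_algebra X MX) (f (Suc i)) \<omega>"
        by eventually_elim (intro mult_left_mono, auto)
    qed auto
    also have "\<dots> = (\<integral>\<^sup>+\<omega>\<in>A. (SUP i. nn_cond_exp M (cond_algebra X MX) (f i) \<omega>) \<partial>M)"
      by (intro nn_integral_cong) (auto simp: indicator_def)
    finally show "(\<integral>\<^sup>+\<omega>\<in>A. (SUP i. f i \<omega>) \<partial>M) = (\<integral>\<^sup>+\<omega>\<in>A. (SUP i. nn_cond_exp M (cond_algebra X MX) (f i) \<omega>) \<partial>M)" .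
  qed auto
qed

lemma cond_lawD:
  assumes "cond_law M MX X MY Y \<kappa>"
  shows "X \<in> M \<rightarrow>\<^sub>M MX" "Y \<in> M \<rightarrow>\<^sub>M MY" "AE \<omega> in M. \<kappa> (X \<omega>) \<in> space (prob_algebra MY)"
  using assms by (auto simp: cond_law_def)

text \<open>An indicator has no negative part, and its conditional expectation is at most 1, so
  passing to real numbers loses nothing.\<close>

lemma real_cond_exp_indicator:
  assumes X: "X \<in> M \<rightarrow>\<^sub>M MX" and A: "A \<in> sets M"
  shows "AE \<omega> in M. nn_cond_exp M (cond_algebra X MX) (indicator A) \<omega> = ennreal (real_cond_exp M (cond_algebra X MX) (indicator A) \<omega>)"
proof -
  interpret F: finite_measure_subalgebra M "cond_algebra X MX"
    by (rule finite_measure_subalgebra_vimage[OF X])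
  note [measurable] = A
  have "AE \<omega> in M. 0 = nn_cond_exp M (cond_algebra X MX) (\<lambda>_. 0) \<omega>"
    by (rule F.nn_cond_exp_F_meas) auto
  moreover have "AE \<omega> in M. 1 = nn_cond_exp M (cond_algebra X MX) (\<lambda>_. 1) \<omega>"
    by (rule F.nn_cond_exp_F_meas) auto
  moreover have "AE \<omega> in M. nn_cond_exp M (cond_algebra X MX) (indicator A) \<omega> \<le> nn_cond_exp M (cond_algebra X MX) (\<lambda>_. 1) \<omega>"
    by (rule F.nn_cond_exp_mono) (auto simp: indicator_def)
  ultimately show ?thesis
  proof eventually_elim
    case (elim \<omega>)
    have 1: "(\<lambda>x. ennreal (indicator A x)) = indicator A" by (auto simp: indicator_def)
    have 2: "(\<lambda>x. ennreal (- indicator A x)) = (\<lambda>_. 0)" by (auto simp: indicator_def ennreal_neg)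
    have "nn_cond_exp M (cond_algebra X MX) (indicator A) \<omega> \<le> 1" using elim by simp
    then have "nn_cond_exp M (cond_algebra X MX) (indicator A) \<omega> < \<top>"
      by (rule order.strict_trans1) simp
    then show ?case
      using elim by (simp add: real_cond_exp_def 1 2)
  qed
qed

text \<open>Extension from indicators by induction over measurable functions. At every stage the
  almost sure identities are combined with the event that \<open>\<kappa> (X \<omega>)\<close> is a
  probability law, because nothing is known about \<open>\<kappa>\<close> elsewhere.\<close>

lemma cond_law_nn_cond_exp:
  assumes cl: "cond_law M MX X MY Y \<kappa>" and f: "f \<in> borel_measurable MY"
  shows "AE \<omega> in M. nn_cond_exp M (cond_algebra X MX) (\<lambda>\<omega>. f (Y \<omega>)) \<omega> = (\<integral>\<^sup>+y. f y \<partial>\<kappa> (X \<omega>))"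
proof -
  note X = cond_lawD(1)[OF cl] and Y = cond_lawD(2)[OF cl] and \<kappa> = cond_lawD(3)[OF cl]
  interpret F: finite_measure_subalgebra M "cond_algebra X MX"
    by (rule finite_measure_subalgebra_vimage[OF X])
  let ?E = "nn_cond_exp M (cond_algebra X MX)"
  have mf [measurable]: "(\<lambda>\<omega>. g (Y \<omega>)) \<in> borel_measurable M" if "g \<in> borel_measurable MY" for g
    using measurable_compose[OF Y that] .
  have km: "g \<in> borel_measurable (\<kappa> (X \<omega>))" if "\<kappa> (X \<omega>) \<in> space (prob_algebra MY)" "g \<in> borel_measurable MY" for g :: "'c \<Rightarrow> ennreal" and \<omega>
    using that by (simp add: space_prob_algebra cong: measurable_cong_sets)
  from f show ?thesis
  proof induction
    case (cong f g)
    have "AE \<omega> in M. ?E (\<lambda>\<omega>. f (Y \<omega>)) \<omega> = ?E (\<lambda>\<omega>. g (Y \<omega>)) \<omega>"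
      using cong measurable_space[OF Y] by (intro F.nn_cond_exp_cong mf) auto
    with cong(4) \<kappa> show ?case
    proof eventually_elim
      case (elim \<omega>)
      then have "space (\<kappa> (X \<omega>)) = space MY"
        by (auto simp: space_prob_algebra dest: sets_eq_imp_space_eq)
      then have "(\<integral>\<^sup>+y. f y \<partial>\<kappa> (X \<omega>)) = (\<integral>\<^sup>+y. g y \<partial>\<kappa> (X \<omega>))"
        using cong(3) by (intro nn_integral_cong) auto
      then show ?case using elim by simp
    qed
  next
    case (set B)
    have "Y -` B \<inter> space M \<in> sets M" using measurable_sets[OF Y set] .
    from real_cond_exp_indicator[OF X this]
    have "AE \<omega> in M. ?E (indicator (Y -` B \<inter> space M)) \<omega> = ennreal (real_cond_exp M (cond_algebra X MX) (indicator (Y -` B \<inter> space M)) \<omega>)" .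
    moreover have "AE \<omega> in M. real_cond_exp M (cond_algebra X MX) (indicator (Y -` B \<inter> space M)) \<omega> = measure (\<kappa> (X \<omega>)) B"
      using cl set by (auto simp: cond_law_def)
    moreover have "AE \<omega> in M. ?E (\<lambda>\<omega>. indicator B (Y \<omega>)) \<omega> = ?E (indicator (Y -` B \<inter> space M)) \<omega>"
      using set \<open>Y -` B \<inter> space M \<in> sets M\<close>
      by (intro F.nn_cond_exp_cong) (auto intro!: AE_I2 mf simp: indicator_def)
    ultimately show ?case
      using \<kappa>
    proof eventually_elim
      case (elim \<omega>)
      then interpret K: prob_space "\<kappa> (X \<omega>)" by (simp add: space_prob_algebra)
      show ?case using elim set by (simp add: space_prob_algebra K.emeasure_eq_measure)
    qed
  next
    case (mult f c)
    have "AE \<omega> in M. c * ?E (\<lambda>\<omega>. f (Y \<omega>)) \<omega> = ?E (\<lambda>\<omega>. c * f (Y \<omega>)) \<omega>"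
      using mult by (intro F.nn_cond_exp_prod mf) auto
    with mult(4) \<kappa> show ?case
    proof eventually_elim
      case (elim \<omega>)
      have "(\<integral>\<^sup>+y. c * f y \<partial>\<kappa> (X \<omega>)) = c * (\<integral>\<^sup>+y. f y \<partial>\<kappa> (X \<omega>))"
        by (rule nn_integral_cmult[OF km[OF elim(2) mult(2)]])
      then show ?case using elim by simp
    qed
  next
    case (add f g)
    have "AE \<omega> in M. ?E (\<lambda>\<omega>. g (Y \<omega>)) \<omega> + ?E (\<lambda>\<omega>. f (Y \<omega>)) \<omega> = ?E (\<lambda>\<omega>. g (Y \<omega>) + f (Y \<omega>)) \<omega>"
      using add by (intro F.nn_cond_exp_sum mf) auto
    with add.IH \<kappa> show ?case
    proof eventually_elim
      case (elim \<omega>)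
      have "(\<integral>\<^sup>+y. g y + f y \<partial>\<kappa> (X \<omega>)) = (\<integral>\<^sup>+y. g y \<partial>\<kappa> (X \<omega>)) + (\<integral>\<^sup>+y. f y \<partial>\<kappa> (X \<omega>))"
        using add.hyps by (intro nn_integral_add km[OF elim(3)]) auto
      then show ?case using elim by simp
    qed
  next
    case (seq U)
    have Uinc: "incseq U" and Um: "\<And>i. U i \<in> borel_measurable MY"
      using seq by auto
    have "AE \<omega> in M. (SUP i. ?E (\<lambda>\<omega>. U i (Y \<omega>)) \<omega>) = ?E (\<lambda>\<omega>. SUP i. U i (Y \<omega>)) \<omega>"
      using seq by (intro nn_cond_exp_SUP[OF X] mf) (auto simp: incseq_def le_fun_def)
    moreover have "AE \<omega> in M. \<forall>i. ?E (\<lambda>\<omega>. U i (Y \<omega>)) \<omega> = (\<integral>\<^sup>+y. U i y \<partial>\<kappa> (X \<omega>))"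
      using seq by (simp add: AE_all_countable)
    ultimately show ?case
      using \<kappa>
    proof eventually_elim
      case (elim \<omega>)
      have "(\<integral>\<^sup>+y. (SUP i. U i y) \<partial>\<kappa> (X \<omega>)) = (SUP i. \<integral>\<^sup>+y. U i y \<partial>\<kappa> (X \<omega>))"
        by (rule nn_integral_monotone_convergence_SUP[OF Uinc km[OF elim(3) Um]])
      moreover have "(SUP i. \<integral>\<^sup>+y. U i y \<partial>\<kappa> (X \<omega>)) = (SUP i. ?E (\<lambda>\<omega>. U i (Y \<omega>)) \<omega>)"
        using elim(2) by simp
      ultimately show ?case using elim(1) by (simp only: SUP_apply)
    qed
  qed
qed

text \<open>The disintegration formula, for products of a function of X and a function of Y. Joint
  functionals are brought to this form below.\<close>

lemma cond_law_nn_integral: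
  assumes cl: "cond_law M MX X MY Y \<kappa>" and f: "f \<in> borel_measurable MY" and h: "h \<in> borel_measurable MX"
  shows "(\<integral>\<^sup>+\<omega>. h (X \<omega>) * f (Y \<omega>) \<partial>M) = (\<integral>\<^sup>+\<omega>. h (X \<omega>) * (\<integral>\<^sup>+y. f y \<partial>\<kappa> (X \<omega>)) \<partial>M)"
proof -
  note X = cond_lawD(1)[OF cl] and Y = cond_lawD(2)[OF cl]
  interpret F: finite_measure_subalgebra M "cond_algebra X MX"
    by (rule finite_measure_subalgebra_vimage[OF X])
  have "(\<integral>\<^sup>+\<omega>. h (X \<omega>) * f (Y \<omega>) \<partial>M) = (\<integral>\<^sup>+\<omega>. h (X \<omega>) * nn_cond_exp M (cond_algebra X MX) (\<lambda>\<omega>. f (Y \<omega>)) \<omega> \<partial>M)"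
    by (rule F.nn_cond_exp_intg[symmetric]) (auto intro: measurable_cond_algebra[OF X h] measurable_compose[OF Y f])
  also have "\<dots> = (\<integral>\<^sup>+\<omega>. h (X \<omega>) * (\<integral>\<^sup>+y. f y \<partial>\<kappa> (X \<omega>)) \<partial>M)"
    using cond_law_nn_cond_exp[OF cl f] by (intro nn_integral_cong_AE) auto
  finally show ?thesis .
qed

lemma cond_law_AE:
  assumes cl: "cond_law M MX X MY Y \<kappa>" and B: "{y\<in>space MY. P y} \<in> sets MY"
    and ae: "AE \<omega> in M. AE y in \<kappa> (X \<omega>). P y"
  shows "AE \<omega> in M. P (Y \<omega>)"
proof -
  let ?f = "indicator {y\<in>space MY. \<not> P y} :: 'c \<Rightarrow> ennreal"
  note Y = cond_lawD(2)[OF cl] and \<kappa> = cond_lawD(3)[OF cl]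
  have "{y\<in>space MY. \<not> P y} = space MY - {y\<in>space MY. P y}" by auto
  then have B': "{y\<in>space MY. \<not> P y} \<in> sets MY" using B by simp
  then have f: "?f \<in> borel_measurable MY" by simp
  have "(\<integral>\<^sup>+\<omega>. 1 * ?f (Y \<omega>) \<partial>M) = (\<integral>\<^sup>+\<omega>. 1 * (\<integral>\<^sup>+y. ?f y \<partial>\<kappa> (X \<omega>)) \<partial>M)"
    using cond_law_nn_integral[OF cl f, of "\<lambda>_. 1"] by simp
  also have "\<dots> = (\<integral>\<^sup>+\<omega>. 0 \<partial>M)"
  proof (rule nn_integral_cong_AE, use ae \<kappa> in eventually_elim)
    case (elim \<omega>)
    have "(\<integral>\<^sup>+y. ?f y \<partial>\<kappa> (X \<omega>)) = (\<integral>\<^sup>+y. 0 \<partial>\<kappa> (X \<omega>))"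
      using elim(1) by (intro nn_integral_cong_AE) (auto elim!: eventually_mono)
    then show ?case by simp
  qed
  finally have "(\<integral>\<^sup>+\<omega>. ?f (Y \<omega>) \<partial>M) = 0" by simp
  then have "AE \<omega> in M. ?f (Y \<omega>) = 0"
    by (subst (asm) nn_integral_0_iff_AE) (auto intro: measurable_compose[OF Y f])
  then show ?thesis
    by (rule AE_mp[OF _ AE_I2]) (use measurable_space[OF Y] in \<open>auto simp: indicator_def\<close>)
qed

lemma cond_lawI:
  assumes X: "X \<in> M \<rightarrow>\<^sub>M MX" and Y: "Y \<in> M \<rightarrow>\<^sub>M MY" and \<kappa>: "AE \<omega> in M. \<kappa> (X \<omega>) \<in> space (prob_algebra MY)"
    and eq: "\<And>B. B \<in> sets MY \<Longrightarrow> AE \<omega> in M. nn_cond_exp M (cond_algebra X MX) (\<lambda>\<omega>. indicator B (Y \<omega>)) \<omega> = emeasure (\<kappa> (X \<omega>)) B"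
  shows "cond_law M MX X MY Y \<kappa>"
  unfolding cond_law_def
proof (intro conjI ballI X Y \<kappa>)
  fix B assume B: "B \<in> sets MY"
  interpret F: finite_measure_subalgebra M "cond_algebra X MX"
    by (rule finite_measure_subalgebra_vimage[OF X])
  have m: "Y -` B \<inter> space M \<in> sets M" using measurable_sets[OF Y B] .
  have "AE \<omega> in M. nn_cond_exp M (cond_algebra X MX) (\<lambda>\<omega>. indicator B (Y \<omega>)) \<omega> = nn_cond_exp M (cond_algebra X MX) (indicator (Y -` B \<inter> space M)) \<omega>"
    using m B by (intro F.nn_cond_exp_cong) (auto intro!: AE_I2 measurable_compose[OF Y] simp: indicator_def)
  moreover have "AE \<omega> in M. 0 \<le> real_cond_exp M (cond_algebra X MX) (indicator (Y -` B \<inter> space M)) \<omega>"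
    by (rule F.real_cond_exp_pos) (use m in auto)
  ultimately show "AE \<omega> in M. real_cond_exp M (cond_algebra X MX) (indicator (Y -` B \<inter> space M)) \<omega> = measure (\<kappa> (X \<omega>)) B"
    using real_cond_exp_indicator[OF X m] eq[OF B] \<kappa>
  proof eventually_elim
    case (elim \<omega>)
    then interpret K: prob_space "\<kappa> (X \<omega>)" by (simp add: space_prob_algebra)
    show ?case using elim by (simp add: K.emeasure_eq_measure)
  qed
qed

end


section \<open>The Beta integrals behind the prediction rule\<close>

text \<open>The probabilities of all patterns add up to 1: expand the n-fold product of r + (1 - r)
  over the choices of factors.\<close>

lemma sum_Pow_binomial:
  fixes r :: "'a :: comm_ring_1"
  shows "(\<Sum>Z\<in>Pow {..<n}. r ^ card Z * (1 - r) ^ (n - card Z)) = 1"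
proof -
  have "(\<Sum>Z\<in>Pow {..<n}. r ^ card Z * (1 - r) ^ (n - card Z)) = (\<Sum>Z\<in>Pow {..<n}. (\<Prod>i\<in>Z. r) * (\<Prod>i\<in>{..<n} - Z. 1 - r))"
  proof (rule sum.cong)
    fix Z assume "Z \<in> Pow {..<n}"
    then have "card ({..<n} - Z) = n - card Z"
      by (subst card_Diff_subset) (auto intro: finite_subset)
    then show "r ^ card Z * (1 - r) ^ (n - card Z) = (\<Prod>i\<in>Z. r) * (\<Prod>i\<in>{..<n} - Z. 1 - r)"
      by simp
  qed simp
  also have "\<dots> = (\<Prod>i<n. r + (1 - r))"
    by (subst prod_add) auto
  finally show ?thesis by simp
qed

lemma ennreal_thin_weight:
  assumes "0 \<le> r" "r \<le> 1"
  shows "ennreal r ^ j * (1 - ennreal r) ^ k = ennreal (r ^ j * (1 - r) ^ k)"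
proof -
  have "1 - ennreal r = ennreal (1 - r)" using assms ennreal_minus[of r 1] by simp
  then show ?thesis using assms by (simp add: ennreal_power ennreal_mult)
qed

section \<open>Avoidance as an infinite penalty\<close>

context separated_prob_space
begin

lemma thin_le_1:
  assumes "0 \<le> r" "r \<le> 1"
  shows "thin n l (ennreal r) x \<le> 1"
proof -
  have "thin n l (ennreal r) x \<le> (\<Sum>Z\<in>Pow {..<n}. ennreal (r ^ card Z * (1 - r) ^ (n - card Z)) * 1)"
    unfolding thin_def ennreal_thin_weight[OF assms] by (intro sum_mono mult_left_mono) auto
  also have "\<dots> = ennreal (\<Sum>Z\<in>Pow {..<n}. r ^ card Z * (1 - r) ^ (n - card Z))"
    using assms by (simp add: sum_ennreal)
  finally show ?thesis by (simp add: sum_Pow_binomial)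
qed

text \<open>An infinite price for a mark in sample i at a location in \<open>A i\<close>. Summed
  over the observed atoms and put into \<open>nexp\<close>, it is the indicator of the avoidance
  event.\<close>

definition void_penalty :: "(nat \<Rightarrow> 'u set) \<Rightarrow> nat set \<Rightarrow> 'u \<Rightarrow> ennreal" where
  "void_penalty A Z x = (if \<exists>i\<in>Z. x \<in> A i then \<top> else 0)"

lemma measurable_void_penalty:
  assumes "Z \<subseteq> {..<n}" "\<And>i. i < n \<Longrightarrow> A i \<in> sets G"
  shows "void_penalty A Z \<in> borel_measurable G"
proof -
  have "finite Z" using assms(1) by (rule finite_subset) simp
  moreover have "\<And>i. i \<in> Z \<Longrightarrow> Measurable.pred G (\<lambda>x. x \<in> A i)" using assms by auto
  ultimately have [measurable]: "Measurable.pred G (\<lambda>x. \<exists>i\<in>Z. x \<in> A i)"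
    by (rule pred_intros_finite)
  show ?thesis unfolding void_penalty_def[abs_def] by measurable
qed

lemma void_penalty_empty [simp]: "void_penalty A {} x = 0"
  by (simp add: void_penalty_def)

lemma nexp_obs_sum_void:
  assumes \<pi>: "\<And>i. i < n \<Longrightarrow> \<pi> i \<in> simple_pts" and A: "\<And>i. i < n \<Longrightarrow> A i \<in> sets G"
  shows "nexp (obs_sum n (void_penalty A) \<pi>) = (if \<forall>i<n. emeasure (\<pi> i) (A i) = 0 then 1 else 0)"
proof -
  have e0: "emeasure (\<pi> i) (A i) = 0 \<longleftrightarrow> (\<forall>x\<in>atoms (\<pi> i). x \<notin> A i)" if "i < n" for i
    using emeasure_simple[OF \<pi>[OF that] A[OF that]] finite_atoms_simple[OF \<pi>[OF that]] by auto
  have os: "obs_sum n (void_penalty A) \<pi> = (\<Sum>x\<in>observed n \<pi>. void_penalty A (zset n \<pi> x) x)"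
    by (rule obs_sum_eq[OF \<pi>]) (auto intro!: measurable_void_penalty[of _ n] A)
  show ?thesis
  proof (cases "\<forall>i<n. emeasure (\<pi> i) (A i) = 0")
    case True
    then have "obs_sum n (void_penalty A) \<pi> = 0"
      unfolding os using e0 by (intro sum.neutral) (auto simp: void_penalty_def zset_def)
    then show ?thesis using True by simp
  next
    case False
    then obtain i x where i: "i < n" "x \<in> atoms (\<pi> i)" "x \<in> A i" using e0 by auto
    then have "void_penalty A (zset n \<pi> x) x = \<top>" by (auto simp: void_penalty_def zset_def)
    moreover have "x \<in> observed n \<pi>" using i by (auto simp: observed_def)
    ultimately have "obs_sum n (void_penalty A) \<pi> = \<top>"
      unfolding os using finite_observed[of n \<pi>, OF \<pi>] by (subst sum.remove[of _ x]) auto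
    then show ?thesis using False by simp
  qed
qed

lemma obs_sum_cong: "(\<And>i. i < n \<Longrightarrow> \<pi> i = \<pi>' i) \<Longrightarrow> obs_sum n l \<pi> = obs_sum n l \<pi>'"
proof -
  assume eq: "\<And>i. i < n \<Longrightarrow> \<pi> i = \<pi>' i"
  have "Min Z < n" if "Z \<in> Pow {..<n} - {{}}" for Z
  proof -
    have "Min Z \<in> Z" using that by (intro Min_in) (auto intro: finite_subset)
    then show ?thesis using that by auto
  qed
  then show ?thesis
    unfolding obs_sum_def using eq by (intro sum.cong) (auto intro!: nn_integral_cong)
qed

lemma obs_sum_add:
  assumes \<pi>: "\<And>i. i < n \<Longrightarrow> \<pi> i \<in> simple_pts"
    and l: "\<And>Z. Z \<subseteq> {..<n} \<Longrightarrow> l Z \<in> borel_measurable G" "\<And>Z. Z \<subseteq> {..<n} \<Longrightarrow> l' Z \<in> borel_measurable G"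
  shows "obs_sum n (\<lambda>Z x. l Z x + l' Z x) \<pi> = obs_sum n l \<pi> + obs_sum n l' \<pi>"
proof -
  have "obs_sum n (\<lambda>Z x. l Z x + l' Z x) \<pi> = (\<Sum>x\<in>observed n \<pi>. l (zset n \<pi> x) x + l' (zset n \<pi> x) x)"
    by (rule obs_sum_eq[OF \<pi>]) (use l in auto)
  then show ?thesis using obs_sum_eq[OF \<pi> l(1)] obs_sum_eq[OF \<pi> l(2)] by (simp add: sum.distrib)
qed

end

lemma sigma_finite_stable_levy: "sigma_finite_measure (stable_levy \<alpha>)"
  unfolding stable_levy_def
  by (subst sigma_finite_measure.sigma_finite_iff_density_finite[OF lborel.sigma_finite_measure_axioms])
     (auto simp: ennreal_mult_eq_top_iff indicator_def intro!: AE_I2)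

lemma AE_stable_levy: "AE s in stable_levy \<alpha>. 0 < s \<and> s \<le> 1"
  unfolding stable_levy_def by (subst AE_density) (auto simp: indicator_def intro!: AE_I2)

section \<open>Exponents of the sample and of the prediction\<close>

context stable_crm
begin

text \<open>The exponent of the sample's Laplace functional for a = 1. The location is the outer
  variable, so that exponents can be compared location by location.\<close>

definition rate :: "nat \<Rightarrow> (nat set \<Rightarrow> 'u \<Rightarrow> ennreal) \<Rightarrow> ennreal" where
  "rate n l = (\<integral>\<^sup>+x. \<integral>\<^sup>+s. 1 - thin n l (ennreal s) x \<partial>stable_levy \<alpha> \<partial>G)"

lemma measurable_thin_weight [measurable]:
  assumes l: "\<And>Z. Z \<subseteq> {..<n} \<Longrightarrow> l Z \<in> borel_measurable G"
    and [measurable]: "h \<in> borel_measurable N" "g \<in> N \<rightarrow>\<^sub>M G"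
  shows "(\<lambda>y. thin n l (h y) (g y)) \<in> borel_measurable N"
  using measurable_compose[OF measurable_Pair[OF assms(2,3)] measurable_thin[of n l, OF l]] by simp

text \<open>The Laplace functional of the random measure, applied to the exponent that is left after
  averaging the coins; Fubini then moves the location outside.\<close>

lemma crm_law_thin:
  assumes L: "crm_law (levy a) G L" and a: "0 < a"
    and l: "\<And>Z. Z \<subseteq> {..<n} \<Longrightarrow> l Z \<in> borel_measurable G"
  shows "(\<integral>\<^sup>+m. nexp (atom_sum (\<lambda>w x. nlog (thin n l w x)) m) \<partial>L) = nexp (ennreal (a powr (- \<alpha>)) * rate n l)"
proof -
  interpret sl: sigma_finite_measure "stable_levy \<alpha>" by (rule sigma_finite_stable_levy)
  interpret pair_sigma_finite "stable_levy \<alpha>" G ..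
  have f: "(\<lambda>(w, x). nlog (thin n l w x)) \<in> borel_measurable (borel \<Otimes>\<^sub>M G)"
    using measurable_compose[OF measurable_thin[of n l, OF l] nlog_measurable] by (simp add: split_def)
  have tm: "(\<lambda>x. thin n l (ennreal s) x) \<in> borel_measurable G" for s
    by (rule measurable_thin_weight[OF l]) auto
  have "(\<integral>\<^sup>+s. 1 - (\<integral>\<^sup>+x. nexp (nlog (thin n l (ennreal s) x)) \<partial>G) \<partial>stable_levy \<alpha>)
      = (\<integral>\<^sup>+s. \<integral>\<^sup>+x. 1 - thin n l (ennreal s) x \<partial>G \<partial>stable_levy \<alpha>)"
    using AE_stable_levy
  proof (intro nn_integral_cong_AE, eventually_elim)
    case (elim s)
    then have le: "thin n l (ennreal s) x \<le> 1" for x by (intro thin_le_1) auto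
    then have fin: "(\<integral>\<^sup>+x. thin n l (ennreal s) x \<partial>G) \<le> 1"
      using nn_integral_mono[of G "\<lambda>x. thin n l (ennreal s) x" "\<lambda>_. 1"] by (simp add: emeasure_space_1)
    have "(\<integral>\<^sup>+x. 1 - thin n l (ennreal s) x \<partial>G) = (\<integral>\<^sup>+x. 1 \<partial>G) - (\<integral>\<^sup>+x. thin n l (ennreal s) x \<partial>G)"
      using fin le tm by (intro nn_integral_diff) (auto simp: top_unique)
    then show ?case using le by (simp add: nexp_nlog emeasure_space_1)
  qed
  also have "\<dots> = rate n l"
    unfolding rate_def
  proof (rule Fubini'[symmetric])
    have "(\<lambda>y. thin n l (ennreal (fst y)) (snd y)) \<in> borel_measurable (stable_levy \<alpha> \<Otimes>\<^sub>M G)"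
      by (rule measurable_thin_weight[OF l]) auto
    then show "(\<lambda>(s, x). 1 - thin n l (ennreal s) x) \<in> borel_measurable (stable_levy \<alpha> \<Otimes>\<^sub>M G)"
      by (simp add: split_def)
  qed
  finally show ?thesis by (simp add: crm_law_laplace[OF L a f])
qed

text \<open>The mean of the Beta law with parameters j - \<alpha> and n - j + 1.\<close>

definition reobs :: "nat \<Rightarrow> nat \<Rightarrow> real" where
  "reobs n j = (real j - \<alpha>) / (real n + 1 - \<alpha>)"

lemma reobs_bounds:
  assumes "1 \<le> j" "j \<le> n" shows "0 \<le> reobs n j" "reobs n j \<le> 1"
  using assms \<alpha> by (auto simp: reobs_def field_simps)

text \<open>The recurrence of the Beta function in its first argument, whose two parameters here add
  up to n + 1 - \<alpha>.\<close>

lemma reobs_Beta: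
  assumes "1 \<le> j" "j \<le> n"
  shows "reobs n j * Beta (real j - \<alpha>) (real (n - j) + 1) = Beta (real (Suc j) - \<alpha>) (real (n - j) + 1)"
proof -
  have "real j - \<alpha> \<notin> \<int>\<^sub>\<le>\<^sub>0" using assms \<alpha> by (intro notI) (auto dest: nonpos_Ints_nonpos)
  from Beta_plus1_left[OF this, of "real (n - j) + 1"]
  have "(real n + 1 - \<alpha>) * Beta (real (Suc j) - \<alpha>) (real (n - j) + 1) = (real j - \<alpha>) * Beta (real j - \<alpha>) (real (n - j) + 1)"
    using assms by (simp add: of_nat_diff algebra_simps)
  moreover have "real n + 1 - \<alpha> > 0" using \<alpha> by simp
  ultimately show ?thesis by (simp add: reobs_def field_simps)
qed

text \<open>Its exponential is the probability that an already seen atom of B is missed by the next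
  sample. Unseen atoms carry no penalty; they are accounted for by \<open>new_rate\<close>.\<close>

definition reobs_penalty :: "nat \<Rightarrow> 'u set \<Rightarrow> nat set \<Rightarrow> 'u \<Rightarrow> ennreal" where
  "reobs_penalty n B Z x = (if Z \<noteq> {} \<and> x \<in> B then nlog (ennreal (1 - reobs n (card Z))) else 0)"

lemma measurable_reobs_penalty [measurable]:
  assumes [measurable]: "B \<in> sets G"
  shows "reobs_penalty n B Z \<in> borel_measurable G"
  unfolding reobs_penalty_def[abs_def] by measurable

lemma nexp_reobs_penalty:
  assumes "Z \<subseteq> {..<n}"
  shows "nexp (reobs_penalty n B Z x) = (if Z \<noteq> {} \<and> x \<in> B then ennreal (1 - reobs n (card Z)) else 1)"
proof (cases "Z = {}")
  case False
  have "finite Z" using assms by (rule finite_subset) simp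
  then have "1 \<le> card Z" "card Z \<le> n"
    using False assms card_mono[of "{..<n}" Z] by (auto simp: Suc_le_eq card_gt_0_iff)
  then show ?thesis
    using reobs_bounds[of "card Z" n] by (auto simp: reobs_penalty_def nexp_nlog ennreal_le_1)
qed (simp add: reobs_penalty_def)

text \<open>The integral of s (1 - s)^n against \<open>stable_levy \<alpha>\<close>: the intensity
  of atoms missed n times and seen in the next sample.\<close>

definition new_rate :: "nat \<Rightarrow> real" where
  "new_rate n = \<alpha> * Beta (1 - \<alpha>) (real n + 1)"

text \<open>The core identity: an atom seen in \<open>Z\<close> reappears with probability \<open>reobs n (card Z)\<close>, which
  is the quotient of two Beta integrals, so the extra factor \<open>s\<close> in the intensity can be traded
  against \<open>reobs\<close>; only the pattern \<open>Z = {}\<close> has no such counterpart and leaves \<open>new_rate n\<close>.\<close>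

lemma rate_Suc_pointwise:
  assumes x: "x \<in> space G"
  shows "(\<integral>\<^sup>+s. 1 - thin (Suc n) (void_penalty (A(n := B))) (ennreal s) x \<partial>stable_levy \<alpha>)
    = (\<integral>\<^sup>+s. 1 - thin n (\<lambda>Z x. void_penalty A Z x + reobs_penalty n B Z x) (ennreal s) x \<partial>stable_levy \<alpha>)
      + ennreal (new_rate n) * indicator B x"
proof -
  let ?P = "Pow {..<n}"
  define v :: "nat set \<Rightarrow> real" where "v Z = (if \<exists>i\<in>Z. x \<in> A i then 0 else 1)" for Z
  \<comment> \<open>Probability that an atom of weight s at x shows pattern Z, counted only if the
    pattern respects the avoidance sets of the first n samples.\<close>
  define b where "b Z s = v Z * (s ^ card Z * (1 - s) ^ (n - card Z))" for Z and s :: real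
  have v01: "0 \<le> v Z" "v Z \<le> 1" for Z by (auto simp: v_def)
  have v_empty: "v {} = 1" by (simp add: v_def)
  have ev: "nexp (void_penalty A Z x) = ennreal (v Z)" for Z
    by (simp add: void_penalty_def v_def)
  have finZ: "finite Z" "card Z \<le> n" if "Z \<in> ?P" for Z
    using that finite_subset[of Z "{..<n}"] card_mono[of "{..<n}" Z] by auto
  have b0: "0 \<le> b Z s" if "0 < s \<and> s \<le> 1" for Z s
    using that v01 by (auto simp: b_def intro!: mult_nonneg_nonneg)
  have sb: "(\<Sum>Z\<in>?P. b Z s) \<le> 1" if "0 < s \<and> s \<le> 1" for s
  proof -
    have "(\<Sum>Z\<in>?P. b Z s) \<le> (\<Sum>Z\<in>?P. s ^ card Z * (1 - s) ^ (n - card Z))"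
      unfolding b_def using that v01 by (intro sum_mono mult_left_le_one_le) auto
    then show ?thesis by (simp add: sum_Pow_binomial)
  qed
  have bm [measurable]: "b Z \<in> borel_measurable borel" for Z
    unfolding b_def[abs_def] by measurable
  \<comment> \<open>The part common to both sides. Splitting it off keeps the identity additive, so
    no possibly infinite quantity is subtracted.\<close>
  define T where "T = (\<integral>\<^sup>+s. ennreal (1 - (\<Sum>Z\<in>?P. b Z s)) \<partial>stable_levy \<alpha>)"
  have Is: "(\<integral>\<^sup>+s. ennreal (b Z s * s) \<partial>stable_levy \<alpha>) = ennreal (v Z * (\<alpha> * Beta (real (Suc (card Z)) - \<alpha>) (real (n - card Z) + 1)))" for Z
  proof -
    have "(\<integral>\<^sup>+s. ennreal (b Z s * s) \<partial>stable_levy \<alpha>) = (\<integral>\<^sup>+s. ennreal (v Z) * ennreal (s ^ Suc (card Z) * (1 - s) ^ (n - card Z)) \<partial>stable_levy \<alpha>)"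
      by (intro nn_integral_cong) (simp add: b_def ennreal_mult'[symmetric] v01 mult_ac)
    also have "\<dots> = ennreal (v Z) * ennreal (\<alpha> * Beta (real (Suc (card Z)) - \<alpha>) (real (n - card Z) + 1))"
      by (subst nn_integral_cmult) (simp_all only: nn_integral_stable_levy_Beta[OF \<alpha>, of "Suc (card Z)"], auto)
    finally show ?thesis using v01 by (simp add: ennreal_mult')
  qed
  \<comment> \<open>The same value as in \<open>Is\<close>: for a nonempty pattern the factor s may
    be replaced by \<open>reobs n (card Z)\<close> under the integral.\<close>
  have Ip: "(\<integral>\<^sup>+s. ennreal (b Z s * reobs n (card Z)) \<partial>stable_levy \<alpha>) = ennreal (v Z * (\<alpha> * Beta (real (Suc (card Z)) - \<alpha>) (real (n - card Z) + 1)))"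
    if Z: "Z \<in> ?P - {{}}" for Z
  proof -
    have cZ: "1 \<le> card Z" "card Z \<le> n" using finZ[of Z] Z by (auto simp: Suc_le_eq card_gt_0_iff)
    note r = reobs_bounds[OF cZ]
    have "(\<integral>\<^sup>+s. ennreal (b Z s * reobs n (card Z)) \<partial>stable_levy \<alpha>)
        = (\<integral>\<^sup>+s. ennreal (v Z * reobs n (card Z)) * ennreal (s ^ card Z * (1 - s) ^ (n - card Z)) \<partial>stable_levy \<alpha>)"
      by (intro nn_integral_cong) (simp add: b_def ennreal_mult'[symmetric] v01 r mult_ac)
    also have "\<dots> = ennreal (v Z * reobs n (card Z)) * ennreal (\<alpha> * Beta (real (card Z) - \<alpha>) (real (n - card Z) + 1))"
      by (subst nn_integral_cmult) (simp_all only: nn_integral_stable_levy_Beta[OF \<alpha> cZ(1)], auto)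
    also have "\<dots> = ennreal (v Z * (\<alpha> * (reobs n (card Z) * Beta (real (card Z) - \<alpha>) (real (n - card Z) + 1))))"
      using v01 r by (simp add: ennreal_mult'[symmetric] mult_ac)
    finally show ?thesis by (simp add: reobs_Beta[OF cZ])
  qed
  \<comment> \<open>Each pattern weight b is thinned to b (1 - q), where q is the reappearance
    probability in B and vanishes on the empty pattern; the loss b q is what has to match.\<close>
  have tn: "1 - thin n (\<lambda>Z x. void_penalty A Z x + reobs_penalty n B Z x) (ennreal s) x
      = ennreal (1 - (\<Sum>Z\<in>?P. b Z s)) + (\<Sum>Z\<in>?P - {{}}. ennreal (b Z s * reobs n (card Z)) * indicator B x)"
    if s: "0 < s \<and> s \<le> 1" for s
  proof -
    define q :: "nat set \<Rightarrow> real" where "q Z = (if Z \<noteq> {} \<and> x \<in> B then reobs n (card Z) else 0)" for Z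
    have q: "0 \<le> q Z" "q Z \<le> 1" if "Z \<in> ?P" for Z
      using reobs_bounds[of "card Z" n] finZ[OF that] by (auto simp: q_def Suc_le_eq card_gt_0_iff)
    have "thin n (\<lambda>Z x. void_penalty A Z x + reobs_penalty n B Z x) (ennreal s) x = (\<Sum>Z\<in>?P. ennreal (b Z s * (1 - q Z)))"
      unfolding thin_def
    proof (rule sum.cong)
      fix Z assume Z: "Z \<in> ?P"
      then have "nexp (reobs_penalty n B Z x) = ennreal (1 - q Z)"
        by (subst nexp_reobs_penalty) (auto simp: q_def)
      then show "ennreal s ^ card Z * (1 - ennreal s) ^ (n - card Z) * nexp (void_penalty A Z x + reobs_penalty n B Z x) = ennreal (b Z s * (1 - q Z))"
        using s q[OF Z] v01 by (simp add: nexp_add ev ennreal_thin_weight b_def ennreal_mult'[symmetric] ennreal_mult''[symmetric] mult_ac)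
    qed simp
    also have "\<dots> = ennreal (\<Sum>Z\<in>?P. b Z s * (1 - q Z))"
      using b0[OF s] q by (intro sum_ennreal) (auto intro!: mult_nonneg_nonneg)
    finally have e: "thin n (\<lambda>Z x. void_penalty A Z x + reobs_penalty n B Z x) (ennreal s) x = ennreal (\<Sum>Z\<in>?P. b Z s * (1 - q Z))" .
    have "0 \<le> (\<Sum>Z\<in>?P. b Z s * (1 - q Z))"
      using b0[OF s] q by (intro sum_nonneg mult_nonneg_nonneg) auto
    from ennreal_minus[OF this, of 1]
    have "1 - thin n (\<lambda>Z x. void_penalty A Z x + reobs_penalty n B Z x) (ennreal s) x = ennreal (1 - (\<Sum>Z\<in>?P. b Z s * (1 - q Z)))"
      unfolding e by simp
    also have "1 - (\<Sum>Z\<in>?P. b Z s * (1 - q Z)) = (1 - (\<Sum>Z\<in>?P. b Z s)) + (\<Sum>Z\<in>?P. b Z s * q Z)"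
      by (simp add: algebra_simps sum_subtractf)
    also have "(\<Sum>Z\<in>?P. b Z s * q Z) = (\<Sum>Z\<in>?P - {{}}. b Z s * reobs n (card Z) * indicator B x)"
      by (rule sum.mono_neutral_cong_right) (auto simp: q_def)
    also have "ennreal ((1 - (\<Sum>Z\<in>?P. b Z s)) + (\<Sum>Z\<in>?P - {{}}. b Z s * reobs n (card Z) * indicator B x))
        = ennreal (1 - (\<Sum>Z\<in>?P. b Z s)) + ennreal (\<Sum>Z\<in>?P - {{}}. b Z s * reobs n (card Z) * indicator B x)"
      using sb[OF s] b0[OF s] reobs_bounds(1) finZ
      by (intro ennreal_plus sum_nonneg mult_nonneg_nonneg) (auto simp: Suc_le_eq card_gt_0_iff)
    also have "ennreal (\<Sum>Z\<in>?P - {{}}. b Z s * reobs n (card Z) * indicator B x) = (\<Sum>Z\<in>?P - {{}}. ennreal (b Z s * reobs n (card Z)) * indicator B x)"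
      using b0[OF s] reobs_bounds(1) finZ
      by (subst sum_ennreal[symmetric]) (auto simp: indicator_def Suc_le_eq card_gt_0_iff intro!: mult_nonneg_nonneg)
    finally show ?thesis .
  qed
  \<comment> \<open>Patterns of n + 1 samples split by whether they contain n. Without n the last
    coin contributes 1 - s; with n it contributes s, and only when x is outside B.\<close>
  have ts: "1 - thin (Suc n) (void_penalty (A(n := B))) (ennreal s) x
      = ennreal (1 - (\<Sum>Z\<in>?P. b Z s)) + (\<Sum>Z\<in>?P. ennreal (b Z s * s) * indicator B x)"
    if s: "0 < s \<and> s \<le> 1" for s
  proof -
    define g where "g Z = ennreal s ^ card Z * (1 - ennreal s) ^ (Suc n - card Z) * nexp (void_penalty (A(n := B)) Z x)" for Z
    have inj: "inj_on (insert n) ?P" by (auto simp: inj_on_def)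
    have disj: "?P \<inter> insert n ` ?P = {}" by auto
    have "thin (Suc n) (void_penalty (A(n := B))) (ennreal s) x = (\<Sum>Z\<in>?P. g Z) + (\<Sum>Z\<in>?P. g (insert n Z))"
      unfolding thin_def g_def[symmetric] lessThan_Suc Pow_insert
      by (subst sum.union_disjoint) (use disj inj in \<open>auto simp: sum.reindex\<close>)
    also have "(\<Sum>Z\<in>?P. g Z) = (\<Sum>Z\<in>?P. ennreal (b Z s * (1 - s)))"
    proof (rule sum.cong)
      fix Z assume Z: "Z \<in> ?P"
      then have "void_penalty (A(n := B)) Z x = void_penalty A Z x"
        by (auto simp: void_penalty_def)
      moreover have "Suc n - card Z = Suc (n - card Z)" using finZ[OF Z] by simp
      ultimately show "g Z = ennreal (b Z s * (1 - s))"
        using s v01 by (simp add: g_def ev ennreal_thin_weight b_def ennreal_mult'[symmetric] ennreal_mult''[symmetric] mult_ac del: power_Suc) (simp add: mult_ac)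
    qed simp
    also have "(\<Sum>Z\<in>?P. g (insert n Z)) = (\<Sum>Z\<in>?P. ennreal (b Z s * s * (1 - indicator B x)))"
    proof (rule sum.cong)
      fix Z assume Z: "Z \<in> ?P"
      have "nexp (void_penalty (A(n := B)) (insert n Z) x) = ennreal (v Z * (1 - indicator B x))"
        using Z by (auto simp: void_penalty_def v_def indicator_def)
      moreover have "n \<notin> Z" using Z by auto
      then have "card (insert n Z) = Suc (card Z)" "Suc n - Suc (card Z) = n - card Z"
        using finZ[OF Z] Z by (auto simp: card_insert_disjoint)
      ultimately show "g (insert n Z) = ennreal (b Z s * s * (1 - indicator B x))"
        using s v01 by (simp add: g_def ennreal_thin_weight b_def ennreal_mult'[symmetric] ennreal_mult''[symmetric] mult_ac del: power_Suc) (simp add: mult_ac)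
    qed simp
    also have "(\<Sum>Z\<in>?P. ennreal (b Z s * (1 - s))) + (\<Sum>Z\<in>?P. ennreal (b Z s * s * (1 - indicator B x)))
        = ennreal ((\<Sum>Z\<in>?P. b Z s * (1 - s)) + (\<Sum>Z\<in>?P. b Z s * s * (1 - indicator B x)))"
      using s b0[OF s] by (subst (1 2) sum_ennreal) (auto intro!: ennreal_plus[symmetric] sum_nonneg mult_nonneg_nonneg simp: indicator_def)
    finally have "1 - thin (Suc n) (void_penalty (A(n := B))) (ennreal s) x
        = ennreal (1 - ((\<Sum>Z\<in>?P. b Z s * (1 - s)) + (\<Sum>Z\<in>?P. b Z s * s * (1 - indicator B x))))"
    proof -
      assume e: "thin (Suc n) (void_penalty (A(n := B))) (ennreal s) x = ennreal ((\<Sum>Z\<in>?P. b Z s * (1 - s)) + (\<Sum>Z\<in>?P. b Z s * s * (1 - indicator B x)))"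
      have "0 \<le> (\<Sum>Z\<in>?P. b Z s * (1 - s)) + (\<Sum>Z\<in>?P. b Z s * s * (1 - indicator B x))"
        using s b0[OF s] by (intro add_nonneg_nonneg sum_nonneg mult_nonneg_nonneg) (auto simp: indicator_def)
      from ennreal_minus[OF this, of 1] show ?thesis unfolding e by simp
    qed
    also have "1 - ((\<Sum>Z\<in>?P. b Z s * (1 - s)) + (\<Sum>Z\<in>?P. b Z s * s * (1 - indicator B x)))
        = (1 - (\<Sum>Z\<in>?P. b Z s)) + (\<Sum>Z\<in>?P. b Z s * s * indicator B x)"
      by (simp add: algebra_simps sum_subtractf sum.distrib)
    also have "ennreal \<dots> = ennreal (1 - (\<Sum>Z\<in>?P. b Z s)) + ennreal (\<Sum>Z\<in>?P. b Z s * s * indicator B x)"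
      using sb[OF s] b0[OF s] s by (intro ennreal_plus sum_nonneg mult_nonneg_nonneg) auto
    also have "ennreal (\<Sum>Z\<in>?P. b Z s * s * indicator B x) = (\<Sum>Z\<in>?P. ennreal (b Z s * s) * indicator B x)"
      using b0[OF s] s by (subst sum_ennreal[symmetric]) (auto simp: indicator_def intro!: mult_nonneg_nonneg)
    finally show ?thesis .
  qed
  have add_sum: "(\<integral>\<^sup>+s. ennreal (1 - (\<Sum>Z\<in>?P. b Z s)) + (\<Sum>Z\<in>S. u Z s * indicator B x) \<partial>stable_levy \<alpha>)
      = T + (\<Sum>Z\<in>S. \<integral>\<^sup>+s. u Z s * indicator B x \<partial>stable_levy \<alpha>)"
    if u [measurable]: "\<And>Z. u Z \<in> borel_measurable borel" for S and u :: "nat set \<Rightarrow> real \<Rightarrow> ennreal"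
  proof -
    have "(\<integral>\<^sup>+s. ennreal (1 - (\<Sum>Z\<in>?P. b Z s)) + (\<Sum>Z\<in>S. u Z s * indicator B x) \<partial>stable_levy \<alpha>)
        = T + (\<integral>\<^sup>+s. (\<Sum>Z\<in>S. u Z s * indicator B x) \<partial>stable_levy \<alpha>)"
      unfolding T_def by (rule nn_integral_add) measurable
    also have "(\<integral>\<^sup>+s. (\<Sum>Z\<in>S. u Z s * indicator B x) \<partial>stable_levy \<alpha>) = (\<Sum>Z\<in>S. \<integral>\<^sup>+s. u Z s * indicator B x \<partial>stable_levy \<alpha>)"
      by (rule nn_integral_sum) measurable
    finally show ?thesis .
  qed
  have "(\<integral>\<^sup>+s. 1 - thin (Suc n) (void_penalty (A(n := B))) (ennreal s) x \<partial>stable_levy \<alpha>)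
      = (\<integral>\<^sup>+s. ennreal (1 - (\<Sum>Z\<in>?P. b Z s)) + (\<Sum>Z\<in>?P. ennreal (b Z s * s) * indicator B x) \<partial>stable_levy \<alpha>)"
    using AE_stable_levy by (intro nn_integral_cong_AE, eventually_elim) (rule ts)
  also have "\<dots> = T + (\<Sum>Z\<in>?P. \<integral>\<^sup>+s. ennreal (b Z s * s) * indicator B x \<partial>stable_levy \<alpha>)"
    by (rule add_sum) measurable
  also have "(\<Sum>Z\<in>?P. \<integral>\<^sup>+s. ennreal (b Z s * s) * indicator B x \<partial>stable_levy \<alpha>)
      = (\<Sum>Z\<in>?P. (\<integral>\<^sup>+s. ennreal (b Z s * s) \<partial>stable_levy \<alpha>) * indicator B x)"
    by (intro sum.cong nn_integral_multc) auto
  also have "\<dots> = (\<integral>\<^sup>+s. ennreal (b {} s * s) \<partial>stable_levy \<alpha>) * indicator B x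
      + (\<Sum>Z\<in>?P - {{}}. (\<integral>\<^sup>+s. ennreal (b Z s * s) \<partial>stable_levy \<alpha>) * indicator B x)"
    by (rule sum.remove) auto
  also have "(\<integral>\<^sup>+s. ennreal (b {} s * s) \<partial>stable_levy \<alpha>) = ennreal (new_rate n)"
    by (simp add: Is v_empty new_rate_def)
  also have "(\<Sum>Z\<in>?P - {{}}. (\<integral>\<^sup>+s. ennreal (b Z s * s) \<partial>stable_levy \<alpha>) * indicator B x)
      = (\<Sum>Z\<in>?P - {{}}. (\<integral>\<^sup>+s. ennreal (b Z s * reobs n (card Z)) \<partial>stable_levy \<alpha>) * indicator B x)"
    by (intro sum.cong) (simp_all only: Is Ip)
  also have "\<dots> = (\<Sum>Z\<in>?P - {{}}. \<integral>\<^sup>+s. ennreal (b Z s * reobs n (card Z)) * indicator B x \<partial>stable_levy \<alpha>)"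
    by (intro sum.cong nn_integral_multc[symmetric]) auto
  also have "T + (ennreal (new_rate n) * indicator B x + (\<Sum>Z\<in>?P - {{}}. \<integral>\<^sup>+s. ennreal (b Z s * reobs n (card Z)) * indicator B x \<partial>stable_levy \<alpha>))
      = (T + (\<Sum>Z\<in>?P - {{}}. \<integral>\<^sup>+s. ennreal (b Z s * reobs n (card Z)) * indicator B x \<partial>stable_levy \<alpha>)) + ennreal (new_rate n) * indicator B x"
    by (simp add: ac_simps)
  also have "T + (\<Sum>Z\<in>?P - {{}}. \<integral>\<^sup>+s. ennreal (b Z s * reobs n (card Z)) * indicator B x \<partial>stable_levy \<alpha>)
      = (\<integral>\<^sup>+s. ennreal (1 - (\<Sum>Z\<in>?P. b Z s)) + (\<Sum>Z\<in>?P - {{}}. ennreal (b Z s * reobs n (card Z)) * indicator B x) \<partial>stable_levy \<alpha>)"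
    by (rule add_sum[symmetric]) measurable
  also have "\<dots> = (\<integral>\<^sup>+s. 1 - thin n (\<lambda>Z x. void_penalty A Z x + reobs_penalty n B Z x) (ennreal s) x \<partial>stable_levy \<alpha>)"
    using AE_stable_levy by (intro nn_integral_cong_AE, eventually_elim) (rule tn[symmetric])
  finally show ?thesis .
qed

lemma rate_Suc:
  assumes A: "\<And>i. i < n \<Longrightarrow> A i \<in> sets G" and B: "B \<in> sets G"
  shows "rate (Suc n) (void_penalty (A(n := B)))
    = rate n (\<lambda>Z x. void_penalty A Z x + reobs_penalty n B Z x) + ennreal (new_rate n) * emeasure G B"
proof -
  interpret sl: sigma_finite_measure "stable_levy \<alpha>" by (rule sigma_finite_stable_levy)
  have l: "(\<lambda>x. void_penalty A Z x + reobs_penalty n B Z x) \<in> borel_measurable G" if "Z \<subseteq> {..<n}" for Z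
    by (intro borel_measurable_add measurable_void_penalty[OF that] measurable_reobs_penalty A B)
  have "(\<lambda>y. thin n (\<lambda>Z x. void_penalty A Z x + reobs_penalty n B Z x) (ennreal (snd y)) (fst y)) \<in> borel_measurable (G \<Otimes>\<^sub>M stable_levy \<alpha>)"
    by (rule measurable_thin_weight[OF l]) auto
  then have m: "(\<lambda>(x, s). 1 - thin n (\<lambda>Z x. void_penalty A Z x + reobs_penalty n B Z x) (ennreal s) x) \<in> borel_measurable (G \<Otimes>\<^sub>M stable_levy \<alpha>)"
    by (simp add: split_def)
  have "rate (Suc n) (void_penalty (A(n := B)))
      = (\<integral>\<^sup>+x. (\<integral>\<^sup>+s. 1 - thin n (\<lambda>Z x. void_penalty A Z x + reobs_penalty n B Z x) (ennreal s) x \<partial>stable_levy \<alpha>)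
        + ennreal (new_rate n) * indicator B x \<partial>G)"
    unfolding rate_def by (intro nn_integral_cong rate_Suc_pointwise)
  also have "\<dots> = rate n (\<lambda>Z x. void_penalty A Z x + reobs_penalty n B Z x) + (\<integral>\<^sup>+x. ennreal (new_rate n) * indicator B x \<partial>G)"
    unfolding rate_def by (rule nn_integral_add) (use B sl.borel_measurable_nn_integral[OF m] in auto)
  finally show ?thesis using B by (simp add: nn_integral_cmult_indicator)
qed

end


section \<open>Avoidance probabilities of the sample\<close>

locale gd_sample = stable_crm G c \<alpha> + M: prob_space M
  for G :: "'u measure" and c \<alpha> and M :: "'a measure" +
  fixes D :: "'a \<Rightarrow> real" and \<xi> :: "'a \<Rightarrow> 'u measure" and X :: "nat \<Rightarrow> 'a \<Rightarrow> 'u measure"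
    and \<kappa> :: "real \<Rightarrow> 'u measure measure"
  assumes D_pos: "AE \<omega> in M. 0 < D \<omega>"
    and \<kappa>: "\<And>a. 0 < a \<Longrightarrow> crm_law (levy a) G (\<kappa> a)"
    and \<xi>_given_D: "cond_law M borel D (measure_algebra G) \<xi> \<kappa>"
    and X_given_\<xi>: "cond_law M (measure_algebra G) \<xi> (PiM UNIV (\<lambda>_. measure_algebra G)) (\<lambda>\<omega> i. X i \<omega>) (\<lambda>m. PiM UNIV (\<lambda>_. BeP m))"
begin

abbreviation "samples n \<equiv> PiM {..<n} (\<lambda>_. measure_algebra G)"

lemma measurable_D [measurable]: "D \<in> borel_measurable M"
  and measurable_\<xi> [measurable]: "\<xi> \<in> M \<rightarrow>\<^sub>M measure_algebra G"
  and measurable_Xs: "(\<lambda>\<omega> i. X i \<omega>) \<in> M \<rightarrow>\<^sub>M PiM UNIV (\<lambda>_. measure_algebra G)"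
  using M.cond_lawD[OF \<xi>_given_D] M.cond_lawD[OF X_given_\<xi>] by auto

lemma measurable_X [measurable]: "X i \<in> M \<rightarrow>\<^sub>M measure_algebra G"
  using measurable_compose[OF measurable_Xs measurable_component_singleton[of i UNIV]] by simp

lemma measurable_sample [measurable]: "sample n X \<in> M \<rightarrow>\<^sub>M samples n"
  unfolding sample_def[abs_def] by (rule measurable_restrict) measurable

text \<open>The sample is only assumed to be conditionally i.i.d. given \<open>\<xi>\<close>; that it may also be
  conditioned on \<open>D\<close> is due to \<open>D\<close> being a function of \<open>\<xi>\<close>.\<close>

lemma AE_recover_scale: "AE \<omega> in M. recover_scale (\<xi> \<omega>) = D \<omega>"
proof -
  \<comment> \<open>Disintegration handles products of a function of D and a function of
    \<open>\<xi>\<close>, so equality of the two variables is tested on rectangles: given D, the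
    recovered scale lies in E only if D does.\<close>
  have imp: "AE \<omega> in M. recover_scale (\<xi> \<omega>) \<in> E \<longrightarrow> D \<omega> \<in> E" if E [measurable]: "E \<in> sets borel" for E
  proof -
    have f: "(\<lambda>m. indicator E (recover_scale m) :: ennreal) \<in> borel_measurable (measure_algebra G)"
      by measurable
    have "(\<integral>\<^sup>+\<omega>. indicator (- E) (D \<omega>) * indicator E (recover_scale (\<xi> \<omega>)) \<partial>M)
        = (\<integral>\<^sup>+\<omega>. indicator (- E) (D \<omega>) * (\<integral>\<^sup>+m. indicator E (recover_scale m) \<partial>\<kappa> (D \<omega>)) \<partial>M)"
      by (rule M.cond_law_nn_integral[OF \<xi>_given_D f]) measurable
    also have "\<dots> = (\<integral>\<^sup>+\<omega>. 0 \<partial>M)"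
    proof (rule nn_integral_cong_AE, use D_pos in eventually_elim)
      case (elim \<omega>)
      have "(\<integral>\<^sup>+m. indicator E (recover_scale m) \<partial>\<kappa> (D \<omega>)) = (\<integral>\<^sup>+m. indicator E (D \<omega>) \<partial>\<kappa> (D \<omega>))"
        using crm_law_recover_scale[OF \<kappa>[OF elim] elim] by (intro nn_integral_cong_AE) (auto elim!: eventually_mono)
      then show ?case by (auto simp: indicator_def)
    qed
    finally have "(\<integral>\<^sup>+\<omega>. indicator (- E) (D \<omega>) * indicator E (recover_scale (\<xi> \<omega>)) \<partial>M) = 0" by simp
    then have "AE \<omega> in M. indicator (- E) (D \<omega>) * indicator E (recover_scale (\<xi> \<omega>)) = (0 :: ennreal)"
      by (subst (asm) nn_integral_0_iff_AE) measurable
    then show ?thesis by eventually_elim (auto simp: indicator_def split: if_splits)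
  qed
  \<comment> \<open>Countably many tests suffice: rational half-lines in both directions separate
    any two distinct reals.\<close>
  have "AE \<omega> in M. \<forall>q :: rat. (recover_scale (\<xi> \<omega>) \<in> {..of_rat q} \<longrightarrow> D \<omega> \<in> {..of_rat q}) \<and> (recover_scale (\<xi> \<omega>) \<in> {of_rat q<..} \<longrightarrow> D \<omega> \<in> {of_rat q<..})"
    by (intro AE_all_countable[THEN iffD2] allI AE_conjI imp) auto
  then show ?thesis
  proof eventually_elim
    case (elim \<omega>)
    show ?case
    proof (rule linorder_cases[of "recover_scale (\<xi> \<omega>)" "D \<omega>"])
      assume "recover_scale (\<xi> \<omega>) < D \<omega>"
      then obtain q where "recover_scale (\<xi> \<omega>) < of_rat q" "of_rat q < D \<omega>" using of_rat_dense by blast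
      then show ?thesis using elim[rule_format, of q] by auto
    next
      assume "D \<omega> < recover_scale (\<xi> \<omega>)"
      then obtain q where "D \<omega> < of_rat q" "of_rat q < recover_scale (\<xi> \<omega>)" using of_rat_dense by blast
      then show ?thesis using elim[rule_format, of q] by auto
    qed auto
  qed
qed

lemma AE_weight_pts: "AE \<omega> in M. \<xi> \<omega> \<in> weight_pts"
proof (rule M.cond_law_AE[OF \<xi>_given_D])
  show "{m \<in> space (measure_algebra G). m \<in> weight_pts} \<in> sets (measure_algebra G)"
    using atomic_masses_sets[of "{0<..1}"] by simp
  show "AE \<omega> in M. AE m in \<kappa> (D \<omega>). m \<in> weight_pts"
    using D_pos by eventually_elim (rule crm_law_weight_pts[OF \<kappa>])
qed

lemma simple_pts_sets: "simple_pts \<in> sets (measure_algebra G)"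
  by (rule atomic_masses_sets) simp

lemma AE_simple_pts: "AE \<omega> in M. \<forall>i. X i \<omega> \<in> simple_pts"
proof (rule M.cond_law_AE[OF X_given_\<xi>, of "\<lambda>\<pi>. \<forall>i. \<pi> i \<in> simple_pts"])
  have [measurable]: "Measurable.pred (PiM UNIV (\<lambda>_::nat. measure_algebra G)) (\<lambda>\<pi>. \<pi> i \<in> simple_pts)" for i
    using simple_pts_sets by measurable
  show "{\<pi> \<in> space (PiM UNIV (\<lambda>_. measure_algebra G)). \<forall>i. \<pi> i \<in> simple_pts} \<in> sets (PiM UNIV (\<lambda>_::nat. measure_algebra G))"
    by measurable
  show "AE \<omega> in M. AE \<pi> in PiM UNIV (\<lambda>_::nat. BeP (\<xi> \<omega>)). \<forall>i. \<pi> i \<in> simple_pts"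
    using AE_weight_pts by eventually_elim (rule BeP_simple)
qed

text \<open>The weight \<open>k (D)\<close> is rewritten as a function of \<open>\<xi>\<close>,
  which permits integrating out the sample given \<open>\<xi>\<close>. It is then turned back into a
  function of D, and \<open>\<xi>\<close> is integrated out given D.\<close>

lemma sample_laplace:
  assumes k [measurable]: "k \<in> borel_measurable borel"
    and l: "\<And>Z. Z \<subseteq> {..<n} \<Longrightarrow> l Z \<in> borel_measurable G" and l0: "\<And>x. l {} x = 0"
  shows "(\<integral>\<^sup>+\<omega>. k (D \<omega>) * nexp (obs_sum n l (\<lambda>i. X i \<omega>)) \<partial>M)
    = (\<integral>\<^sup>+\<omega>. k (D \<omega>) * nexp (ennreal (D \<omega> powr (- \<alpha>)) * rate n l) \<partial>M)"
proof -
  have m1: "(\<lambda>\<pi>. nexp (obs_sum n l \<pi>)) \<in> borel_measurable (PiM UNIV (\<lambda>_. measure_algebra G))"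
    using measurable_obs_sum[of n l UNIV, OF l] by measurable
  have m2: "(\<lambda>m. nexp (atom_sum (\<lambda>w x. nlog (thin n l w x)) m)) \<in> borel_measurable (measure_algebra G)"
  proof -
    have "(\<lambda>(w, x). nlog (thin n l w x)) \<in> borel_measurable (borel \<Otimes>\<^sub>M G)"
      using measurable_compose[OF measurable_thin[of n l, OF l] nlog_measurable] by (simp add: split_def)
    from measurable_atom_sum[OF this] show ?thesis by measurable
  qed
  have "(\<integral>\<^sup>+\<omega>. k (D \<omega>) * nexp (obs_sum n l (\<lambda>i. X i \<omega>)) \<partial>M)
      = (\<integral>\<^sup>+\<omega>. k (recover_scale (\<xi> \<omega>)) * nexp (obs_sum n l (\<lambda>i. X i \<omega>)) \<partial>M)"
    using AE_recover_scale by (intro nn_integral_cong_AE, eventually_elim) simp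
  also have "\<dots> = (\<integral>\<^sup>+\<omega>. k (recover_scale (\<xi> \<omega>)) * (\<integral>\<^sup>+\<pi>. nexp (obs_sum n l \<pi>) \<partial>PiM UNIV (\<lambda>_. BeP (\<xi> \<omega>))) \<partial>M)"
    by (rule M.cond_law_nn_integral[OF X_given_\<xi> m1]) measurable
  also have "\<dots> = (\<integral>\<^sup>+\<omega>. k (D \<omega>) * nexp (atom_sum (\<lambda>w x. nlog (thin n l w x)) (\<xi> \<omega>)) \<partial>M)"
    using AE_recover_scale AE_weight_pts
    by (intro nn_integral_cong_AE, eventually_elim) (simp add: BeP_laplace[where n=n and l=l, OF _ l l0])
  also have "\<dots> = (\<integral>\<^sup>+\<omega>. k (D \<omega>) * (\<integral>\<^sup>+m. nexp (atom_sum (\<lambda>w x. nlog (thin n l w x)) m) \<partial>\<kappa> (D \<omega>)) \<partial>M)"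
    by (rule M.cond_law_nn_integral[OF \<xi>_given_D m2]) measurable
  also have "\<dots> = (\<integral>\<^sup>+\<omega>. k (D \<omega>) * nexp (ennreal (D \<omega> powr (- \<alpha>)) * rate n l) \<partial>M)"
    using D_pos by (intro nn_integral_cong_AE, eventually_elim) (simp add: crm_law_thin[OF \<kappa> _ l])
  finally show ?thesis .
qed

text \<open>The probability, at scale a, that the Poisson part of the prediction avoids B;
  \<open>reobs_void\<close> is that of the re-observed part.\<close>

definition new_void :: "nat \<Rightarrow> 'u set \<Rightarrow> real \<Rightarrow> ennreal" where
  "new_void n B a = nexp (ennreal (a powr (- \<alpha>) * new_rate n) * emeasure G B)"

definition reobs_void :: "nat \<Rightarrow> 'u set \<Rightarrow> (nat \<Rightarrow> 'u measure) \<Rightarrow> ennreal" where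
  "reobs_void n B \<pi> = nexp (obs_sum n (reobs_penalty n B) \<pi>)"

lemma measurable_new_void [measurable]: "new_void n B \<in> borel_measurable borel"
  unfolding new_void_def[abs_def] by measurable

lemma measurable_reobs_void [measurable]:
  assumes "B \<in> sets G"
  shows "reobs_void n B \<in> borel_measurable (samples n)"
  unfolding reobs_void_def[abs_def]
  using measurable_obs_sum[of n "reobs_penalty n B" "{..<n}", OF measurable_reobs_penalty[OF assms] subset_refl]
  by measurable

lemma new_rate_nonneg: "0 \<le> new_rate n"
proof -
  have "0 \<le> Beta (1 - \<alpha>) (real n + 1)"
    unfolding Beta_def using \<alpha> by (intro divide_nonneg_nonneg mult_nonneg_nonneg Gamma_real_nonneg) auto
  then show ?thesis using \<alpha> by (simp add: new_rate_def)
qed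

text \<open>Both sides are Laplace functionals: on the left of n + 1 samples with last avoidance set
  B, on the right of n samples with the extra \<open>reobs_penalty\<close>. Their exponents differ
  by exactly that of \<open>new_void\<close>, by \<open>rate_Suc\<close>.\<close>

lemma sample_void_box:
  assumes A: "\<And>i. i < n \<Longrightarrow> A i \<in> sets G" and B [measurable]: "B \<in> sets G"
    and C: "C = {\<pi>\<in>space (samples n). \<forall>i<n. emeasure (\<pi> i) (A i) = 0}"
  shows "(\<integral>\<^sup>+\<omega>. indicator C (sample n X \<omega>) * (if emeasure (X n \<omega>) B = 0 then 1 else 0) \<partial>M)
    = (\<integral>\<^sup>+\<omega>. indicator C (sample n X \<omega>) * (reobs_void n B (sample n X \<omega>) * new_void n B (D \<omega>)) \<partial>M)"
proof -
  let ?A = "A(n := B)"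
  let ?l = "\<lambda>Z x. void_penalty A Z x + reobs_penalty n B Z x"
  have A': "?A i \<in> sets G" if "i < Suc n" for i using A B that by auto
  have l: "?l Z \<in> borel_measurable G" if "Z \<subseteq> {..<n}" for Z
    by (intro borel_measurable_add measurable_void_penalty[OF that] measurable_reobs_penalty A B)
  have in_C: "sample n X \<omega> \<in> C \<longleftrightarrow> (\<forall>i<n. emeasure (X i \<omega>) (A i) = 0)" if "\<omega> \<in> space M" for \<omega>
    using measurable_space[OF measurable_sample that] by (auto simp: C sample_def)
  have "(\<integral>\<^sup>+\<omega>. indicator C (sample n X \<omega>) * (if emeasure (X n \<omega>) B = 0 then 1 else 0) \<partial>M)
      = (\<integral>\<^sup>+\<omega>. 1 * nexp (obs_sum (Suc n) (void_penalty ?A) (\<lambda>i. X i \<omega>)) \<partial>M)"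
  proof (rule nn_integral_cong_AE, use AE_simple_pts AE_space[of M] in eventually_elim)
    case (elim \<omega>)
    have "nexp (obs_sum (Suc n) (void_penalty ?A) (\<lambda>i. X i \<omega>)) = (if \<forall>i<Suc n. emeasure (X i \<omega>) (?A i) = 0 then 1 else 0)"
      by (rule nexp_obs_sum_void) (use elim A' in auto)
    also have "(\<forall>i<Suc n. emeasure (X i \<omega>) (?A i) = 0) \<longleftrightarrow> sample n X \<omega> \<in> C \<and> emeasure (X n \<omega>) B = 0"
      unfolding in_C[OF elim(2)] by (auto simp: less_Suc_eq)
    finally have e: "nexp (obs_sum (Suc n) (void_penalty ?A) (\<lambda>i. X i \<omega>)) = (if sample n X \<omega> \<in> C \<and> emeasure (X n \<omega>) B = 0 then 1 else 0)" .
    show ?case unfolding e by (simp add: indicator_def)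
  qed
  also have "\<dots> = (\<integral>\<^sup>+\<omega>. 1 * nexp (ennreal (D \<omega> powr (- \<alpha>)) * rate (Suc n) (void_penalty ?A)) \<partial>M)"
  proof (rule sample_laplace)
    show "void_penalty ?A Z \<in> borel_measurable G" if "Z \<subseteq> {..<Suc n}" for Z
      using that A' by (rule measurable_void_penalty)
  qed (simp_all del: fun_upd_apply)
  also have "\<dots> = (\<integral>\<^sup>+\<omega>. new_void n B (D \<omega>) * nexp (ennreal (D \<omega> powr (- \<alpha>)) * rate n ?l) \<partial>M)"
    using new_rate_nonneg
    by (intro nn_integral_cong)
       (simp add: rate_Suc[OF A B] new_void_def nexp_add distrib_left ennreal_mult' mult_ac)
  \<comment> \<open>The Laplace formula read backwards, with \<open>new_void n B\<close> as the
    weight depending on D.\<close>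
  also have "\<dots> = (\<integral>\<^sup>+\<omega>. new_void n B (D \<omega>) * nexp (obs_sum n ?l (\<lambda>i. X i \<omega>)) \<partial>M)"
  proof (rule sample_laplace[symmetric])
    show "?l Z \<in> borel_measurable G" if "Z \<subseteq> {..<n}" for Z
      using that by (rule l)
  qed (simp_all add: reobs_penalty_def)
  also have "\<dots> = (\<integral>\<^sup>+\<omega>. indicator C (sample n X \<omega>) * (reobs_void n B (sample n X \<omega>) * new_void n B (D \<omega>)) \<partial>M)"
  proof (rule nn_integral_cong_AE, use AE_simple_pts AE_space[of M] in eventually_elim)
    case (elim \<omega>)
    have "obs_sum n ?l (\<lambda>i. X i \<omega>) = obs_sum n (void_penalty A) (\<lambda>i. X i \<omega>) + obs_sum n (reobs_penalty n B) (\<lambda>i. X i \<omega>)"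
      by (rule obs_sum_add) (use elim A B in \<open>auto intro: measurable_void_penalty\<close>)
    moreover have "nexp (obs_sum n (void_penalty A) (\<lambda>i. X i \<omega>)) = indicator C (sample n X \<omega>)"
      using elim A by (subst nexp_obs_sum_void) (auto simp: in_C indicator_def)
    moreover have "obs_sum n (reobs_penalty n B) (\<lambda>i. X i \<omega>) = obs_sum n (reobs_penalty n B) (sample n X \<omega>)"
      by (rule obs_sum_cong) (simp add: sample_def)
    ultimately show ?case by (simp add: nexp_add reobs_void_def mult_ac)
  qed
  finally show ?thesis .
qed

text \<open>Avoidance boxes are closed under intersection, so two weighted laws of the sample that
  agree on them agree on the sigma-algebra they generate. The sample almost surely consists of
  simple measures, which brings in every measurable C.\<close>

lemma sample_void:
  assumes B [measurable]: "B \<in> sets G" and C: "C \<in> sets (samples n)"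
  shows "(\<integral>\<^sup>+\<omega>. indicator C (sample n X \<omega>) * (if emeasure (X n \<omega>) B = 0 then 1 else 0) \<partial>M)
    = (\<integral>\<^sup>+\<omega>. indicator C (sample n X \<omega>) * (reobs_void n B (sample n X \<omega>) * new_void n B (D \<omega>)) \<partial>M)"
proof -
  let ?S = "space (samples n)"
  \<comment> \<open>The two weighted laws are pushed to this smaller sigma-algebra, on which the
    boxes determine them.\<close>
  let ?N = "sigma ?S (void_boxes n)"
  have V: "void_boxes n \<subseteq> Pow ?S" by (auto simp: void_boxes_def)
  have sN: "sets ?N = sigma_sets ?S (void_boxes n)" and spN: "space ?N = ?S"
    using V by (auto simp: sets_measure_of space_measure_of)
  have sub: "sets ?N \<subseteq> sets (samples n)"
    unfolding sN by (rule sets.sigma_sets_subset[OF void_boxes_sub])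
  have mN: "sample n X \<in> M \<rightarrow>\<^sub>M ?N"
    using measurable_sample[of n] sub by (auto simp: measurable_def spN)
  define f where "f \<omega> = (if emeasure (X n \<omega>) B = 0 then 1 else 0 :: ennreal)" for \<omega>
  define g where "g \<omega> = reobs_void n B (sample n X \<omega>) * new_void n B (D \<omega>)" for \<omega>
  have fm [measurable]: "f \<in> borel_measurable M"
  proof -
    have [measurable]: "(\<lambda>\<omega>. emeasure (X n \<omega>) B) \<in> borel_measurable M"
      using measurable_compose[OF measurable_X measurable_emeasure_measure_algebra[OF B]] .
    show ?thesis unfolding f_def[abs_def] by measurable
  qed
  have gm [measurable]: "g \<in> borel_measurable M"
    unfolding g_def[abs_def] using measurable_compose[OF measurable_sample measurable_reobs_void[OF B]] by measurable
  have em: "emeasure (distr (density M h) ?N (sample n X)) E = (\<integral>\<^sup>+\<omega>. indicator E (sample n X \<omega>) * h \<omega> \<partial>M)"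
    if h [measurable]: "h \<in> borel_measurable M" and E: "E \<in> sets ?N" for h E
  proof -
    have "sample n X -` E \<inter> space M \<in> sets M" using measurable_sets[OF mN E] .
    then have "emeasure (distr (density M h) ?N (sample n X)) E = (\<integral>\<^sup>+\<omega>. h \<omega> * indicator (sample n X -` E \<inter> space M) \<omega> \<partial>M)"
      using E mN by (simp add: emeasure_distr emeasure_density)
    also have "\<dots> = (\<integral>\<^sup>+\<omega>. indicator E (sample n X \<omega>) * h \<omega> \<partial>M)"
      by (intro nn_integral_cong) (auto simp: indicator_def)
    finally show ?thesis .
  qed
  have box: "(\<integral>\<^sup>+\<omega>. indicator E (sample n X \<omega>) * f \<omega> \<partial>M) = (\<integral>\<^sup>+\<omega>. indicator E (sample n X \<omega>) * g \<omega> \<partial>M)"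
    if E: "E \<in> void_boxes n" for E
  proof -
    obtain A where "\<forall>i<n. A i \<in> sets G" "E = {\<pi>\<in>?S. \<forall>i<n. emeasure (\<pi> i) (A i) = 0}"
      using E by (auto simp: void_boxes_def)
    then show ?thesis unfolding f_def g_def by (intro sample_void_box) auto
  qed
  have top: "?S \<in> void_boxes n"
    unfolding void_boxes_def by (auto intro!: exI[of _ "\<lambda>_. {}"])
  have eq: "distr (density M f) ?N (sample n X) = distr (density M g) ?N (sample n X)"
  proof (rule measure_eqI_generator_eq[OF Int_stable_void_boxes V])
    fix E assume E: "E \<in> void_boxes n"
    then have "E \<in> sets ?N" unfolding sN by (rule sigma_sets.Basic)
    then show "emeasure (distr (density M f) ?N (sample n X)) E = emeasure (distr (density M g) ?N (sample n X)) E"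
      by (simp add: em box[OF E])
  next
    show "range (\<lambda>_::nat. ?S) \<subseteq> void_boxes n" using top by auto
    fix i :: nat
    have "emeasure (distr (density M f) ?N (sample n X)) ?S \<le> (\<integral>\<^sup>+\<omega>. 1 \<partial>M)"
      by (subst em, rule fm, simp add: sN sigma_sets.Basic top, rule nn_integral_mono)
         (simp add: f_def indicator_def)
    then show "emeasure (distr (density M f) ?N (sample n X)) ?S \<noteq> \<infinity>"
      by (auto simp: M.emeasure_space_1 top_unique)
  qed (auto simp: sN)
  obtain C' where C': "C' \<in> sets ?N" "C \<inter> {\<pi>. \<forall>i<n. \<pi> i \<in> simple_pts} = C' \<inter> {\<pi>. \<forall>i<n. \<pi> i \<in> simple_pts}"
    using void_boxes_generate[OF C] unfolding sN by auto
  have ind: "AE \<omega> in M. (indicator C (sample n X \<omega>) :: ennreal) = indicator C' (sample n X \<omega>)"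
    using AE_simple_pts
  proof eventually_elim
    case (elim \<omega>)
    then have "sample n X \<omega> \<in> {\<pi>. \<forall>i<n. \<pi> i \<in> simple_pts}" by (auto simp: sample_def)
    then have "sample n X \<omega> \<in> C \<longleftrightarrow> sample n X \<omega> \<in> C'" using C'(2) by blast
    then show ?case by (simp add: indicator_def)
  qed
  have "(\<integral>\<^sup>+\<omega>. indicator C (sample n X \<omega>) * f \<omega> \<partial>M) = (\<integral>\<^sup>+\<omega>. indicator C' (sample n X \<omega>) * f \<omega> \<partial>M)"
    using ind by (intro nn_integral_cong_AE, eventually_elim) simp
  also have "\<dots> = (\<integral>\<^sup>+\<omega>. indicator C' (sample n X \<omega>) * g \<omega> \<partial>M)"
    using em[OF fm C'(1)] em[OF gm C'(1)] eq by simp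
  also have "\<dots> = (\<integral>\<^sup>+\<omega>. indicator C (sample n X \<omega>) * g \<omega> \<partial>M)"
    using ind by (intro nn_integral_cong_AE, eventually_elim) simp
  finally show ?thesis by (simp add: f_def g_def)
qed

text \<open>The re-observed factor is a function of the sample and can be pulled out. The new factor
  depends on D, and its conditional expectation is the integral against Q.\<close>

lemma nn_cond_exp_void:
  assumes Q: "cond_law M (samples n) (sample n X) borel D Q" and B [measurable]: "B \<in> sets G"
  shows "AE \<omega> in M. nn_cond_exp M (M.cond_algebra (sample n X) (samples n)) (\<lambda>\<omega>. if emeasure (X n \<omega>) B = 0 then 1 else 0) \<omega>
    = reobs_void n B (sample n X \<omega>) * (\<integral>\<^sup>+a. new_void n B a \<partial>Q (sample n X \<omega>))"
proof -
  let ?F = "M.cond_algebra (sample n X) (samples n)"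
  interpret F: finite_measure_subalgebra M ?F
    by (rule M.finite_measure_subalgebra_vimage) measurable
  have gF [measurable]: "(\<lambda>\<omega>. reobs_void n B (sample n X \<omega>)) \<in> borel_measurable ?F"
    by (rule M.measurable_cond_algebra[OF measurable_sample measurable_reobs_void[OF B]])
  have [measurable]: "(\<lambda>\<omega>. emeasure (X n \<omega>) B) \<in> borel_measurable M"
    using measurable_compose[OF measurable_X measurable_emeasure_measure_algebra[OF B]] .
  have "AE \<omega> in M. reobs_void n B (sample n X \<omega>) * nn_cond_exp M ?F (\<lambda>\<omega>. new_void n B (D \<omega>)) \<omega>
      = nn_cond_exp M ?F (\<lambda>\<omega>. if emeasure (X n \<omega>) B = 0 then 1 else 0) \<omega>"
  proof (rule F.nn_cond_exp_charact)
    fix E assume E: "E \<in> sets ?F"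
    have "sample n X \<in> space M \<rightarrow> space (samples n)"
      using measurable_space[OF measurable_sample] by auto
    then obtain C where C: "C \<in> sets (samples n)" "E = sample n X -` C \<inter> space M"
      using E by (auto simp: sets_vimage_algebra2)
    have iF [measurable]: "(\<lambda>\<omega>. indicator C (sample n X \<omega>) :: ennreal) \<in> borel_measurable ?F"
      by (rule M.measurable_cond_algebra[OF measurable_sample]) (use C in simp)
    have "(\<integral>\<^sup>+\<omega>\<in>E. (if emeasure (X n \<omega>) B = 0 then 1 else 0) \<partial>M)
        = (\<integral>\<^sup>+\<omega>. indicator C (sample n X \<omega>) * (if emeasure (X n \<omega>) B = 0 then 1 else 0) \<partial>M)"
      by (intro nn_integral_cong) (auto simp: C indicator_def)
    also have "\<dots> = (\<integral>\<^sup>+\<omega>. indicator C (sample n X \<omega>) * (reobs_void n B (sample n X \<omega>) * new_void n B (D \<omega>)) \<partial>M)"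
      by (rule sample_void[OF B C(1)])
    also have "\<dots> = (\<integral>\<^sup>+\<omega>. (indicator C (sample n X \<omega>) * reobs_void n B (sample n X \<omega>)) * new_void n B (D \<omega>) \<partial>M)"
      by (simp add: mult.assoc)
    also have "\<dots> = (\<integral>\<^sup>+\<omega>. (indicator C (sample n X \<omega>) * reobs_void n B (sample n X \<omega>)) * nn_cond_exp M ?F (\<lambda>\<omega>. new_void n B (D \<omega>)) \<omega> \<partial>M)"
      by (rule F.nn_cond_exp_intg[symmetric]) measurable
    also have "\<dots> = (\<integral>\<^sup>+\<omega>\<in>E. (reobs_void n B (sample n X \<omega>) * nn_cond_exp M ?F (\<lambda>\<omega>. new_void n B (D \<omega>)) \<omega>) \<partial>M)"
      by (intro nn_integral_cong) (auto simp: C indicator_def)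
    finally show "(\<integral>\<^sup>+\<omega>\<in>E. (if emeasure (X n \<omega>) B = 0 then 1 else 0) \<partial>M)
      = (\<integral>\<^sup>+\<omega>\<in>E. (reobs_void n B (sample n X \<omega>) * nn_cond_exp M ?F (\<lambda>\<omega>. new_void n B (D \<omega>)) \<omega>) \<partial>M)" .
  qed measurable
  with M.cond_law_nn_cond_exp[OF Q measurable_new_void[of n B]] show ?thesis
    by eventually_elim simp
qed

end


section \<open>The Poisson and Beta-Bernoulli parts\<close>

lemma Beta_pos: "0 < a \<Longrightarrow> 0 < b \<Longrightarrow> 0 < Beta a (b :: real)"
  unfolding Beta_def by (intro divide_pos_pos mult_pos_pos Gamma_real_pos) auto

text \<open>The moment formula: c = 0 yields total mass 1, and c = 1 the mean.\<close>

lemma nn_integral_beta_law: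
  assumes ab: "0 < a" "0 < b" and c: "0 \<le> c"
  shows "(\<integral>\<^sup>+x. ennreal (x powr c) \<partial>beta_law a b) = ennreal (Beta (a + c) b / Beta a b)"
proof -
  have Bp: "0 < Beta a b" using ab by (rule Beta_pos)
  have "(\<integral>\<^sup>+x. ennreal (x powr c) \<partial>beta_law a b)
      = (\<integral>\<^sup>+x. ennreal (indicator {0<..<1} x * x powr (a - 1) * (1 - x) powr (b - 1) / Beta a b) * ennreal (x powr c) \<partial>lborel)"
    unfolding beta_law_def by (subst nn_integral_density) auto
  also have "\<dots> = (\<integral>\<^sup>+x. ennreal (1 / Beta a b) * (ennreal (x powr ((a + c) - 1) * (1 - x) powr (b - 1)) * indicator {0<..<1} x) \<partial>lborel)"
  proof (rule nn_integral_cong)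
    fix x :: real
    show "ennreal (indicator {0<..<1} x * x powr (a - 1) * (1 - x) powr (b - 1) / Beta a b) * ennreal (x powr c)
      = ennreal (1 / Beta a b) * (ennreal (x powr ((a + c) - 1) * (1 - x) powr (b - 1)) * indicator {0<..<1} x)"
    proof (cases "x \<in> {0<..<1}")
      case True
      have "x powr (a - 1) * x powr c = x powr ((a + c) - 1)"
        by (simp add: powr_add[symmetric] algebra_simps)
      then show ?thesis
        using True Bp by (simp add: ennreal_mult[symmetric] mult_ac)
    qed simp
  qed
  also have "\<dots> = ennreal (1 / Beta a b) * ennreal (Beta (a + c) b)"
    by (subst nn_integral_cmult, measurable) (use nn_integral_Beta[of "a + c" b] ab c in simp)
  also have "\<dots> = ennreal (Beta (a + c) b / Beta a b)"
    using Bp by (simp add: ennreal_mult'[symmetric])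
  finally show ?thesis .
qed

lemma sets_beta_law [simp, measurable_cong]: "sets (beta_law a b) = sets borel"
  by (simp add: beta_law_def)

lemma AE_beta_law: "AE x in beta_law a b. 0 < x \<and> x < 1"
  unfolding beta_law_def by (subst AE_density) (auto simp: indicator_def)

lemma prob_space_beta_law:
  assumes ab: "0 < a" "0 < b" shows "prob_space (beta_law a b)"
proof (rule prob_spaceI)
  have "emeasure (beta_law a b) (space (beta_law a b)) = (\<integral>\<^sup>+x. 1 \<partial>beta_law a b)" by simp
  also have "\<dots> = (\<integral>\<^sup>+x. ennreal (x powr 0) \<partial>beta_law a b)"
    using AE_beta_law[of a b] by (intro nn_integral_cong_AE) (auto elim!: eventually_mono)
  also have "\<dots> = 1" using nn_integral_beta_law[OF ab, of 0] Beta_pos[OF ab] by simp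
  finally show "emeasure (beta_law a b) (space (beta_law a b)) = 1" .
qed

lemma measurable_bernoulli_pmf:
  "(\<lambda>p. measure_pmf (bernoulli_pmf p)) \<in> borel \<rightarrow>\<^sub>M prob_algebra (count_space UNIV)"
proof (rule measurable_prob_algebraI)
  show "(\<lambda>p. measure_pmf (bernoulli_pmf p)) \<in> borel \<rightarrow>\<^sub>M subprob_algebra (count_space UNIV)"
  proof (rule measurable_subprob_algebra)
    fix A :: "bool set"
    \<comment> \<open>\<open>bernoulli_pmf\<close> clips its parameter to [0, 1], so the kernel is
      defined on all reals.\<close>
    have pmf: "pmf (bernoulli_pmf p) b = (if b then min 1 (max 0 p) else 1 - min 1 (max 0 p))" for p b
      by (simp add: bernoulli_pmf.rep_eq)
    have "emeasure (measure_pmf (bernoulli_pmf p)) A = (\<Sum>b\<in>A. ennreal (if b then min 1 (max 0 p) else 1 - min 1 (max 0 p)))" for p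
      by (subst emeasure_measure_pmf_finite) (auto simp: pmf intro: finite_subset[of _ UNIV])
    then show "(\<lambda>p. emeasure (measure_pmf (bernoulli_pmf p)) A) \<in> borel_measurable borel"
      by simp
  qed (auto intro: prob_space_imp_subprob_space prob_space_measure_pmf)
qed (rule prob_space_measure_pmf)

text \<open>A Bernoulli variable with random parameter is Bernoulli with the mean of that parameter,
  which is a / (a + b) for the Beta law.\<close>

lemma beta_bernoulli_law:
  assumes ab: "0 < a" "0 < b"
  shows "prob_space (beta_bernoulli_law a b)" "sets (beta_bernoulli_law a b) = UNIV"
    "emeasure (beta_bernoulli_law a b) {False} = ennreal (1 - a / (a + b))"
proof -
  have B: "beta_law a b \<in> space (prob_algebra borel)"
    using prob_space_beta_law[OF ab] by (simp add: space_prob_algebra)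
  interpret B: prob_space "beta_law a b" by (rule prob_space_beta_law[OF ab])
  show p: "prob_space (beta_bernoulli_law a b)"
    unfolding beta_bernoulli_law_def by (rule prob_space_bind'[OF B measurable_bernoulli_pmf])
  show s: "sets (beta_bernoulli_law a b) = UNIV"
    unfolding beta_bernoulli_law_def by (subst sets_bind'[OF B measurable_bernoulli_pmf]) simp
  interpret L: prob_space "beta_bernoulli_law a b" by (rule p)
  have spL: "space (beta_bernoulli_law a b) = UNIV"
    unfolding beta_bernoulli_law_def using sets_eq_imp_space_eq[OF sets_bind'[OF B measurable_bernoulli_pmf]] by simp
  have "emeasure (beta_bernoulli_law a b) {True} = (\<integral>\<^sup>+p. emeasure (measure_pmf (bernoulli_pmf p)) {True} \<partial>beta_law a b)"
    unfolding beta_bernoulli_law_def by (rule emeasure_bind_prob_algebra[OF B measurable_bernoulli_pmf]) simp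
  also have "\<dots> = (\<integral>\<^sup>+p. ennreal (p powr 1) \<partial>beta_law a b)"
    using AE_beta_law[of a b] by (intro nn_integral_cong_AE, eventually_elim) (simp add: emeasure_pmf_single)
  also have "\<dots> = ennreal (Beta (a + 1) b / Beta a b)" using ab by (subst nn_integral_beta_law) auto
  also have "Beta (a + 1) b / Beta a b = a / (a + b)"
  proof -
    have "a \<notin> \<int>\<^sub>\<le>\<^sub>0" using ab by (auto dest: nonpos_Ints_nonpos)
    from Beta_plus1_left[OF this, of b] show ?thesis
      using Beta_pos[OF ab] ab by (simp add: field_simps)
  qed
  finally have t: "emeasure (beta_bernoulli_law a b) {True} = ennreal (a / (a + b))" .
  have "emeasure (beta_bernoulli_law a b) {False} = emeasure (beta_bernoulli_law a b) (space (beta_bernoulli_law a b) - {True})"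
    by (rule arg_cong[where f="emeasure _"]) (auto simp: spL)
  also have "\<dots> = 1 - ennreal (a / (a + b))"
    by (subst emeasure_compl) (auto simp: s t L.emeasure_space_1)
  also have "\<dots> = ennreal (1 - a / (a + b))"
    using ab ennreal_minus[of "a / (a + b)" 1] by simp
  finally show "emeasure (beta_bernoulli_law a b) {False} = ennreal (1 - a / (a + b))" .
qed

lemma measurable_poisson_law:
  "(\<lambda>c. measure_pmf (poisson_law c)) \<in> borel \<rightarrow>\<^sub>M prob_algebra (count_space UNIV)"
proof (rule measurable_prob_algebraI)
  show "(\<lambda>c. measure_pmf (poisson_law c)) \<in> borel \<rightarrow>\<^sub>M subprob_algebra (count_space UNIV)"
  proof (rule measurable_subprob_algebra)
    fix A :: "nat set"
    have "emeasure (measure_pmf (poisson_law c)) A = (\<Sum>k. ennreal (if 0 < c then c ^ k / fact k * exp (- c) else if k = 0 then 1 else 0) * indicator A k)" for c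
    proof -
      have "emeasure (measure_pmf (poisson_law c)) A = (\<integral>\<^sup>+k. indicator A k \<partial>measure_pmf (poisson_law c))" by simp
      also have "\<dots> = (\<Sum>k. ennreal (pmf (poisson_law c) k) * indicator A k)"
        by (subst nn_integral_measure_pmf) (simp add: nn_integral_count_space_nat)
      moreover have "pmf (poisson_law c) k = (if 0 < c then c ^ k / fact k * exp (- c) else if k = 0 then 1 else 0)" for k
        by (simp add: poisson_law_def)
      ultimately show ?thesis by simp
    qed
    then show "(\<lambda>c. emeasure (measure_pmf (poisson_law c)) A) \<in> borel_measurable borel"
      by simp
  qed (auto intro: prob_space_imp_subprob_space prob_space_measure_pmf)
qed (rule prob_space_measure_pmf)

lemma sets_add_measure [simp]: "sets (add_measure \<mu> \<nu>) = sets \<mu>"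
  by (simp add: add_measure_def)

lemma emeasure_add_measure:
  assumes s: "sets \<nu> = sets \<mu>" and A: "A \<in> sets \<mu>"
  shows "emeasure (add_measure \<mu> \<nu>) A = emeasure \<mu> A + emeasure \<nu> A"
  unfolding add_measure_def
proof (rule emeasure_measure_of_sigma)
  show "sigma_algebra (space \<mu>) (sets \<mu>)" ..
  show "positive (sets \<mu>) (\<lambda>A. emeasure \<mu> A + emeasure \<nu> A)" by (simp add: positive_def)
  show "countably_additive (sets \<mu>) (\<lambda>A. emeasure \<mu> A + emeasure \<nu> A)"
  proof (rule countably_additiveI)
    fix F :: "nat \<Rightarrow> 'a set" assume F: "range F \<subseteq> sets \<mu>" "disjoint_family F"
    have "(\<Sum>i. emeasure \<mu> (F i) + emeasure \<nu> (F i)) = (\<Sum>i. emeasure \<mu> (F i)) + (\<Sum>i. emeasure \<nu> (F i))"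
      by (rule suminf_add[symmetric]) auto
    also have "\<dots> = emeasure \<mu> (\<Union>i. F i) + emeasure \<nu> (\<Union>i. F i)"
      using F s by (simp add: suminf_emeasure)
    finally show "(\<Sum>i. emeasure \<mu> (F i) + emeasure \<nu> (F i)) = emeasure \<mu> (\<Union>i. F i) + emeasure \<nu> (\<Union>i. F i)" .
  qed
qed (rule A)

section \<open>Poisson numbers of i.i.d. new atoms\<close>

context separated_prob_space
begin

lemma emeasure_first_points:
  assumes u: "\<And>j. u j \<in> space G" and A: "A \<in> sets G"
  shows "emeasure (distr (count_space {..<N::nat}) G u) A = (\<Sum>j<N. indicator A (u j))"
proof -
  have "emeasure (distr (count_space {..<N}) G u) A = (\<integral>\<^sup>+x. indicator A x \<partial>distr (count_space {..<N}) G u)"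
    using A by simp
  also have "\<dots> = (\<integral>\<^sup>+j. indicator A (u j) \<partial>count_space {..<N})"
    using u A by (intro nn_integral_distr) auto
  finally show ?thesis by (simp add: nn_integral_count_space_finite)
qed

lemma measurable_first_points:
  "(\<lambda>(N, u). distr (count_space {..<N::nat}) G u) \<in> count_space UNIV \<Otimes>\<^sub>M PiM UNIV (\<lambda>_. G) \<rightarrow>\<^sub>M measure_algebra G"
proof (rule measurable_measure_algebra)
  fix A assume [measurable]: "A \<in> sets G"
  let ?N = "count_space (UNIV :: nat set) \<Otimes>\<^sub>M PiM UNIV (\<lambda>_::nat. G)"
  have eq: "emeasure (case y of (N, u) \<Rightarrow> distr (count_space {..<N}) G u) A = (\<Sum>j. if j < fst y then indicator A (snd y j) else 0)"
    if "y \<in> space ?N" for y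
  proof -
    have u: "snd y j \<in> space G" for j using that by (auto simp: space_pair_measure space_PiM)
    have "(\<Sum>j. if j < fst y then indicator A (snd y j) else 0 :: ennreal) = (\<Sum>j<fst y. if j < fst y then indicator A (snd y j) else 0)"
      by (rule suminf_finite) auto
    then show ?thesis
      by (simp add: split_def emeasure_first_points[OF u])
  qed
  have "(\<lambda>y. \<Sum>j. if j < fst y then indicator A (snd y j) else 0 :: ennreal) \<in> borel_measurable ?N"
    by measurable
  then show "(\<lambda>y. emeasure (case y of (N, u) \<Rightarrow> distr (count_space {..<N}) G u) A) \<in> borel_measurable ?N"
    by (simp only: measurable_cong[OF eq])
qed auto

lemma measurable_poisson_atoms_law:
  "poisson_atoms_law G \<in> borel \<rightarrow>\<^sub>M prob_algebra (measure_algebra G)"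
proof -
  have "(\<lambda>c. measure_pmf (poisson_law c) \<Otimes>\<^sub>M PiM UNIV (\<lambda>_. G)) \<in> borel \<rightarrow>\<^sub>M prob_algebra (count_space UNIV \<Otimes>\<^sub>M PiM UNIV (\<lambda>_::nat. G))"
    using measurable_poisson_law prob_space_iid
    by (intro measurable_pair_prob measurable_const) (auto simp: space_prob_algebra)
  from measurable_compose[OF this measurable_distr_prob_space[OF measurable_first_points]]
  show ?thesis unfolding poisson_atoms_law_def[abs_def] .
qed

lemma poisson_atoms_law_space:
  "prob_space (poisson_atoms_law G r)" "sets (poisson_atoms_law G r) = sets (measure_algebra G)"
  using measurable_space[OF measurable_poisson_atoms_law, of r] by (auto simp: space_prob_algebra)

lemma void_measurable [measurable]:
  assumes "B \<in> sets G" shows "Measurable.pred (measure_algebra G) (\<lambda>m. emeasure m B = 0)"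
proof -
  have [measurable]: "(\<lambda>m. emeasure m B) \<in> borel_measurable (measure_algebra G)"
    by (rule measurable_emeasure_measure_algebra[OF assms])
  show ?thesis by measurable
qed

text \<open>Given N, the new locations avoid B with probability (1 - G B)^N; the Poisson generating
  function does the rest.\<close>

lemma poisson_atoms_law_void:
  assumes B: "B \<in> sets G" and c: "0 \<le> r"
  shows "(\<integral>\<^sup>+m. (if emeasure m B = 0 then 1 else 0) \<partial>poisson_atoms_law G r) = nexp (ennreal r * emeasure G B)"
proof -
  interpret iid: prob_space "PiM UNIV (\<lambda>_::nat. G)" by (rule prob_space_iid)
  \<comment> \<open>The exponent per location; it is \<open>\<top>\<close> when B has full
    measure.\<close>
  define v where "v = nlog (1 - emeasure G B)"
  have v: "nexp v = 1 - emeasure G B" unfolding v_def by (rule nexp_nlog) simp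
  let ?P = "measure_pmf (poisson_law r) \<Otimes>\<^sub>M PiM UNIV (\<lambda>_. G)"
  have mp: "(\<lambda>(N, u). distr (count_space {..<N}) G u) \<in> ?P \<rightarrow>\<^sub>M measure_algebra G"
    using measurable_first_points by (simp cong: measurable_cong_sets sets_pair_measure_cong)
  have f: "(\<lambda>m. if emeasure m B = 0 then 1 else 0 :: ennreal) \<in> borel_measurable (measure_algebra G)"
    using B by measurable
  have "(\<integral>\<^sup>+m. (if emeasure m B = 0 then 1 else 0) \<partial>poisson_atoms_law G r)
      = (\<integral>\<^sup>+y. (if emeasure (case y of (N, u) \<Rightarrow> distr (count_space {..<N}) G u) B = 0 then 1 else 0) \<partial>?P)"
    unfolding poisson_atoms_law_def by (rule nn_integral_distr[OF mp]) (use f in simp)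
  also have "\<dots> = (\<integral>\<^sup>+N. \<integral>\<^sup>+u. (if emeasure (distr (count_space {..<N}) G u) B = 0 then 1 else 0) \<partial>PiM UNIV (\<lambda>_. G) \<partial>measure_pmf (poisson_law r))"
  proof -
    have "(\<lambda>y. if emeasure (case y of (N, u) \<Rightarrow> distr (count_space {..<N}) G u) B = 0 then 1 else 0 :: ennreal) \<in> borel_measurable ?P"
      using measurable_compose[OF mp f] .
    from iid.nn_integral_fst[OF this] show ?thesis by simp
  qed
  also have "\<dots> = (\<integral>\<^sup>+N. nexp (v * of_nat N) \<partial>measure_pmf (poisson_law r))"
  proof (rule nn_integral_cong)
    fix N
    \<comment> \<open>Locations from index N on are free of penalty, so that the infinite product
      formula applies.\<close>
    let ?g = "\<lambda>(k::nat) x. if k < N \<and> x \<in> B then \<top> else 0 :: ennreal"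
    have gm: "?g k \<in> borel_measurable G" for k using B by measurable
    have "(\<integral>\<^sup>+u. (if emeasure (distr (count_space {..<N}) G u) B = 0 then 1 else 0) \<partial>PiM UNIV (\<lambda>_. G))
        = (\<integral>\<^sup>+u. nexp (\<Sum>k. ?g k (u k)) \<partial>PiM UNIV (\<lambda>_. G))"
    proof (rule nn_integral_cong)
      fix u assume "u \<in> space (PiM UNIV (\<lambda>_::nat. G))"
      then have u: "u k \<in> space G" for k by (auto simp: space_PiM)
      have s: "(\<Sum>k. ?g k (u k)) = (\<Sum>k<N. ?g k (u k))" by (rule suminf_finite) auto
      show "(if emeasure (distr (count_space {..<N}) G u) B = 0 then 1 else 0) = nexp (\<Sum>k. ?g k (u k))"
      proof (cases "\<exists>k<N. u k \<in> B")
        case True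
        then obtain k where k: "k < N" "u k \<in> B" by auto
        then have t: "(\<Sum>k<N. ?g k (u k)) = \<top>" by (subst sum.remove[of _ k]) auto
        have "emeasure (distr (count_space {..<N}) G u) B \<noteq> 0"
          using k by (auto simp: emeasure_first_points[OF u B] intro!: bexI[of _ k])
        then show ?thesis unfolding s t by simp
      next
        case False
        then show ?thesis unfolding s by (simp add: emeasure_first_points[OF u B])
      qed
    qed
    also have "\<dots> = nexp (\<Sum>k. nlog (\<integral>\<^sup>+x. nexp (?g k x) \<partial>G))"
      by (rule nn_integral_PiM_nexp[OF gm])
    also have "(\<Sum>k. nlog (\<integral>\<^sup>+x. nexp (?g k x) \<partial>G)) = (\<Sum>k. if k < N then v else 0)"
    proof (rule arg_cong[where f=suminf], rule ext)
      fix k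
      show "nlog (\<integral>\<^sup>+x. nexp (?g k x) \<partial>G) = (if k < N then v else 0)"
      proof (cases "k < N")
        case True
        have "(\<integral>\<^sup>+x. nexp (?g k x) \<partial>G) = (\<integral>\<^sup>+x. indicator (space G - B) x \<partial>G)"
          using True by (intro nn_integral_cong) (auto simp: indicator_def)
        also have "\<dots> = 1 - emeasure G B"
          using B by (simp add: emeasure_compl emeasure_space_1)
        finally show ?thesis using True by (simp add: v_def)
      qed (simp add: emeasure_space_1)
    qed
    also have "(\<Sum>k. if k < N then v else 0) = (\<Sum>k<N. if k < N then v else 0)" by (rule suminf_finite) auto
    also have "\<dots> = v * of_nat N" by (simp add: mult.commute)
    finally show "(\<integral>\<^sup>+u. (if emeasure (distr (count_space {..<N}) G u) B = 0 then 1 else 0) \<partial>PiM UNIV (\<lambda>_. G)) = nexp (v * of_nat N)" .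
  qed
  also have "\<dots> = nexp ((1 - nexp v) * ennreal r)" by (rule nn_integral_poisson_law_nexp[OF c])
  also have "1 - nexp v = emeasure G B"
    unfolding v using prob_le_1[of B] by (simp add: emeasure_eq_measure ennreal_minus flip: ennreal_1)
  finally show ?thesis by (simp add: mult.commute)
qed

text \<open>Independent locations with a non-atomic law are almost surely distinct, so all atoms
  have mass 1.\<close>

lemma poisson_atoms_law_simple: "AE m in poisson_atoms_law G r. m \<in> simple_pts"
proof -
  interpret iid: prob_space "PiM UNIV (\<lambda>_::nat. G)" by (rule prob_space_iid)
  let ?P = "measure_pmf (poisson_law r) \<Otimes>\<^sub>M PiM UNIV (\<lambda>_. G)"
  interpret pair_sigma_finite "measure_pmf (poisson_law r)" "PiM UNIV (\<lambda>_::nat. G)" ..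
  have mp: "(\<lambda>(N, u). distr (count_space {..<N}) G u) \<in> ?P \<rightarrow>\<^sub>M measure_algebra G"
    using measurable_first_points by (simp cong: measurable_cong_sets sets_pair_measure_cong)
  have S: "{m \<in> space (measure_algebra G). m \<in> simple_pts} \<in> sets (measure_algebra G)"
    using atomic_masses_sets[of "{1}"] by simp
  have simp: "distr (count_space {..<N::nat}) G u \<in> simple_pts" if u: "\<And>k. u k \<in> space G" and inj: "inj u" for N u
  proof (rule simple_ptsI(1)[where F="u ` {..<N}"])
    fix A assume A: "A \<in> sets G"
    have "(\<Sum>j<N. indicator A (u j)) = (\<Sum>x\<in>u ` {..<N}. indicator A x :: ennreal)"
      using inj by (subst sum.reindex) (auto intro: inj_on_subset)
    also have "\<dots> = (\<Sum>x\<in>u ` {..<N}. if x \<in> A then 1 else 0)"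
      by (intro sum.cong) auto
    also have "\<dots> = of_nat (card (u ` {..<N} \<inter> A))"
      by (simp add: sum.inter_restrict[symmetric])
    finally show "emeasure (distr (count_space {..<N}) G u) A = of_nat (card (u ` {..<N} \<inter> A))"
      by (simp add: emeasure_first_points[OF u A])
  qed (use u in auto)
  show ?thesis
    unfolding poisson_atoms_law_def
  proof (subst AE_distr_iff[OF mp S])
    have "AE u in PiM UNIV (\<lambda>_. G). distr (count_space {..<N}) G u \<in> simple_pts" for N :: nat
      using AE_PiM_inj AE_space[of "PiM UNIV (\<lambda>_::nat. G)"]
      by eventually_elim (rule simp, auto simp: space_PiM)
    then have "AE N in measure_pmf (poisson_law r). AE u in PiM UNIV (\<lambda>_. G). distr (count_space {..<N}) G u \<in> simple_pts"
      by (rule AE_I2)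
    moreover have "{y \<in> space ?P. distr (count_space {..<fst y}) G (snd y) \<in> simple_pts} \<in> sets ?P"
    proof -
      have "{y \<in> space ?P. distr (count_space {..<fst y}) G (snd y) \<in> simple_pts} = (\<lambda>(N, u). distr (count_space {..<N}) G u) -` simple_pts \<inter> space ?P"
        by auto
      then show ?thesis using measurable_sets[OF mp atomic_masses_sets[of "{1}"]] by simp
    qed
    ultimately show "AE y in ?P. (case y of (N, u) \<Rightarrow> distr (count_space {..<N}) G u) \<in> simple_pts"
      using AE_pair_iff[of "\<lambda>N u. distr (count_space {..<N}) G u \<in> simple_pts"] by (simp add: split_def)
  qed
qed

end


section \<open>The predictive_cond_law kernel\<close>

context separated_prob_space
begin

text \<open>Renyi's uniqueness theorem: avoidance events are closed under intersection, and on
  simple measures they generate all events.\<close>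

lemma prob_measure_eqI_void:
  assumes N: "prob_space N" "prob_space N'" "sets N = sets (measure_algebra G)" "sets N' = sets (measure_algebra G)"
    and s: "AE m in N. m \<in> simple_pts" "AE m in N'. m \<in> simple_pts"
    and eq: "\<And>B. B \<in> sets G \<Longrightarrow> (\<integral>\<^sup>+m. (if emeasure m B = 0 then 1 else 0) \<partial>N) = (\<integral>\<^sup>+m. (if emeasure m B = 0 then 1 else 0) \<partial>N')"
  shows "N = N'"
proof (rule measure_eqI)
  let ?S = "space (measure_algebra G)"
  let ?V = "sigma ?S void_sets"
  interpret N: prob_space N by fact
  interpret N': prob_space N' by fact
  have V: "void_sets \<subseteq> Pow ?S" by (auto simp: void_sets_def)
  have sV: "sets ?V = sigma_sets ?S void_sets" and spV: "space ?V = ?S"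
    using V by (auto simp: sets_measure_of space_measure_of)
  have sub: "sets ?V \<subseteq> sets (measure_algebra G)"
    unfolding sV by (rule sets.sigma_sets_subset[OF void_sets_sub])
  have id: "(\<lambda>m. m) \<in> N \<rightarrow>\<^sub>M ?V" "(\<lambda>m. m) \<in> N' \<rightarrow>\<^sub>M ?V"
    using sub N(3,4) sets_eq_imp_space_eq[OF N(3)] sets_eq_imp_space_eq[OF N(4)]
    by (auto simp: measurable_def spV)
  have sp: "space N = ?S" "space N' = ?S" using N(3,4) by (auto dest: sets_eq_imp_space_eq)
  have em: "emeasure K {m\<in>?S. emeasure m B = 0} = (\<integral>\<^sup>+m. (if emeasure m B = 0 then 1 else 0) \<partial>K)"
    if K: "sets K = sets (measure_algebra G)" and B: "B \<in> sets G" for K B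
  proof -
    have "{m\<in>?S. emeasure m B = 0} \<in> sets K"
      using void_sets_sub B K by (auto simp: void_sets_def)
    then have "emeasure K {m\<in>?S. emeasure m B = 0} = (\<integral>\<^sup>+m. indicator {m\<in>?S. emeasure m B = 0} m \<partial>K)" by simp
    also have "\<dots> = (\<integral>\<^sup>+m. (if emeasure m B = 0 then 1 else 0) \<partial>K)"
      using sets_eq_imp_space_eq[OF K] by (intro nn_integral_cong) (auto simp: indicator_def)
    finally show ?thesis .
  qed
  have d: "emeasure (distr N ?V (\<lambda>m. m)) E = emeasure N E" "emeasure (distr N' ?V (\<lambda>m. m)) E = emeasure N' E"
    if "E \<in> sets ?V" for E
    using that id sub sets.sets_into_space[of E ?V]
    by (auto simp: emeasure_distr sp spV Int_absorb2)
  have "distr N ?V (\<lambda>m. m) = distr N' ?V (\<lambda>m. m)"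
  proof (rule measure_eqI_generator_eq[OF Int_stable_void_sets V])
    fix E assume E: "E \<in> void_sets"
    then obtain B where B: "B \<in> sets G" "E = {m\<in>?S. emeasure m B = 0}" by (auto simp: void_sets_def)
    have "E \<in> sets ?V" unfolding sV using E by (rule sigma_sets.Basic)
    then show "emeasure (distr N ?V (\<lambda>m. m)) E = emeasure (distr N' ?V (\<lambda>m. m)) E"
      using eq[OF B(1)] N by (simp add: d em[OF N(3) B(1)] em[OF N(4) B(1)] B(2))
  next
    have "{m\<in>?S. emeasure m {} = 0} \<in> void_sets" unfolding void_sets_def by blast
    then have top: "?S \<in> void_sets" by simp
    then show "range (\<lambda>_::nat. ?S) \<subseteq> void_sets" by auto
    have "?S \<in> sets ?V" unfolding sV using top by (rule sigma_sets.Basic)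
    then show "emeasure (distr N ?V (\<lambda>m. m)) ?S \<noteq> \<infinity>" by (simp add: d)
  qed (auto simp: sV)
  then have eqV: "emeasure N E = emeasure N' E" if "E \<in> sets ?V" for E
    using d[OF that] by simp
  show "sets N = sets N'" using N by simp
  fix B assume "B \<in> sets N"
  then have B: "B \<in> sets (measure_algebra G)" using N by simp
  then obtain B' where B': "B' \<in> sets ?V" "B \<inter> simple_pts = B' \<inter> simple_pts"
    using void_sets_generate[OF B] unfolding sV by auto
  have B'm: "B' \<in> sets (measure_algebra G)" using B'(1) sub by auto
  have "emeasure N B = emeasure N B'"
    by (rule emeasure_eq_AE) (use s(1) B B'm B'(2) N in \<open>auto elim!: eventually_mono\<close>)
  also have "\<dots> = emeasure N' B'" by (rule eqV[OF B'(1)])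
  also have "\<dots> = emeasure N' B"
    by (rule emeasure_eq_AE) (use s(2) B B'm B'(2) N in \<open>auto elim!: eventually_mono\<close>)
  finally show "emeasure N B = emeasure N' B" .
qed

end

section \<open>The predictive law given the sample\<close>

context gd_sample
begin

text \<open>The integrand of \<open>predictive_law\<close>, at a fixed value a of the mixing
  variable.\<close>

definition predictive_kernel :: "nat \<Rightarrow> (nat \<Rightarrow> 'u measure) \<Rightarrow> real \<Rightarrow> 'u measure measure" where
  "predictive_kernel n \<pi> a = distr
     (poisson_atoms_law G (a powr (-\<alpha>) * \<alpha> * Beta (1 - \<alpha>) (real n + 1)) \<Otimes>\<^sub>M
      PiM (observed n \<pi>) (\<lambda>x. beta_bernoulli_law (real (multiplicity_of n \<pi> x) - \<alpha>)
                                                (real n - real (multiplicity_of n \<pi> x) + 1)))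
     (measure_algebra G)
     (\<lambda>(\<nu>, z). add_measure \<nu> (distr (count_space {x \<in> observed n \<pi>. z x}) G (\<lambda>x. x)))"

context
  fixes n :: nat and \<pi> :: "nat \<Rightarrow> 'u measure"
  assumes \<pi>: "\<And>i. i < n \<Longrightarrow> \<pi> i \<in> simple_pts"
begin

abbreviation (input) "obs \<equiv> observed n \<pi>"
abbreviation (input) "re_obs x \<equiv> beta_bernoulli_law (real (multiplicity_of n \<pi> x) - \<alpha>) (real n - real (multiplicity_of n \<pi> x) + 1)"
abbreviation (input) "reseen z \<equiv> distr (count_space {x \<in> obs. z x}) G (\<lambda>x. x)"

text \<open>Finitely many points under a non-atomic law form a null set, so new atoms almost surely
  miss the old ones.\<close>

lemma obs: "finite obs" "obs \<subseteq> space G" "obs \<in> sets G" "emeasure G obs = 0"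
proof -
  show f: "finite obs" and s: "obs \<subseteq> space G"
    using finite_observed[of n \<pi>] observed_sub[of n \<pi>] \<pi> by auto
  show "obs \<in> sets G"
  proof (rule sets.countable)
    show "{x} \<in> sets G" if "x \<in> obs" for x using that s by (intro singleton_sets) blast
  qed (rule countable_finite[OF f])
  have "emeasure G obs = (\<Sum>x\<in>obs. emeasure G {x})"
    using s by (intro emeasure_eq_sum_singleton f singleton_sets) auto
  also have "\<dots> = 0" using s nonatomic by (intro sum.neutral) auto
  finally show "emeasure G obs = 0" .
qed

lemma multiplicity_bounds: "x \<in> obs \<Longrightarrow> 1 \<le> multiplicity_of n \<pi> x \<and> multiplicity_of n \<pi> x \<le> n"
  using zset_eq_empty_iff[of n \<pi> x] zset_subset[of n \<pi> x] card_mono[of "{..<n}" "zset n \<pi> x"]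
  unfolding card_zset[symmetric]
  by (auto simp: Suc_le_eq card_gt_0_iff intro: finite_subset)

lemma re_obs:
  assumes x: "x \<in> obs"
  shows "prob_space (re_obs x)" "sets (re_obs x) = UNIV" "emeasure (re_obs x) {False} = ennreal (1 - reobs n (multiplicity_of n \<pi> x))"
proof -
  have ab: "0 < real (multiplicity_of n \<pi> x) - \<alpha>" "0 < real n - real (multiplicity_of n \<pi> x) + 1"
    using multiplicity_bounds[OF x] \<alpha> by linarith+
  have "(real (multiplicity_of n \<pi> x) - \<alpha>) / (real (multiplicity_of n \<pi> x) - \<alpha> + (real n - real (multiplicity_of n \<pi> x) + 1)) = reobs n (multiplicity_of n \<pi> x)"
    by (simp add: reobs_def algebra_simps)
  then show "prob_space (re_obs x)" "sets (re_obs x) = UNIV" "emeasure (re_obs x) {False} = ennreal (1 - reobs n (multiplicity_of n \<pi> x))"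
    using beta_bernoulli_law[OF ab] by auto
qed

lemma prob_space_re_obs: "prob_space (PiM obs re_obs)"
  by (rule prob_space_PiM) (rule re_obs)

lemma measurable_re_obs:
  assumes x: "x \<in> obs" shows "f \<in> re_obs x \<rightarrow>\<^sub>M N \<longleftrightarrow> f \<in> count_space UNIV \<rightarrow>\<^sub>M N" "space (re_obs x) = UNIV"
proof -
  have s: "sets (re_obs x) = sets (count_space UNIV)" using re_obs(2)[OF x] by simp
  show "f \<in> re_obs x \<rightarrow>\<^sub>M N \<longleftrightarrow> f \<in> count_space UNIV \<rightarrow>\<^sub>M N"
    by (rule arg_cong[where f="\<lambda>A. f \<in> A"], rule measurable_cong_sets[OF s refl])
  show "space (re_obs x) = UNIV" using sets_eq_imp_space_eq[OF s] by simp
qed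

lemma pred_re_obs: "x \<in> obs \<Longrightarrow> Measurable.pred (PiM obs re_obs) (\<lambda>z. z x)"
proof -
  assume x: "x \<in> obs"
  have "(\<lambda>b. b) \<in> re_obs x \<rightarrow>\<^sub>M count_space UNIV" using x by (simp add: measurable_re_obs(1))
  from measurable_compose[OF measurable_component_singleton[OF x, where M="\<lambda>x. re_obs x"] this]
  show "Measurable.pred (PiM obs re_obs) (\<lambda>z. z x)" .
qed

lemma emeasure_reseen:
  assumes A: "A \<in> sets G"
  shows "emeasure (reseen z) A = (\<Sum>x\<in>obs. if z x then indicator A x else 0)"
proof -
  have "emeasure (reseen z) A = (\<integral>\<^sup>+x. indicator A x \<partial>reseen z)" using A by simp
  also have "\<dots> = (\<integral>\<^sup>+x. indicator A x \<partial>count_space {x \<in> obs. z x})"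
    using obs A by (intro nn_integral_distr) auto
  also have "\<dots> = (\<Sum>x\<in>{x \<in> obs. z x}. indicator A x)" using obs by (simp add: nn_integral_count_space_finite)
  also have "\<dots> = (\<Sum>x\<in>obs. if z x then indicator A x else 0)"
    using obs(1) by (rule sum.inter_filter)
  finally show ?thesis .
qed

lemma emeasure_add_reseen:
  assumes "sets \<nu> = sets G" "A \<in> sets G"
  shows "emeasure (add_measure \<nu> (reseen z)) A = emeasure \<nu> A + (\<Sum>x\<in>obs. if z x then indicator A x else 0)"
  using assms by (simp add: emeasure_add_measure emeasure_reseen)

lemma measurable_add_reseen:
  "(\<lambda>(\<nu>, z). add_measure \<nu> (reseen z)) \<in> measure_algebra G \<Otimes>\<^sub>M PiM obs re_obs \<rightarrow>\<^sub>M measure_algebra G"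
proof (rule measurable_measure_algebra)
  fix y assume y: "y \<in> space (measure_algebra G \<Otimes>\<^sub>M PiM obs re_obs)"
  then have "fst y \<in> space (measure_algebra G)" by (simp only: space_pair_measure mem_Times_iff)
  then have "sets (fst y) = sets G" by (simp only: space_measure_algebra mem_Collect_eq)
  then show "sets (case y of (\<nu>, z) \<Rightarrow> add_measure \<nu> (reseen z)) = sets G"
    by (simp only: split_def sets_add_measure)
next
  fix A assume A: "A \<in> sets G"
  let ?N = "measure_algebra G \<Otimes>\<^sub>M PiM obs re_obs"
  have eq: "emeasure (case y of (\<nu>, z) \<Rightarrow> add_measure \<nu> (reseen z)) A = emeasure (fst y) A + (\<Sum>x\<in>obs. if snd y x then indicator A x else 0)"
    if "y \<in> space ?N" for y
  proof -
    have "fst y \<in> space (measure_algebra G)" using that by (simp only: space_pair_measure mem_Times_iff)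
    then have "sets (fst y) = sets G" by (simp only: space_measure_algebra mem_Collect_eq)
    then show ?thesis by (simp only: split_def emeasure_add_reseen[OF _ A])
  qed
  have [measurable]: "(\<lambda>y. emeasure (fst y) A) \<in> borel_measurable ?N"
    by (rule measurable_compose[OF measurable_fst measurable_emeasure_measure_algebra[OF A]])
  have "(\<lambda>y. if snd y x then indicator A x else 0 :: ennreal) \<in> borel_measurable ?N" if "x \<in> obs" for x
  proof -
    have [measurable]: "Measurable.pred ?N (\<lambda>y. snd y x)"
      by (rule measurable_compose[OF measurable_snd pred_re_obs[OF that]])
    show ?thesis by measurable
  qed
  then have [measurable]: "(\<lambda>y. \<Sum>x\<in>obs. if snd y x then indicator A x else 0 :: ennreal) \<in> borel_measurable ?N"
    by (rule borel_measurable_sum)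
  have "(\<lambda>y. emeasure (fst y) A + (\<Sum>x\<in>obs. if snd y x then indicator A x else 0)) \<in> borel_measurable ?N"
    by measurable
  then show "(\<lambda>y. emeasure (case y of (\<nu>, z) \<Rightarrow> add_measure \<nu> (reseen z)) A) \<in> borel_measurable ?N"
    by (simp only: measurable_cong[OF eq])
qed

lemma measurable_predictive_kernel: "predictive_kernel n \<pi> \<in> borel \<rightarrow>\<^sub>M prob_algebra (measure_algebra G)"
proof -
  have "(\<lambda>a. poisson_atoms_law G (a powr (-\<alpha>) * \<alpha> * Beta (1 - \<alpha>) (real n + 1))) \<in> borel \<rightarrow>\<^sub>M prob_algebra (measure_algebra G)"
    by (rule measurable_compose[OF _ measurable_poisson_atoms_law]) measurable
  then have "(\<lambda>a. poisson_atoms_law G (a powr (-\<alpha>) * \<alpha> * Beta (1 - \<alpha>) (real n + 1)) \<Otimes>\<^sub>M PiM obs re_obs)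
      \<in> borel \<rightarrow>\<^sub>M prob_algebra (measure_algebra G \<Otimes>\<^sub>M PiM obs re_obs)"
    using prob_space_re_obs by (intro measurable_pair_prob measurable_const) (auto simp: space_prob_algebra)
  from measurable_compose[OF this measurable_distr_prob_space[OF measurable_add_reseen]]
  show ?thesis by (simp only: predictive_kernel_def[abs_def])
qed

lemma predictive_kernel_space: "prob_space (predictive_kernel n \<pi> a)" "sets (predictive_kernel n \<pi> a) = sets (measure_algebra G)"
proof -
  have "predictive_kernel n \<pi> a \<in> space (prob_algebra (measure_algebra G))"
    by (rule measurable_space[OF measurable_predictive_kernel]) simp
  then show "prob_space (predictive_kernel n \<pi> a)" "sets (predictive_kernel n \<pi> a) = sets (measure_algebra G)"
    unfolding space_prob_algebra by blast+
qed

lemma measurable_add_reseen':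
  "(\<lambda>(\<nu>, z). add_measure \<nu> (reseen z)) \<in> poisson_atoms_law G r \<Otimes>\<^sub>M PiM obs re_obs \<rightarrow>\<^sub>M measure_algebra G"
proof -
  have "sets (poisson_atoms_law G r \<Otimes>\<^sub>M PiM obs re_obs) = sets (measure_algebra G \<Otimes>\<^sub>M PiM obs re_obs)"
    by (rule sets_pair_measure_cong[OF poisson_atoms_law_space(2) refl])
  then show ?thesis
    using measurable_add_reseen by (subst measurable_cong_sets[OF _ refl])
qed

lemma measurable_poisson_atoms_law_iff:
  "f \<in> poisson_atoms_law G r \<rightarrow>\<^sub>M N \<longleftrightarrow> f \<in> measure_algebra G \<rightarrow>\<^sub>M N"
  by (subst measurable_cong_sets[OF poisson_atoms_law_space(2) refl]) (rule refl)

lemma reobs_void_eq: "reobs_void n B \<pi> = (\<Prod>x\<in>obs. if x \<in> B then emeasure (re_obs x) {False} else 1)" if B: "B \<in> sets G"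
proof -
  have "obs_sum n (reobs_penalty n B) \<pi> = (\<Sum>x\<in>obs. reobs_penalty n B (zset n \<pi> x) x)"
    by (rule obs_sum_eq[OF \<pi> measurable_reobs_penalty[OF B]])
  then show ?thesis
    unfolding reobs_void_def
    by (simp add: nexp_sum)
       (rule prod.cong, simp, subst nexp_reobs_penalty[OF zset_subset], auto simp: zset_eq_empty_iff re_obs(3) card_zset)
qed

text \<open>The re-observed atoms avoid B iff each observed atom in B fails to reappear, and these
  failures are independent.\<close>

lemma reseen_void:
  assumes B: "B \<in> sets G"
  shows "(\<integral>\<^sup>+z. (\<Prod>x\<in>obs. if z x \<and> x \<in> B then 0 else 1) \<partial>PiM obs re_obs) = reobs_void n B \<pi>"
proof -
  interpret P: prob_space "PiM obs re_obs" by (rule prob_space_re_obs)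
  have "P.indep_vars (\<lambda>_. borel) (\<lambda>x z. if z x \<and> x \<in> B then 0 else 1 :: ennreal) obs"
    by (rule P.indep_vars_compose2[OF indep_vars_PiM_components]) (auto simp: re_obs measurable_re_obs)
  from P.indep_vars_nn_integral[OF obs(1) this]
  have "(\<integral>\<^sup>+z. (\<Prod>x\<in>obs. if z x \<and> x \<in> B then 0 else 1) \<partial>PiM obs re_obs) = (\<Prod>x\<in>obs. \<integral>\<^sup>+z. (if z x \<and> x \<in> B then 0 else 1) \<partial>PiM obs re_obs)"
    by simp
  also have "\<dots> = (\<Prod>x\<in>obs. if x \<in> B then emeasure (re_obs x) {False} else 1)"
  proof (rule prod.cong)
    fix x assume x: "x \<in> obs"
    have "(\<integral>\<^sup>+z. (if z x \<and> x \<in> B then 0 else 1) \<partial>PiM obs re_obs) = (\<integral>\<^sup>+b. (if b \<and> x \<in> B then 0 else 1) \<partial>distr (PiM obs re_obs) (re_obs x) (\<lambda>z. z x))"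
      by (rule nn_integral_distr[symmetric]) (use x in \<open>auto simp: measurable_re_obs intro: measurable_component_singleton\<close>)
    also have "distr (PiM obs re_obs) (re_obs x) (\<lambda>z. z x) = re_obs x"
      by (rule distr_PiM_component) (use re_obs x in auto)
    also have "(\<integral>\<^sup>+b. (if b \<and> x \<in> B then 0 else 1) \<partial>re_obs x) = (if x \<in> B then emeasure (re_obs x) {False} else 1)"
    proof (cases "x \<in> B")
      case True
      have "(\<integral>\<^sup>+b. (if b \<and> x \<in> B then 0 else 1) \<partial>re_obs x) = (\<integral>\<^sup>+b. indicator {False} b \<partial>re_obs x)"
        using True by (intro nn_integral_cong) (auto simp: indicator_def)
      then show ?thesis using True re_obs(2)[OF x] by simp
    next
      case False
      then show ?thesis using prob_space.emeasure_space_1[OF re_obs(1)[OF x]] by simp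
    qed
    finally show "(\<integral>\<^sup>+z. (if z x \<and> x \<in> B then 0 else 1) \<partial>PiM obs re_obs) = (if x \<in> B then emeasure (re_obs x) {False} else 1)" .
  qed simp
  finally show ?thesis by (simp add: reobs_void_eq[OF B])
qed

text \<open>A sum of two measures vanishes on B iff both do. The two parts are independent, so the
  avoidance probabilities multiply.\<close>

lemma predictive_kernel_void:
  assumes B: "B \<in> sets G"
  shows "(\<integral>\<^sup>+m. (if emeasure m B = 0 then 1 else 0) \<partial>predictive_kernel n \<pi> a) = reobs_void n B \<pi> * new_void n B a"
proof -
  define r where "r = a powr (-\<alpha>) * \<alpha> * Beta (1 - \<alpha>) (real n + 1)"
  have r: "r = a powr (- \<alpha>) * new_rate n" by (simp add: r_def new_rate_def)
  have r0: "0 \<le> r" unfolding r using new_rate_nonneg by simp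
  interpret P: prob_space "PiM obs re_obs" by (rule prob_space_re_obs)
  have f: "(\<lambda>m. if emeasure m B = 0 then 1 else 0 :: ennreal) \<in> borel_measurable (measure_algebra G)"
    using B by measurable
  have "(\<integral>\<^sup>+m. (if emeasure m B = 0 then 1 else 0) \<partial>predictive_kernel n \<pi> a)
      = (\<integral>\<^sup>+y. (if emeasure (case y of (\<nu>, z) \<Rightarrow> add_measure \<nu> (reseen z)) B = 0 then 1 else 0) \<partial>(poisson_atoms_law G r \<Otimes>\<^sub>M PiM obs re_obs))"
    unfolding predictive_kernel_def r_def[symmetric] by (rule nn_integral_distr[OF measurable_add_reseen']) (use f in simp)
  also have "\<dots> = (\<integral>\<^sup>+\<nu>. \<integral>\<^sup>+z. (if emeasure (add_measure \<nu> (reseen z)) B = 0 then 1 else 0) \<partial>PiM obs re_obs \<partial>poisson_atoms_law G r)"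
  proof -
    have "(\<lambda>y. if emeasure (case y of (\<nu>, z) \<Rightarrow> add_measure \<nu> (reseen z)) B = 0 then 1 else 0 :: ennreal) \<in> borel_measurable (poisson_atoms_law G r \<Otimes>\<^sub>M PiM obs re_obs)"
      using measurable_compose[OF measurable_add_reseen' f] .
    from P.nn_integral_fst[OF this] show ?thesis by simp
  qed
  also have "\<dots> = (\<integral>\<^sup>+\<nu>. (if emeasure \<nu> B = 0 then 1 else 0) * reobs_void n B \<pi> \<partial>poisson_atoms_law G r)"
  proof (rule nn_integral_cong)
    fix \<nu> assume "\<nu> \<in> space (poisson_atoms_law G r)"
    then have s: "sets \<nu> = sets G"
      using sets_eq_imp_space_eq[OF poisson_atoms_law_space(2)[of r]] by (auto simp: space_measure_algebra)
    have pz: "(\<lambda>z. \<Prod>x\<in>obs. if z x \<and> x \<in> B then 0 else 1 :: ennreal) \<in> borel_measurable (PiM obs re_obs)"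
    proof (rule borel_measurable_prod_ennreal)
      fix x assume "x \<in> obs"
      from pred_re_obs[OF this] have [measurable]: "Measurable.pred (PiM obs re_obs) (\<lambda>z. z x)" .
      show "(\<lambda>z. if z x \<and> x \<in> B then 0 else 1 :: ennreal) \<in> borel_measurable (PiM obs re_obs)" by measurable
    qed
    have "(\<integral>\<^sup>+z. (if emeasure (add_measure \<nu> (reseen z)) B = 0 then 1 else 0) \<partial>PiM obs re_obs)
        = (\<integral>\<^sup>+z. (if emeasure \<nu> B = 0 then 1 else 0) * (\<Prod>x\<in>obs. if z x \<and> x \<in> B then 0 else 1) \<partial>PiM obs re_obs)"
    proof (rule nn_integral_cong)
      fix z
      have "(\<Sum>x\<in>obs. if z x then indicator B x else 0 :: ennreal) = 0 \<longleftrightarrow> (\<forall>x\<in>obs. \<not> (z x \<and> x \<in> B))"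
        using obs(1) by (auto simp: sum_eq_0_iff indicator_def)
      moreover have "(\<Prod>x\<in>obs. if z x \<and> x \<in> B then 0 else 1) = (if \<forall>x\<in>obs. \<not> (z x \<and> x \<in> B) then 1 else 0 :: ennreal)"
      proof (cases "\<forall>x\<in>obs. \<not> (z x \<and> x \<in> B)")
        case True
        then show ?thesis by (auto intro!: prod.neutral)
      next
        case False
        then have "\<exists>x\<in>obs. (if z x \<and> x \<in> B then 0 else 1 :: ennreal) = 0" by auto
        then have p0: "(\<Prod>x\<in>obs. if z x \<and> x \<in> B then 0 else 1 :: ennreal) = 0" by (rule prod_zero[OF obs(1)])
        show ?thesis unfolding p0 using False by simp
      qed
      ultimately show "(if emeasure (add_measure \<nu> (reseen z)) B = 0 then 1 else 0)
          = (if emeasure \<nu> B = 0 then 1 else 0) * (\<Prod>x\<in>obs. if z x \<and> x \<in> B then 0 else 1 :: ennreal)"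
        by (simp add: emeasure_add_reseen[OF s B] add_eq_0_iff_both_eq_0)
    qed
    also have "\<dots> = (if emeasure \<nu> B = 0 then 1 else 0) * (\<integral>\<^sup>+z. (\<Prod>x\<in>obs. if z x \<and> x \<in> B then 0 else 1) \<partial>PiM obs re_obs)"
      by (rule nn_integral_cmult[OF pz])
    also have "\<dots> = (if emeasure \<nu> B = 0 then 1 else 0) * reobs_void n B \<pi>"
      by (simp only: reseen_void[OF B])
    finally show "(\<integral>\<^sup>+z. (if emeasure (add_measure \<nu> (reseen z)) B = 0 then 1 else 0) \<partial>PiM obs re_obs)
      = (if emeasure \<nu> B = 0 then 1 else 0) * reobs_void n B \<pi>" .
  qed
  also have "\<dots> = (\<integral>\<^sup>+\<nu>. (if emeasure \<nu> B = 0 then 1 else 0) \<partial>poisson_atoms_law G r) * reobs_void n B \<pi>"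
    by (rule nn_integral_multc) (simp only: measurable_poisson_atoms_law_iff f)
  also have "\<dots> = reobs_void n B \<pi> * new_void n B a"
    by (subst poisson_atoms_law_void[OF B r0]) (simp add: r new_void_def mult.commute)
  finally show ?thesis .
qed

text \<open>New and re-observed atoms almost surely do not meet, so the sum of the two simple
  measures is simple.\<close>

lemma predictive_kernel_simple: "AE m in predictive_kernel n \<pi> a. m \<in> simple_pts"
proof -
  define r where "r = a powr (-\<alpha>) * \<alpha> * Beta (1 - \<alpha>) (real n + 1)"
  have r0: "0 \<le> r" using new_rate_nonneg[of n] by (simp add: r_def new_rate_def mult.assoc)
  interpret R: prob_space "poisson_atoms_law G r" by (rule poisson_atoms_law_space)
  interpret P: prob_space "PiM obs re_obs" by (rule prob_space_re_obs)
  have S: "{m \<in> space (measure_algebra G). m \<in> simple_pts} \<in> sets (measure_algebra G)"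
    using simple_pts_sets by simp
  have fm: "(\<lambda>m. if emeasure m obs = 0 then 1 else 0 :: ennreal) \<in> borel_measurable (poisson_atoms_law G r)"
    unfolding measurable_poisson_atoms_law_iff using obs(3) by measurable
  \<comment> \<open>The observed set is null for G, so the new atoms avoid it with probability
    \<open>nexp 0\<close>, which is 1.\<close>
  have "(\<integral>\<^sup>+m. 1 - (if emeasure m obs = 0 then 1 else 0) \<partial>poisson_atoms_law G r)
      = (\<integral>\<^sup>+m. 1 \<partial>poisson_atoms_law G r) - (\<integral>\<^sup>+m. (if emeasure m obs = 0 then 1 else 0) \<partial>poisson_atoms_law G r)"
    by (rule nn_integral_diff) (use fm in \<open>auto simp: poisson_atoms_law_void[OF obs(3) r0] obs(4)\<close>)
  then have "(\<integral>\<^sup>+m. 1 - (if emeasure m obs = 0 then 1 else 0) \<partial>poisson_atoms_law G r) = 0"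
    by (simp add: poisson_atoms_law_void[OF obs(3) r0] obs(4) R.emeasure_space_1)
  then have "AE m in poisson_atoms_law G r. 1 - (if emeasure m obs = 0 then 1 else 0) = (0 :: ennreal)"
    by (subst (asm) nn_integral_0_iff_AE) (use fm in auto)
  then have void: "AE m in poisson_atoms_law G r. emeasure m obs = 0"
    by eventually_elim (auto split: if_splits)
  \<comment> \<open>Disjointness of the two atom sets rules out points of mass two.\<close>
  have ok: "add_measure \<nu> (reseen z) \<in> simple_pts" if \<nu>: "\<nu> \<in> simple_pts" and v: "emeasure \<nu> obs = 0" for \<nu> z
  proof (rule simple_ptsI(1)[where F="atoms \<nu> \<union> {x\<in>obs. z x}"])
    note s = atomic_masses_D(1)[OF \<nu>]
    show "sets (add_measure \<nu> (reseen z)) = sets G" using s by simp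
    show "finite (atoms \<nu> \<union> {x\<in>obs. z x})" using finite_atoms_simple[OF \<nu>] obs(1) by auto
    show "atoms \<nu> \<union> {x\<in>obs. z x} \<subseteq> space G" using atoms_sub[OF \<nu>] obs(2) by auto
    have disj: "atoms \<nu> \<inter> obs = {}"
      using v emeasure_simple[OF \<nu> obs(3)] finite_atoms_simple[OF \<nu>] by simp
    fix A assume A: "A \<in> sets G"
    have "(\<Sum>x\<in>obs. if z x then indicator A x else 0 :: ennreal) = (\<Sum>x\<in>{x\<in>obs. z x}. indicator A x)"
      using obs(1) by (rule sum.inter_filter[symmetric])
    also have "\<dots> = (\<Sum>x\<in>{x\<in>obs. z x}. if x \<in> A then 1 else 0)" by (intro sum.cong) auto
    also have "\<dots> = of_nat (card ({x\<in>obs. z x} \<inter> A))"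
      using obs(1) by (simp add: sum.inter_restrict[symmetric])
    finally have "emeasure (add_measure \<nu> (reseen z)) A = of_nat (card (atoms \<nu> \<inter> A) + card ({x\<in>obs. z x} \<inter> A))"
      by (simp add: emeasure_add_reseen[OF s A] emeasure_simple[OF \<nu> A])
    also have "card (atoms \<nu> \<inter> A) + card ({x\<in>obs. z x} \<inter> A) = card ((atoms \<nu> \<inter> A) \<union> ({x\<in>obs. z x} \<inter> A))"
      using disj obs(1) finite_atoms_simple[OF \<nu>] by (intro card_Un_disjoint[symmetric]) auto
    also have "(atoms \<nu> \<inter> A) \<union> ({x\<in>obs. z x} \<inter> A) = (atoms \<nu> \<union> {x\<in>obs. z x}) \<inter> A" by auto
    finally show "emeasure (add_measure \<nu> (reseen z)) A = of_nat (card ((atoms \<nu> \<union> {x\<in>obs. z x}) \<inter> A))" .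
  qed
  interpret RP: pair_sigma_finite "poisson_atoms_law G r" "PiM obs re_obs" ..
  let ?P = "poisson_atoms_law G r \<Otimes>\<^sub>M PiM obs re_obs"
  show ?thesis
    unfolding predictive_kernel_def r_def[symmetric]
  proof (subst AE_distr_iff[OF measurable_add_reseen' S])
    have "AE \<nu> in poisson_atoms_law G r. AE z in PiM obs re_obs. add_measure \<nu> (reseen z) \<in> simple_pts"
      using poisson_atoms_law_simple void by eventually_elim (intro AE_I2 ok)
    moreover have "{y \<in> space ?P. add_measure (fst y) (reseen (snd y)) \<in> simple_pts} \<in> sets ?P"
    proof -
      have "{y \<in> space ?P. add_measure (fst y) (reseen (snd y)) \<in> simple_pts} = (\<lambda>(\<nu>, z). add_measure \<nu> (reseen z)) -` simple_pts \<inter> space ?P"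
        by auto
      then show ?thesis using measurable_sets[OF measurable_add_reseen' simple_pts_sets] by simp
    qed
    ultimately show "AE y in ?P. (case y of (\<nu>, z) \<Rightarrow> add_measure \<nu> (reseen z)) \<in> simple_pts"
      using RP.AE_pair_iff[of "\<lambda>\<nu> z. add_measure \<nu> (reseen z) \<in> simple_pts"] by (simp add: split_def)
  qed
qed

text \<open>Properties of the fixed-scale kernel integrated over Q. The re-observed factor is
  constant in a and leaves the integral.\<close>

lemma predictive_law_space:
  assumes Q: "Q \<in> space (prob_algebra borel)"
  shows "predictive_law \<alpha> G n \<pi> Q \<in> space (prob_algebra (measure_algebra G))"
    "AE m in predictive_law \<alpha> G n \<pi> Q. m \<in> simple_pts"
    "B \<in> sets G \<Longrightarrow> emeasure (predictive_law \<alpha> G n \<pi> Q) {m\<in>space (measure_algebra G). emeasure m B = 0}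
      = reobs_void n B \<pi> * (\<integral>\<^sup>+a. new_void n B a \<partial>Q)"
proof -
  have p: "predictive_law \<alpha> G n \<pi> Q = Q \<bind> predictive_kernel n \<pi>"
    by (simp add: predictive_law_def predictive_kernel_def[abs_def])
  have Qs: "sets Q = sets borel" using Q by (simp add: space_prob_algebra)
  show "predictive_law \<alpha> G n \<pi> Q \<in> space (prob_algebra (measure_algebra G))"
    unfolding p space_prob_algebra using prob_space_bind'[OF Q measurable_predictive_kernel] sets_bind'[OF Q measurable_predictive_kernel] by simp
  have "predictive_kernel n \<pi> \<in> Q \<rightarrow>\<^sub>M subprob_algebra (measure_algebra G)"
    using measurable_prob_algebraD[OF measurable_predictive_kernel] Qs by (simp cong: measurable_cong_sets)
  then have "(AE m in Q \<bind> predictive_kernel n \<pi>. m \<in> simple_pts) \<longleftrightarrow> (AE a in Q. AE m in predictive_kernel n \<pi> a. m \<in> simple_pts)"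
    by (rule AE_bind) (use simple_pts_sets in measurable)
  then show "AE m in predictive_law \<alpha> G n \<pi> Q. m \<in> simple_pts"
    unfolding p by (simp add: predictive_kernel_simple)
  assume B: "B \<in> sets G"
  then have V: "{m\<in>space (measure_algebra G). emeasure m B = 0} \<in> sets (measure_algebra G)"
    by measurable
  have "emeasure (predictive_law \<alpha> G n \<pi> Q) {m\<in>space (measure_algebra G). emeasure m B = 0}
      = (\<integral>\<^sup>+a. emeasure (predictive_kernel n \<pi> a) {m\<in>space (measure_algebra G). emeasure m B = 0} \<partial>Q)"
    unfolding p by (rule emeasure_bind_prob_algebra[OF Q measurable_predictive_kernel V])
  also have "\<dots> = (\<integral>\<^sup>+a. reobs_void n B \<pi> * new_void n B a \<partial>Q)"
  proof (rule nn_integral_cong)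
    fix a
    have "emeasure (predictive_kernel n \<pi> a) {m\<in>space (measure_algebra G). emeasure m B = 0}
        = (\<integral>\<^sup>+m. indicator {m\<in>space (measure_algebra G). emeasure m B = 0} m \<partial>predictive_kernel n \<pi> a)"
      using V predictive_kernel_space(2)[of a] by simp
    also have "\<dots> = (\<integral>\<^sup>+m. (if emeasure m B = 0 then 1 else 0) \<partial>predictive_kernel n \<pi> a)"
      using sets_eq_imp_space_eq[OF predictive_kernel_space(2)[of a]] by (intro nn_integral_cong) (auto simp: indicator_def)
    finally show "emeasure (predictive_kernel n \<pi> a) {m\<in>space (measure_algebra G). emeasure m B = 0} = reobs_void n B \<pi> * new_void n B a"
      by (simp only: predictive_kernel_void[OF B])
  qed
  also have "\<dots> = reobs_void n B \<pi> * (\<integral>\<^sup>+a. new_void n B a \<partial>Q)"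
    by (rule nn_integral_cmult) (use Qs measurable_new_void in \<open>simp cong: measurable_cong_sets\<close>)
  finally show "emeasure (predictive_law \<alpha> G n \<pi> Q) {m\<in>space (measure_algebra G). emeasure m B = 0}
      = reobs_void n B \<pi> * (\<integral>\<^sup>+a. new_void n B a \<partial>Q)" .
qed

end

end


section \<open>The prediction rule\<close>

context gd_sample
begin

text \<open>Dynkin induction starting from avoidance events. Each step combines at most countably
  many almost sure identities, so the exceptional sets, which depend on the event, stay
  null.\<close>

lemma nn_cond_exp_generated:
  assumes Q: "cond_law M (samples n) (sample n X) borel D Q"
    and B: "B \<in> sigma_sets (space (measure_algebra G)) void_sets"
  shows "AE \<omega> in M. nn_cond_exp M (M.cond_algebra (sample n X) (samples n)) (\<lambda>\<omega>. indicator B (X n \<omega>)) \<omega>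
    = emeasure (predictive_law \<alpha> G n (sample n X \<omega>) (Q (sample n X \<omega>))) B"
proof -
  let ?F = "M.cond_algebra (sample n X) (samples n)"
  let ?E = "nn_cond_exp M ?F"
  let ?S = "space (measure_algebra G)"
  let ?p = "\<lambda>\<omega>. predictive_law \<alpha> G n (sample n X \<omega>) (Q (sample n X \<omega>))"
  interpret F: finite_measure_subalgebra M ?F
    by (rule M.finite_measure_subalgebra_vimage) measurable
  have V: "void_sets \<subseteq> Pow ?S" by (auto simp: void_sets_def)
  have sub: "sigma_sets ?S void_sets \<subseteq> sets (measure_algebra G)"
    by (rule sets.sigma_sets_subset[OF void_sets_sub])
  have iX: "(\<lambda>\<omega>. indicator E (X n \<omega>) :: ennreal) \<in> borel_measurable M" if "E \<in> sets (measure_algebra G)" for E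
    using measurable_compose[OF measurable_X[of n], of "indicator E :: 'u measure \<Rightarrow> ennreal" borel] that by simp
  have good: "AE \<omega> in M. (\<forall>i<n. sample n X \<omega> i \<in> simple_pts) \<and> Q (sample n X \<omega>) \<in> space (prob_algebra borel)"
    using AE_simple_pts M.cond_lawD(3)[OF Q] by eventually_elim (auto simp: sample_def)
  have one: "AE \<omega> in M. ?E (\<lambda>_. 1) \<omega> = 1"
    using F.nn_cond_exp_F_meas[of "\<lambda>_. 1"] by (auto elim!: eventually_mono)
  from Int_stable_void_sets V B show ?thesis
  proof (induction rule: sigma_sets_induct_disjoint[consumes 3])
    case (basic E)
    then obtain A where A: "A \<in> sets G" "E = {m\<in>?S. emeasure m A = 0}" by (auto simp: void_sets_def)
    have Em: "E \<in> sets (measure_algebra G)" using basic void_sets_sub by auto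
    have "(\<lambda>\<omega>. if emeasure (X n \<omega>) A = 0 then 1 else 0 :: ennreal) \<in> borel_measurable M"
      using measurable_compose[OF measurable_X[of n] void_measurable[OF A(1)]] by measurable
    then have "AE \<omega> in M. ?E (\<lambda>\<omega>. indicator E (X n \<omega>)) \<omega> = ?E (\<lambda>\<omega>. if emeasure (X n \<omega>) A = 0 then 1 else 0) \<omega>"
      using iX[OF Em] measurable_space[OF measurable_X[of n]]
      by (intro F.nn_cond_exp_cong AE_I2) (auto simp: A(2) indicator_def)
    with nn_cond_exp_void[OF Q A(1)] good show ?case
    proof eventually_elim
      case (elim \<omega>)
      have "emeasure (?p \<omega>) E = reobs_void n A (sample n X \<omega>) * (\<integral>\<^sup>+a. new_void n A a \<partial>Q (sample n X \<omega>))"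
        unfolding A(2) using elim(2) by (intro predictive_law_space(3) A(1)) auto
      then show ?case using elim by simp
    qed
  next
    case empty
    have "AE \<omega> in M. 0 = ?E (\<lambda>_. 0) \<omega>" by (rule F.nn_cond_exp_F_meas) simp
    then show ?case by eventually_elim simp
  next
    case (compl E)
    have Em: "E \<in> sets (measure_algebra G)" using compl sub by auto
    then have cE: "?S - E \<in> sets (measure_algebra G)" by auto
    have "AE \<omega> in M. ?E (\<lambda>\<omega>. indicator E (X n \<omega>)) \<omega> + ?E (\<lambda>\<omega>. indicator (?S - E) (X n \<omega>)) \<omega> = ?E (\<lambda>\<omega>. indicator E (X n \<omega>) + indicator (?S - E) (X n \<omega>)) \<omega>"
      by (rule F.nn_cond_exp_sum[OF iX[OF Em] iX[OF cE]])
    moreover have "AE \<omega> in M. ?E (\<lambda>\<omega>. indicator E (X n \<omega>) + indicator (?S - E) (X n \<omega>)) \<omega> = ?E (\<lambda>_. 1) \<omega>"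
      using iX[OF Em] iX[OF cE] measurable_space[OF measurable_X[of n]]
      by (intro F.nn_cond_exp_cong AE_I2) (auto simp: indicator_def intro!: borel_measurable_add)
    ultimately show ?case
      using compl.IH one good
    proof eventually_elim
      case (elim \<omega>)
      have p: "?p \<omega> \<in> space (prob_algebra (measure_algebra G))"
        using elim by (intro predictive_law_space(1)) auto
      then interpret K: prob_space "?p \<omega>" by (simp add: space_prob_algebra)
      have s: "sets (?p \<omega>) = sets (measure_algebra G)" using p by (simp add: space_prob_algebra)
      have "emeasure (?p \<omega>) (?S - E) = 1 - emeasure (?p \<omega>) E"
        using emeasure_compl[of E "?p \<omega>"] Em s sets_eq_imp_space_eq[OF s] K.emeasure_space_1 by simp
      moreover have "emeasure (?p \<omega>) E + ?E (\<lambda>\<omega>. indicator (?S - E) (X n \<omega>)) \<omega> = 1"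
        using elim by simp
      moreover have "emeasure (?p \<omega>) E \<noteq> \<top>" by simp
      ultimately show ?case by (metis ennreal_add_diff_cancel_left)
    qed
  next
    case (union E)
    have Em: "E i \<in> sets (measure_algebra G)" for i using union sub by auto
    have eq: "(\<Sum>i. indicator (E i) (X n \<omega>)) = (indicator (\<Union>i. E i) (X n \<omega>) :: ennreal)" for \<omega>
      by (rule suminf_indicator[OF union(1)])
    have "AE \<omega> in M. (\<Sum>i. ?E (\<lambda>\<omega>. indicator (E i) (X n \<omega>)) \<omega>) = ?E (\<lambda>\<omega>. \<Sum>i. indicator (E i) (X n \<omega>)) \<omega>"
      by (rule M.nn_cond_exp_suminf[OF measurable_sample iX[OF Em]])
    moreover have "AE \<omega> in M. \<forall>i. ?E (\<lambda>\<omega>. indicator (E i) (X n \<omega>)) \<omega> = emeasure (?p \<omega>) (E i)"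
      using union by (simp add: AE_all_countable)
    ultimately show ?case
      using good
    proof eventually_elim
      case (elim \<omega>)
      have p: "?p \<omega> \<in> space (prob_algebra (measure_algebra G))"
        using elim(3) by (intro predictive_law_space(1)) auto
      have "range E \<subseteq> sets (?p \<omega>)" using p Em by (auto simp: space_prob_algebra)
      then have "(\<Sum>i. emeasure (?p \<omega>) (E i)) = emeasure (?p \<omega>) (\<Union>i. E i)"
        using union(1) by (intro suminf_emeasure)
      then show ?case using elim(1,2) by (simp add: eq)
    qed
  qed
qed

text \<open>Both the next observation and the predictive law sit on simple measures, where any event
  coincides with one generated by avoidance events.\<close>

lemma predictive_cond_law:
  assumes Q: "cond_law M (samples n) (sample n X) borel D Q"
  shows "cond_law M (samples n) (sample n X) (measure_algebra G) (X n) (\<lambda>\<pi>. predictive_law \<alpha> G n \<pi> (Q \<pi>))"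
proof (rule M.cond_lawI)
  let ?p = "\<lambda>\<omega>. predictive_law \<alpha> G n (sample n X \<omega>) (Q (sample n X \<omega>))"
  let ?F = "M.cond_algebra (sample n X) (samples n)"
  interpret F: finite_measure_subalgebra M ?F
    by (rule M.finite_measure_subalgebra_vimage) measurable
  have good: "AE \<omega> in M. (\<forall>i<n. sample n X \<omega> i \<in> simple_pts) \<and> Q (sample n X \<omega>) \<in> space (prob_algebra borel)"
    using AE_simple_pts M.cond_lawD(3)[OF Q] by eventually_elim (auto simp: sample_def)
  then show "AE \<omega> in M. ?p \<omega> \<in> space (prob_algebra (measure_algebra G))"
    by eventually_elim (intro predictive_law_space(1), auto)
  have iX: "(\<lambda>\<omega>. indicator E (X n \<omega>) :: ennreal) \<in> borel_measurable M" if "E \<in> sets (measure_algebra G)" for E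
    using measurable_compose[OF measurable_X[of n], of "indicator E :: 'u measure \<Rightarrow> ennreal" borel] that by simp
  fix B assume B: "B \<in> sets (measure_algebra G)"
  then obtain B' where B': "B' \<in> sigma_sets (space (measure_algebra G)) void_sets" "B \<inter> simple_pts = B' \<inter> simple_pts"
    using void_sets_generate by blast
  have B'm: "B' \<in> sets (measure_algebra G)"
    using B'(1) sets.sigma_sets_subset[OF void_sets_sub] by auto
  have mem: "m \<in> B \<longleftrightarrow> m \<in> B'" if "m \<in> simple_pts" for m using B'(2) that by blast
  have "AE \<omega> in M. nn_cond_exp M ?F (\<lambda>\<omega>. indicator B (X n \<omega>)) \<omega> = nn_cond_exp M ?F (\<lambda>\<omega>. indicator B' (X n \<omega>)) \<omega>"
  proof (rule F.nn_cond_exp_cong[OF _ iX[OF B] iX[OF B'm]])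
    show "AE \<omega> in M. (indicator B (X n \<omega>) :: ennreal) = indicator B' (X n \<omega>)"
      using AE_simple_pts by eventually_elim (simp add: indicator_def mem)
  qed
  with nn_cond_exp_generated[OF Q B'(1)] good
  show "AE \<omega> in M. nn_cond_exp M ?F (\<lambda>\<omega>. indicator B (X n \<omega>)) \<omega> = emeasure (?p \<omega>) B"
  proof eventually_elim
    case (elim \<omega>)
    have g: "sample n X \<omega> i \<in> simple_pts" if "i < n" for i using elim(2) that by blast
    have Qg: "Q (sample n X \<omega>) \<in> space (prob_algebra borel)" using elim(2) by blast
    have s: "sets (?p \<omega>) = sets (measure_algebra G)"
      using predictive_law_space(1)[where n=n and \<pi>="sample n X \<omega>", OF g Qg] by (simp add: space_prob_algebra)
    have "emeasure (?p \<omega>) B = emeasure (?p \<omega>) B'"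
    proof (rule emeasure_eq_AE)
      have "AE m in ?p \<omega>. m \<in> simple_pts"
        by (rule predictive_law_space(2)[OF _ Qg]) (rule g)
      then show "AE m in ?p \<omega>. m \<in> B \<longleftrightarrow> m \<in> B'"
        by eventually_elim (rule mem)
    qed (use s B B'm in auto)
    then show ?case using elim by simp
  qed
qed measurable

text \<open>The avoidance identity for n = 0, which involves no conditional law of D. The Poisson
  mean simplifies because B(1 - \<alpha>, 1) = 1 / (1 - \<alpha>).\<close>

lemma initial_law:
  "distr M (measure_algebra G) (X 0) = M \<bind> (\<lambda>\<omega>. poisson_atoms_law G (D \<omega> powr (-\<alpha>) * \<alpha> / (1 - \<alpha>)))"
proof -
  define h where "h a = a powr (-\<alpha>) * \<alpha> / (1 - \<alpha>)" for a :: real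
  have hm [measurable]: "h \<in> borel_measurable borel" unfolding h_def[abs_def] by measurable
  have rate0: "new_rate 0 = \<alpha> / (1 - \<alpha>)"
  proof -
    have "1 - \<alpha> \<notin> \<int>\<^sub>\<le>\<^sub>0" using \<alpha> by (auto dest: nonpos_Ints_nonpos)
    then have "Gamma (1 - \<alpha> + 1) = (1 - \<alpha>) * Gamma (1 - \<alpha>)" by (rule Gamma_plus1)
    moreover have "Gamma (1 - \<alpha>) > 0" using \<alpha> by (intro Gamma_real_pos) auto
    ultimately have "Beta (1 - \<alpha>) 1 = 1 / (1 - \<alpha>)" by (simp add: Beta_def)
    then show ?thesis by (simp add: new_rate_def)
  qed
  have km: "(\<lambda>\<omega>. poisson_atoms_law G (h (D \<omega>))) \<in> M \<rightarrow>\<^sub>M prob_algebra (measure_algebra G)"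
    by (rule measurable_compose[OF _ measurable_poisson_atoms_law]) measurable
  have MM: "M \<in> space (prob_algebra M)" by (simp add: space_prob_algebra M.prob_space_axioms)
  have "distr M (measure_algebra G) (X 0) = M \<bind> (\<lambda>\<omega>. poisson_atoms_law G (h (D \<omega>)))"
  proof (rule prob_measure_eqI_void)
    show "prob_space (distr M (measure_algebra G) (X 0))" by (rule M.prob_space_distr) measurable
    show "prob_space (M \<bind> (\<lambda>\<omega>. poisson_atoms_law G (h (D \<omega>))))" by (rule prob_space_bind'[OF MM km])
    show sb: "sets (M \<bind> (\<lambda>\<omega>. poisson_atoms_law G (h (D \<omega>)))) = sets (measure_algebra G)" by (rule sets_bind'[OF MM km])
    have S: "Measurable.pred (measure_algebra G) (\<lambda>m. m \<in> simple_pts)" using simple_pts_sets by measurable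
    show "AE m in distr M (measure_algebra G) (X 0). m \<in> simple_pts"
      using AE_simple_pts simple_pts_sets by (subst AE_distr_iff[OF measurable_X]) auto
    have "(AE m in M \<bind> (\<lambda>\<omega>. poisson_atoms_law G (h (D \<omega>))). m \<in> simple_pts)
        \<longleftrightarrow> (AE \<omega> in M. AE m in poisson_atoms_law G (h (D \<omega>)). m \<in> simple_pts)"
      by (rule AE_bind[OF measurable_prob_algebraD[OF km] S])
    then show "AE m in M \<bind> (\<lambda>\<omega>. poisson_atoms_law G (h (D \<omega>))). m \<in> simple_pts"
      by (simp add: poisson_atoms_law_simple)
    fix B assume B: "B \<in> sets G"
    then have f: "(\<lambda>m. if emeasure m B = 0 then 1 else 0 :: ennreal) \<in> borel_measurable (measure_algebra G)"
      by measurable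
    have "(\<integral>\<^sup>+m. (if emeasure m B = 0 then 1 else 0) \<partial>distr M (measure_algebra G) (X 0))
        = (\<integral>\<^sup>+\<omega>. (if emeasure (X 0 \<omega>) B = 0 then 1 else 0) \<partial>M)"
      by (rule nn_integral_distr[OF measurable_X]) (use f in simp)
    \<comment> \<open>The empty sample takes only one value, so conditioning on it is trivial; as
      nothing has been observed, the re-observed factor is 1 as well.\<close>
    also have "\<dots> = (\<integral>\<^sup>+\<omega>. indicator (space (samples 0)) (sample 0 X \<omega>) * (if emeasure (X 0 \<omega>) B = 0 then 1 else 0) \<partial>M)"
      using measurable_space[OF measurable_sample[of 0]] by (intro nn_integral_cong) (auto simp: indicator_def)
    also have "\<dots> = (\<integral>\<^sup>+\<omega>. indicator (space (samples 0)) (sample 0 X \<omega>) * (reobs_void 0 B (sample 0 X \<omega>) * new_void 0 B (D \<omega>)) \<partial>M)"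
      by (rule sample_void[OF B sets.top])
    also have "\<dots> = (\<integral>\<^sup>+\<omega>. nexp (ennreal (h (D \<omega>)) * emeasure G B) \<partial>M)"
      using measurable_space[OF measurable_sample[of 0]]
      by (intro nn_integral_cong) (auto simp: indicator_def reobs_void_def obs_sum_def new_void_def rate0 h_def)
    also have "\<dots> = (\<integral>\<^sup>+\<omega>. \<integral>\<^sup>+m. (if emeasure m B = 0 then 1 else 0) \<partial>poisson_atoms_law G (h (D \<omega>)) \<partial>M)"
      using \<alpha> by (intro nn_integral_cong poisson_atoms_law_void[OF B, symmetric]) (auto simp: h_def)
    also have "\<dots> = (\<integral>\<^sup>+m. (if emeasure m B = 0 then 1 else 0) \<partial>(M \<bind> (\<lambda>\<omega>. poisson_atoms_law G (h (D \<omega>)))))"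
      by (rule nn_integral_bind[OF f measurable_prob_algebraD[OF km], symmetric])
    finally show "(\<integral>\<^sup>+m. (if emeasure m B = 0 then 1 else 0) \<partial>distr M (measure_algebra G) (X 0))
      = (\<integral>\<^sup>+m. (if emeasure m B = 0 then 1 else 0) \<partial>(M \<bind> (\<lambda>\<omega>. poisson_atoms_law G (h (D \<omega>)))))" .
  qed simp
  then show ?thesis by (simp only: h_def)
qed

end

theorem corollary3p4:
  fixes M :: "'a measure" and G :: "'u measure" and P :: "real measure" and \<alpha> :: real
    and D :: "'a \<Rightarrow> real" and \<xi> :: "'a \<Rightarrow> 'u measure" and X :: "nat \<Rightarrow> 'a \<Rightarrow> 'u measure"
  assumes "prob_space M"
    and "prob_space G" and "countably_separated G" and "\<forall>x\<in>space G. emeasure G {x} = 0"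
    and "prob_space P" and "sets P = sets borel" and "AE a in P. 0 < a"
    and "0 < \<alpha>" and "\<alpha> < 1"
    and "GD (\<lambda>s. \<alpha> * s powr (- 1 - \<alpha>)) P G M D \<xi>"
    and "cond_law M (measure_algebra G) \<xi>
           (PiM UNIV (\<lambda>_. measure_algebra G)) (\<lambda>\<omega> i. X i \<omega>)
           (\<lambda>m. PiM UNIV (\<lambda>_. BeP m))"
  shows "(\<forall>n Q.
            cond_law M (PiM {..<n} (\<lambda>_. measure_algebra G)) (sample n X) borel D Q \<longrightarrow>
            cond_law M (PiM {..<n} (\<lambda>_. measure_algebra G)) (sample n X)
              (measure_algebra G) (X n) (\<lambda>\<pi>. predictive_law \<alpha> G n \<pi> (Q \<pi>)))
       \<and> distr M (measure_algebra G) (X 0)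
            = M \<bind> (\<lambda>\<omega>. poisson_atoms_law G (D \<omega> powr (-\<alpha>) * \<alpha> / (1 - \<alpha>)))"
proof -
  obtain c where c: "separated_prob_space G c"
    using separated_prob_spaceE[OF assms(2-4)] .
  obtain \<kappa> where P: "distr M borel D = P" and \<kappa>: "scaled_kernel (\<lambda>s. \<alpha> * s powr (- 1 - \<alpha>)) G \<kappa>"
    and cl: "cond_law M borel D (measure_algebra G) \<xi> \<kappa>"
    using assms(10) by (auto simp: GD_def)
  have D: "D \<in> borel_measurable M" using cl by (simp add: cond_law_def)
  have "AE \<omega> in M. 0 < D \<omega>"
    using assms(7) by (subst (asm) P[symmetric], subst (asm) AE_distr_iff[OF D]) auto
  then interpret gd_sample G c \<alpha> M D \<xi> X \<kappa>
    using c \<kappa> cl assms(1,8,9,11)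
    by (intro gd_sample.intro stable_crm.intro stable_crm_axioms.intro gd_sample_axioms.intro)
       (simp_all add: scaled_kernel_def)
  show ?thesis using predictive_cond_law initial_law by blast
qed

end
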